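(* Let $\mathcal C$ be a braided monoidal category with braiding $\Phi$ and let $H\in\mathcal C$ be a finite Hopf algebra with a bijective antipode $S$ such that $\Phi_{H,H}$ and $\Phi_{H,H^*}$ are symmetric, i.e. $\Phi_{H,H}=\Phi_{H,H}^{-1}$ and $\Phi_{H,H^*}=\Phi_{H^*,H}^{-1}$. Let $B=(H^{op})^*$, and define $\triangleright:H\otimes B\to B$ and $\triangleleft:H\otimes B\to H$ by $$\overline{ev}\,(H\otimes\triangleright)=\overline{ev}\,\big(\nabla\Phi_{H,H}(\nabla\otimes S^{-1})(H\otimes\Delta)\otimes B\big):H\otimes H\otimes B\to I,$$ $$\triangleleft=(H\otimes\overline{ev})(H\otimes\nabla\Phi_{H,H}\otimes B)(\Phi_{H,H}^{-1}\otimes S^{-1}\otimes B)\big((\Delta\otimes H)\Delta\otimes B\big).$$ Then, with these actions, $B\bowtie H$ is a bicrossproduct; that is, $B$ and $H$ form a matched pair of bialgebras in $\mathcal C$ with respect to $\triangleright$ and $\triangleleft$.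
   Context: $\mathcal C$ is taken strict; an object name also denotes its identity morphism and composition is written by juxtaposition. $H$ has multiplication $\nabla$, unit $\eta$, comultiplication $\Delta$, counit $\varepsilon$. $H$ is finite if $[H,I]$, $[H,H]$ exist and the dual basis morphism $H\otimes[H,I]\to[H,H]$ is an isomorphism; then $H^*=[H,I]$ is a left dual of $H$ with evaluation $ev:H^*\otimes H\to I$. Put $\overline{ev}=ev\,\Phi_{H,H^*}:H\otimes H^*\to I$. $H^{op}$ is $H$ with multiplication $\nabla\Phi_{H,H}$. $B=(H^{op})^*$ is the object $H^*$ with multiplication given by $ev(\nabla_B\otimes H)=(ev\otimes ev)(H^*\otimes\Phi_{H^*,H}\otimes H)(H^*\otimes H^*\otimes\Delta)$, comultiplication given by $(ev\otimes ev)(H^*\otimes\Phi_{H^*,H}\otimes H)(\Delta_B\otimes H\otimes H)=ev(H^*\otimes\nabla\Phi_{H,H})$, unit given by $ev(\eta_B\otimes H)=\varepsilon$ and counit $\varepsilon_B=ev(H^*\otimes\eta)$. Matched pair of bialgebras: bialgebras $B$, $H$ in $\mathcal C$ such that $B$ is a left $H$-module coalgebra via $\triangleright:H\otimes B\to B$, $H$ is a right $B$-module coalgebra via $\triangleleft:H\otimes B\to H$, and, with $\Theta=(H\otimes\Phi_{H,B}\otimes B)(\Delta_H\otimes\Delta_B)$: (a) $\triangleright(H\otimes\nabla_B)=\nabla_B(B\otimes\triangleright)(\triangleright\otimes\triangleleft\otimes B)(\Theta\otimes B)$; (b) $\triangleleft(\nabla_H\otimes B)=\nabla_H(\triangleleft\otimes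 H)(H\otimes\triangleright\otimes\triangleleft)(H\otimes\Theta)$; (c) $\Phi_{B,H}(\triangleright\otimes\triangleleft)\Theta=(\triangleleft\otimes\triangleright)\Theta$; (d) $\triangleright(H\otimes\eta_B)=\eta_B\varepsilon_H$ and $\triangleleft(\eta_H\otimes B)=\eta_H\varepsilon_B$. The bicrossproduct $B\bowtie H$ is then the bialgebra $B\otimes H$ with unit $\eta_B\otimes\eta_H$, counit $\varepsilon_B\otimes\varepsilon_H$, comultiplication $(B\otimes\Phi_{B,H}\otimes H)(\Delta_B\otimes\Delta_H)$ and multiplication $(\nabla_B\otimes\nabla_H)(B\otimes\triangleright\otimes\triangleleft\otimes H)(B\otimes\Theta\otimes H)$. *)

theory Defs
  imports Main
begin

text \<open>
  Categories are presented by their arrows alone: an object is the same thing as its identity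
  arrow. A single tensor product therefore serves for objects and for arrows, and an expression
  such as \<open>H \<otimes> f\<close> is the tensor product of the identity of \<open>H\<close> with \<open>f\<close>.
  The product \<open>g \<cdot> f\<close> (first \<open>f\<close>, then \<open>g\<close>) is meaningful only if \<open>Dom g = Cod f\<close>.
\<close>

record 'a braided_cat =
  Arr :: "'a set"
  Dom :: "'a \<Rightarrow> 'a"
  Cod :: "'a \<Rightarrow> 'a"
  Comp :: "'a \<Rightarrow> 'a \<Rightarrow> 'a"  (infixr "\<cdot>\<index>" 55)
  Tensor :: "'a \<Rightarrow> 'a \<Rightarrow> 'a"  (infixr "\<otimes>\<index>" 70)
  TUnit :: 'a  ("\<one>\<index>")
  Braid :: "'a \<Rightarrow> 'a \<Rightarrow> 'a"  ("\<Phi>\<index>")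

context
  fixes C :: "'a braided_cat" (structure)
begin

definition objects :: "'a set" where
  "objects = {A \<in> Arr C. Dom C A = A \<and> Cod C A = A}"

definition hom :: "'a \<Rightarrow> 'a \<Rightarrow> 'a set" where
  "hom A B = {f \<in> Arr C. Dom C f = A \<and> Cod C f = B}"

definition inverse_arrows :: "'a \<Rightarrow> 'a \<Rightarrow> bool" where
  "inverse_arrows f g \<longleftrightarrow> f \<in> Arr C \<and> g \<in> hom (Cod C f) (Dom C f)
     \<and> g \<cdot> f = Dom C f \<and> f \<cdot> g = Cod C f"

definition is_iso :: "'a \<Rightarrow> bool" where
  "is_iso f \<longleftrightarrow> (\<exists>g. inverse_arrows f g)"

definition inv_arrow :: "'a \<Rightarrow> 'a" where
  "inv_arrow f = (THE g. inverse_arrows f g)"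

end

locale strict_braided_monoidal_category =
  fixes C :: "'a braided_cat" (structure)
  assumes Dom_object: "f \<in> Arr C \<Longrightarrow> Dom C f \<in> objects C"
    and Cod_object: "f \<in> Arr C \<Longrightarrow> Cod C f \<in> objects C"
    and comp_in_hom: "\<lbrakk>f \<in> hom C X Y; g \<in> hom C Y Z\<rbrakk> \<Longrightarrow> g \<cdot> f \<in> hom C X Z"
    and comp_assoc: "\<lbrakk>f \<in> hom C X Y; g \<in> hom C Y Z; h \<in> hom C Z W\<rbrakk>
      \<Longrightarrow> (h \<cdot> g) \<cdot> f = h \<cdot> (g \<cdot> f)"
    and comp_id_right: "f \<in> hom C X Y \<Longrightarrow> f \<cdot> X = f"
    and comp_id_left: "f \<in> hom C X Y \<Longrightarrow> Y \<cdot> f = f"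
    \<comment> \<open>For objects \<open>X\<close>, \<open>Y\<close> the next axiom puts \<open>X \<otimes> Y\<close> into its own endomorphisms, so \<open>X \<otimes> Y\<close>
      is an object; preservation of identities is thereby built in.\<close>
    and tensor_in_hom: "\<lbrakk>f \<in> hom C X Y; g \<in> hom C X' Y'\<rbrakk>
      \<Longrightarrow> f \<otimes> g \<in> hom C (X \<otimes> X') (Y \<otimes> Y')"
    and interchange: "\<lbrakk>f \<in> hom C X Y; g \<in> hom C Y Z; f' \<in> hom C X' Y'; g' \<in> hom C Y' Z'\<rbrakk>
      \<Longrightarrow> (g \<cdot> f) \<otimes> (g' \<cdot> f') = (g \<otimes> g') \<cdot> (f \<otimes> f')"
    and tensor_assoc: "\<lbrakk>f \<in> Arr C; g \<in> Arr C; h \<in> Arr C\<rbrakk>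
      \<Longrightarrow> (f \<otimes> g) \<otimes> h = f \<otimes> (g \<otimes> h)"
    and unit_object: "\<one> \<in> objects C"
    and tensor_unit_left: "f \<in> Arr C \<Longrightarrow> \<one> \<otimes> f = f"
    and tensor_unit_right: "f \<in> Arr C \<Longrightarrow> f \<otimes> \<one> = f"
    and braid_in_hom: "\<lbrakk>X \<in> objects C; Y \<in> objects C\<rbrakk> \<Longrightarrow> \<Phi> X Y \<in> hom C (X \<otimes> Y) (Y \<otimes> X)"
    and braid_iso: "\<lbrakk>X \<in> objects C; Y \<in> objects C\<rbrakk> \<Longrightarrow> is_iso C (\<Phi> X Y)"
    and braid_natural: "\<lbrakk>f \<in> hom C X Y; g \<in> hom C X' Y'\<rbrakk>
      \<Longrightarrow> \<Phi> Y Y' \<cdot> (f \<otimes> g) = (g \<otimes> f) \<cdot> \<Phi> X X'"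
    and hexagon1: "\<lbrakk>X \<in> objects C; Y \<in> objects C; Z \<in> objects C\<rbrakk>
      \<Longrightarrow> \<Phi> X (Y \<otimes> Z) = (Y \<otimes> \<Phi> X Z) \<cdot> (\<Phi> X Y \<otimes> Z)"
    and hexagon2: "\<lbrakk>X \<in> objects C; Y \<in> objects C; Z \<in> objects C\<rbrakk>
      \<Longrightarrow> \<Phi> (X \<otimes> Y) Z = (\<Phi> X Z \<otimes> Y) \<cdot> (X \<otimes> \<Phi> Y Z)"

record 'a bialg_data =
  Obj :: 'a  ("\<langle>_\<rangle>")
  Mult :: 'a  ("\<nabla>\<index>")
  Unit :: 'a  ("\<eta>\<index>")
  Comult :: 'a  ("\<Delta>\<index>")
  Counit :: 'a  ("\<epsilon>\<index>")

context
  fixes C :: "'a braided_cat" (structure)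
begin

text \<open>
  \<open>internal_hom X Y E e\<close>: the object \<open>E\<close> with evaluation \<open>e : E \<otimes> X \<rightarrow> Y\<close> is an internal hom
  \<open>[X,Y]\<close>, i.e. it represents \<open>Z \<mapsto> hom (Z \<otimes> X) Y\<close>.
\<close>

definition internal_hom :: "'a \<Rightarrow> 'a \<Rightarrow> 'a \<Rightarrow> 'a \<Rightarrow> bool" where
  "internal_hom X Y E e \<longleftrightarrow>
     X \<in> objects C \<and> Y \<in> objects C \<and> E \<in> objects C \<and> e \<in> hom C (E \<otimes> X) Y \<and>
     (\<forall>Z \<in> objects C. \<forall>f \<in> hom C (Z \<otimes> X) Y. \<exists>!g. g \<in> hom C Z E \<and> e \<cdot> (g \<otimes> X) = f)"

text \<open>
  The dual basis morphism \<open>X \<otimes> [X,\<one>] \<rightarrow> [X,X]\<close>, where \<open>(D, ev)\<close> is \<open>[X,\<one>]\<close> and \<open>(E, e)\<close> is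
  \<open>[X,X]\<close>: the transpose of \<open>X \<otimes> ev\<close>.
\<close>

definition dual_basis_morphism :: "'a \<Rightarrow> 'a \<Rightarrow> 'a \<Rightarrow> 'a \<Rightarrow> 'a \<Rightarrow> 'a" where
  "dual_basis_morphism X D ev E e =
     (THE d. d \<in> hom C (X \<otimes> D) E \<and> e \<cdot> (d \<otimes> X) = X \<otimes> ev)"

definition finite_object :: "'a \<Rightarrow> bool" where
  "finite_object X \<longleftrightarrow>
     (\<exists>D ev E e. internal_hom X \<one> D ev \<and> internal_hom X X E e \<and>
        is_iso C (dual_basis_morphism X D ev E e))"

definition algebra :: "'a bialg_data \<Rightarrow> bool" where
  "algebra X \<longleftrightarrow>
     \<langle>X\<rangle> \<in> objects C \<and> \<nabla>\<^bsub>X\<^esub> \<in> hom C (\<langle>X\<rangle> \<otimes> \<langle>X\<rangle>) \<langle>X\<rangle> \<and> \<eta>\<^bsub>X\<^esub> \<in> hom C \<one> \<langle>X\<rangle> \<and>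
     \<nabla>\<^bsub>X\<^esub> \<cdot> (\<nabla>\<^bsub>X\<^esub> \<otimes> \<langle>X\<rangle>) = \<nabla>\<^bsub>X\<^esub> \<cdot> (\<langle>X\<rangle> \<otimes> \<nabla>\<^bsub>X\<^esub>) \<and>
     \<nabla>\<^bsub>X\<^esub> \<cdot> (\<eta>\<^bsub>X\<^esub> \<otimes> \<langle>X\<rangle>) = \<langle>X\<rangle> \<and> \<nabla>\<^bsub>X\<^esub> \<cdot> (\<langle>X\<rangle> \<otimes> \<eta>\<^bsub>X\<^esub>) = \<langle>X\<rangle>"

definition coalgebra :: "'a bialg_data \<Rightarrow> bool" where
  "coalgebra X \<longleftrightarrow>
     \<langle>X\<rangle> \<in> objects C \<and> \<Delta>\<^bsub>X\<^esub> \<in> hom C \<langle>X\<rangle> (\<langle>X\<rangle> \<otimes> \<langle>X\<rangle>) \<and> \<epsilon>\<^bsub>X\<^esub> \<in> hom C \<langle>X\<rangle> \<one> \<and>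
     (\<Delta>\<^bsub>X\<^esub> \<otimes> \<langle>X\<rangle>) \<cdot> \<Delta>\<^bsub>X\<^esub> = (\<langle>X\<rangle> \<otimes> \<Delta>\<^bsub>X\<^esub>) \<cdot> \<Delta>\<^bsub>X\<^esub> \<and>
     (\<epsilon>\<^bsub>X\<^esub> \<otimes> \<langle>X\<rangle>) \<cdot> \<Delta>\<^bsub>X\<^esub> = \<langle>X\<rangle> \<and> (\<langle>X\<rangle> \<otimes> \<epsilon>\<^bsub>X\<^esub>) \<cdot> \<Delta>\<^bsub>X\<^esub> = \<langle>X\<rangle>"

text \<open>\<open>Theta H B\<close> is also the comultiplication of the tensor product coalgebra of \<open>H\<close> and \<open>B\<close>.\<close>

definition Theta :: "'a bialg_data \<Rightarrow> 'a bialg_data \<Rightarrow> 'a" where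
  "Theta H B = (\<langle>H\<rangle> \<otimes> \<Phi> \<langle>H\<rangle> \<langle>B\<rangle> \<otimes> \<langle>B\<rangle>) \<cdot> (\<Delta>\<^bsub>H\<^esub> \<otimes> \<Delta>\<^bsub>B\<^esub>)"

definition bialgebra :: "'a bialg_data \<Rightarrow> bool" where
  "bialgebra X \<longleftrightarrow> algebra X \<and> coalgebra X \<and>
     \<Delta>\<^bsub>X\<^esub> \<cdot> \<nabla>\<^bsub>X\<^esub> = (\<nabla>\<^bsub>X\<^esub> \<otimes> \<nabla>\<^bsub>X\<^esub>) \<cdot> (\<langle>X\<rangle> \<otimes> \<Phi> \<langle>X\<rangle> \<langle>X\<rangle> \<otimes> \<langle>X\<rangle>) \<cdot> (\<Delta>\<^bsub>X\<^esub> \<otimes> \<Delta>\<^bsub>X\<^esub>) \<and>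
     \<Delta>\<^bsub>X\<^esub> \<cdot> \<eta>\<^bsub>X\<^esub> = \<eta>\<^bsub>X\<^esub> \<otimes> \<eta>\<^bsub>X\<^esub> \<and>
     \<epsilon>\<^bsub>X\<^esub> \<cdot> \<nabla>\<^bsub>X\<^esub> = \<epsilon>\<^bsub>X\<^esub> \<otimes> \<epsilon>\<^bsub>X\<^esub> \<and>
     \<epsilon>\<^bsub>X\<^esub> \<cdot> \<eta>\<^bsub>X\<^esub> = \<one>"

definition hopf_algebra :: "'a bialg_data \<Rightarrow> 'a \<Rightarrow> bool" where
  "hopf_algebra X S \<longleftrightarrow> bialgebra X \<and> S \<in> hom C \<langle>X\<rangle> \<langle>X\<rangle> \<and>
     \<nabla>\<^bsub>X\<^esub> \<cdot> (S \<otimes> \<langle>X\<rangle>) \<cdot> \<Delta>\<^bsub>X\<^esub> = \<eta>\<^bsub>X\<^esub> \<cdot> \<epsilon>\<^bsub>X\<^esub> \<and>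
     \<nabla>\<^bsub>X\<^esub> \<cdot> (\<langle>X\<rangle> \<otimes> S) \<cdot> \<Delta>\<^bsub>X\<^esub> = \<eta>\<^bsub>X\<^esub> \<cdot> \<epsilon>\<^bsub>X\<^esub>"

definition left_module_coalgebra :: "'a bialg_data \<Rightarrow> 'a bialg_data \<Rightarrow> 'a \<Rightarrow> bool" where
  "left_module_coalgebra H B l \<longleftrightarrow> coalgebra B \<and> l \<in> hom C (\<langle>H\<rangle> \<otimes> \<langle>B\<rangle>) \<langle>B\<rangle> \<and>
     l \<cdot> (\<nabla>\<^bsub>H\<^esub> \<otimes> \<langle>B\<rangle>) = l \<cdot> (\<langle>H\<rangle> \<otimes> l) \<and>
     l \<cdot> (\<eta>\<^bsub>H\<^esub> \<otimes> \<langle>B\<rangle>) = \<langle>B\<rangle> \<and>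
     \<Delta>\<^bsub>B\<^esub> \<cdot> l = (l \<otimes> l) \<cdot> Theta H B \<and>
     \<epsilon>\<^bsub>B\<^esub> \<cdot> l = \<epsilon>\<^bsub>H\<^esub> \<otimes> \<epsilon>\<^bsub>B\<^esub>"

definition right_module_coalgebra :: "'a bialg_data \<Rightarrow> 'a bialg_data \<Rightarrow> 'a \<Rightarrow> bool" where
  "right_module_coalgebra H B r \<longleftrightarrow> coalgebra H \<and> r \<in> hom C (\<langle>H\<rangle> \<otimes> \<langle>B\<rangle>) \<langle>H\<rangle> \<and>
     r \<cdot> (\<langle>H\<rangle> \<otimes> \<nabla>\<^bsub>B\<^esub>) = r \<cdot> (r \<otimes> \<langle>B\<rangle>) \<and>
     r \<cdot> (\<langle>H\<rangle> \<otimes> \<eta>\<^bsub>B\<^esub>) = \<langle>H\<rangle> \<and>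
     \<Delta>\<^bsub>H\<^esub> \<cdot> r = (r \<otimes> r) \<cdot> Theta H B \<and>
     \<epsilon>\<^bsub>H\<^esub> \<cdot> r = \<epsilon>\<^bsub>H\<^esub> \<otimes> \<epsilon>\<^bsub>B\<^esub>"

definition matched_pair :: "'a bialg_data \<Rightarrow> 'a bialg_data \<Rightarrow> 'a \<Rightarrow> 'a \<Rightarrow> bool" where
  "matched_pair B H l r \<longleftrightarrow>
     bialgebra B \<and> bialgebra H \<and>
     left_module_coalgebra H B l \<and> right_module_coalgebra H B r \<and>
     l \<cdot> (\<langle>H\<rangle> \<otimes> \<nabla>\<^bsub>B\<^esub>) = \<nabla>\<^bsub>B\<^esub> \<cdot> (\<langle>B\<rangle> \<otimes> l) \<cdot> (l \<otimes> r \<otimes> \<langle>B\<rangle>) \<cdot> (Theta H B \<otimes> \<langle>B\<rangle>) \<and>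
     r \<cdot> (\<nabla>\<^bsub>H\<^esub> \<otimes> \<langle>B\<rangle>) = \<nabla>\<^bsub>H\<^esub> \<cdot> (r \<otimes> \<langle>H\<rangle>) \<cdot> (\<langle>H\<rangle> \<otimes> l \<otimes> r) \<cdot> (\<langle>H\<rangle> \<otimes> Theta H B) \<and>
     \<Phi> \<langle>B\<rangle> \<langle>H\<rangle> \<cdot> (l \<otimes> r) \<cdot> Theta H B = (r \<otimes> l) \<cdot> Theta H B \<and>
     l \<cdot> (\<langle>H\<rangle> \<otimes> \<eta>\<^bsub>B\<^esub>) = \<eta>\<^bsub>B\<^esub> \<cdot> \<epsilon>\<^bsub>H\<^esub> \<and>
     r \<cdot> (\<eta>\<^bsub>H\<^esub> \<otimes> \<langle>B\<rangle>) = \<eta>\<^bsub>H\<^esub> \<cdot> \<epsilon>\<^bsub>B\<^esub>"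

definition op_bialg :: "'a bialg_data \<Rightarrow> 'a bialg_data" where
  "op_bialg H = H\<lparr>Mult := \<nabla>\<^bsub>H\<^esub> \<cdot> \<Phi> \<langle>H\<rangle> \<langle>H\<rangle>\<rparr>"

text \<open>
  The dual on \<open>D = [\<langle>H\<rangle>,\<one>]\<close> with evaluation \<open>ev\<close>. The four-fold pairing matches the first factor
  of \<open>D \<otimes> D\<close> with the first factor of \<open>\<langle>H\<rangle> \<otimes> \<langle>H\<rangle>\<close>, and the second with the second.
\<close>

definition dual_bialg :: "'a bialg_data \<Rightarrow> 'a \<Rightarrow> 'a \<Rightarrow> 'a bialg_data" where
  "dual_bialg H D ev =
     \<lparr>Obj = D,
      Mult = (THE m. m \<in> hom C (D \<otimes> D) D \<and>
        ev \<cdot> (m \<otimes> \<langle>H\<rangle>) = (ev \<otimes> ev) \<cdot> (D \<otimes> \<Phi> D \<langle>H\<rangle> \<otimes> \<langle>H\<rangle>) \<cdot> (D \<otimes> D \<otimes> \<Delta>\<^bsub>H\<^esub>)),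
      Unit = (THE u. u \<in> hom C \<one> D \<and> ev \<cdot> (u \<otimes> \<langle>H\<rangle>) = \<epsilon>\<^bsub>H\<^esub>),
      Comult = (THE d. d \<in> hom C D (D \<otimes> D) \<and>
        (ev \<otimes> ev) \<cdot> (D \<otimes> \<Phi> D \<langle>H\<rangle> \<otimes> \<langle>H\<rangle>) \<cdot> (d \<otimes> \<langle>H\<rangle> \<otimes> \<langle>H\<rangle>) = ev \<cdot> (D \<otimes> \<nabla>\<^bsub>H\<^esub>)),
      Counit = ev \<cdot> (D \<otimes> \<eta>\<^bsub>H\<^esub>)\<rparr>"

definition ev_bar :: "'a bialg_data \<Rightarrow> 'a \<Rightarrow> 'a \<Rightarrow> 'a" where
  "ev_bar H D ev = ev \<cdot> \<Phi> \<langle>H\<rangle> D"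

definition left_action :: "'a bialg_data \<Rightarrow> 'a \<Rightarrow> 'a \<Rightarrow> 'a \<Rightarrow> 'a" where
  "left_action H S D ev =
     (THE l. l \<in> hom C (\<langle>H\<rangle> \<otimes> D) D \<and>
        ev_bar H D ev \<cdot> (\<langle>H\<rangle> \<otimes> l) =
        ev_bar H D ev \<cdot>
          ((\<nabla>\<^bsub>H\<^esub> \<cdot> \<Phi> \<langle>H\<rangle> \<langle>H\<rangle> \<cdot> (\<nabla>\<^bsub>H\<^esub> \<otimes> inv_arrow C S) \<cdot> (\<langle>H\<rangle> \<otimes> \<Delta>\<^bsub>H\<^esub>)) \<otimes> D))"

definition right_action :: "'a bialg_data \<Rightarrow> 'a \<Rightarrow> 'a \<Rightarrow> 'a \<Rightarrow> 'a" where
  "right_action H S D ev =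
     (\<langle>H\<rangle> \<otimes> ev_bar H D ev) \<cdot>
     (\<langle>H\<rangle> \<otimes> (\<nabla>\<^bsub>H\<^esub> \<cdot> \<Phi> \<langle>H\<rangle> \<langle>H\<rangle>) \<otimes> D) \<cdot>
     (inv_arrow C (\<Phi> \<langle>H\<rangle> \<langle>H\<rangle>) \<otimes> inv_arrow C S \<otimes> D) \<cdot>
     (((\<Delta>\<^bsub>H\<^esub> \<otimes> \<langle>H\<rangle>) \<cdot> \<Delta>\<^bsub>H\<^esub>) \<otimes> D)"

end

end

theory Submission
  imports Defs "HOL-Library.Multiset"
begin

text \<open>
  The braidings among \<open>H\<close> and its dual \<open>D\<close> are symmetries: for \<open>D\<close> with itself this follows from the
  duality, since an arrow into \<open>Y \<otimes> D\<close> is determined by its pairing with \<open>H\<close>. Hence arrows between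
  tensor products of copies of \<open>H\<close> and \<open>D\<close> may be computed with named wires, in any order, as in
  Sweedler notation. With \<open>T\<close> the inverse of the antipode, the definitions of the structure on \<open>D\<close> read
  \<open>(fg)(x) = f(x\<^sub>1) g(x\<^sub>2)\<close>, \<open>f\<^sub>1(x) f\<^sub>2(y) = f(yx)\<close>, \<open>(h \<triangleright> f)(x) = f(T(h\<^sub>2) x h\<^sub>1)\<close> and
  \<open>h \<triangleleft> f = h\<^sub>2 f(T(h\<^sub>3) h\<^sub>1)\<close>. After pairing all \<open>D\<close>-valued outputs with \<open>H\<close>, each axiom of a matched pair
  becomes an identity of words in Sweedler components of \<open>H\<close>, in which at most one factor
  \<open>h\<^sub>2 T(h\<^sub>1)\<close> or \<open>T(h\<^sub>2) h\<^sub>1\<close> has to be cancelled.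
\<close>

section \<open>Strict braided monoidal categories\<close>

text \<open>The obstacle is that an arrow of a strict monoidal category knows positions, not names,
  so a computation with Sweedler components is legitimate only if every rearrangement of wires has
  one canonical value. Since the braidings concerned are involutions, crossings obey the relations
  of the symmetric group, and a rearrangement depends only on the two orders of the wires. Pairing
  away one output in the dual while other outputs remain requires a genuine coevaluation; this is
  where finiteness of \<open>H\<close> enters. The actions are coadjoint actions, as in the Drinfeld
  double, whence the conjugation-like words T(h2) x h1, with \<open>T\<close> as antipode for the
  opposite product. Where an axiom lets both parts of a coproduct act, words such as T(h4) y h3
  T(h2) x h1 arise, and the adjacent pair h3 T(h2) collapses. Its two legs and its two factors
  belong to a long coproduct and a long product, which is why products and coproducts of any length
  are the basic gates.\<close>

context strict_braided_monoidal_category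
begin

lemma hom_iff: "f \<in> hom C X Y \<longleftrightarrow> f \<in> Arr C \<and> Dom C f = X \<and> Cod C f = Y"
  by (auto simp: hom_def)

lemma homI: "f \<in> Arr C \<Longrightarrow> f \<in> hom C (Dom C f) (Cod C f)"
  by (simp add: hom_iff)

lemma object_iff: "X \<in> objects C \<longleftrightarrow> X \<in> Arr C \<and> Dom C X = X \<and> Cod C X = X"
  by (auto simp: objects_def)

text \<open>The axioms speak about \<open>hom\<close>, whose objects would have to be guessed.
  Stated with \<open>Dom\<close> and \<open>Cod\<close>, typing becomes a set of conditional rewrite
  rules, and the side conditions of \<open>comp_assoc'\<close> and \<open>comp_id\<close> are
  discharged by computation.\<close>

lemma comp_typing [simp]:
  assumes "f \<in> Arr C" "g \<in> Arr C" "Dom C g = Cod C f"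
  shows "g \<cdot> f \<in> Arr C" "Dom C (g \<cdot> f) = Dom C f" "Cod C (g \<cdot> f) = Cod C g"
  using comp_in_hom[of f "Dom C f" "Cod C f" g "Cod C g"] assms by (auto simp: hom_iff)

lemma tensor_typing [simp]:
  assumes "f \<in> Arr C" "g \<in> Arr C"
  shows "f \<otimes> g \<in> Arr C" "Dom C (f \<otimes> g) = Dom C f \<otimes> Dom C g" "Cod C (f \<otimes> g) = Cod C f \<otimes> Cod C g"
  using tensor_in_hom[OF homI homI, of f g] assms by (auto simp: hom_iff)

lemma object_typing [simp]:
  assumes "X \<in> objects C"
  shows "X \<in> Arr C" "Dom C X = X" "Cod C X = X"
  using assms by (auto simp: object_iff)

lemma objects_closed [simp]:
  "\<one> \<in> objects C"
  "X \<in> objects C \<Longrightarrow> Y \<in> objects C \<Longrightarrow> X \<otimes> Y \<in> objects C"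
  "f \<in> Arr C \<Longrightarrow> Dom C f \<in> objects C"
  "f \<in> Arr C \<Longrightarrow> Cod C f \<in> objects C"
  using unit_object Dom_object Cod_object unfolding object_iff by (simp_all del: object_typing)

lemma braid_typing [simp]:
  assumes "X \<in> objects C" "Y \<in> objects C"
  shows "\<Phi> X Y \<in> Arr C" "Dom C (\<Phi> X Y) = X \<otimes> Y" "Cod C (\<Phi> X Y) = Y \<otimes> X"
  using braid_in_hom[OF assms] by (auto simp: hom_iff)

lemma comp_assoc' [simp]:
  assumes "f \<in> Arr C" "g \<in> Arr C" "h \<in> Arr C" "Dom C g = Cod C f" "Dom C h = Cod C g"
  shows "(h \<cdot> g) \<cdot> f = h \<cdot> g \<cdot> f"
  using assms by (intro comp_assoc) (auto simp: hom_iff)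

lemma comp_id [simp]:
  assumes "X \<in> objects C" "f \<in> Arr C"
  shows "X = Dom C f \<Longrightarrow> f \<cdot> X = f" "X = Cod C f \<Longrightarrow> X \<cdot> f = f"
  using assms comp_id_left[OF homI] comp_id_right[OF homI] by auto

declare tensor_assoc [simp] tensor_unit_left [simp] tensor_unit_right [simp]

lemma tensor_comp:
  assumes "f \<in> Arr C" "g \<in> Arr C" "f' \<in> Arr C" "g' \<in> Arr C" "Dom C g = Cod C f" "Dom C g' = Cod C f'"
  shows "(g \<otimes> g') \<cdot> (f \<otimes> f') = (g \<cdot> f) \<otimes> (g' \<cdot> f')"
  using assms by (intro interchange[symmetric]) (auto simp: hom_iff)

text \<open>Composites are normalised to the right, so two neighbouring factors form a subterm only
  at the end of a chain. The \<open>_cont\<close> versions carry the rest of the chain in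
  \<open>k\<close>.\<close>

lemma tensor_comp_cont:
  assumes "f \<in> Arr C" "g \<in> Arr C" "f' \<in> Arr C" "g' \<in> Arr C" "k \<in> Arr C"
    "Dom C g = Cod C f" "Dom C g' = Cod C f'" "Cod C k = Dom C f \<otimes> Dom C f'"
  shows "(g \<otimes> g') \<cdot> (f \<otimes> f') \<cdot> k = ((g \<cdot> f) \<otimes> (g' \<cdot> f')) \<cdot> k"
proof -
  have "(g \<otimes> g') \<cdot> (f \<otimes> f') \<cdot> k = ((g \<otimes> g') \<cdot> (f \<otimes> f')) \<cdot> k"
    using assms by (intro comp_assoc'[symmetric]) auto
  then show ?thesis using assms by (simp add: tensor_comp)
qed

lemma whisker_l:
  assumes "X \<in> objects C" "f \<in> Arr C" "g \<in> Arr C" "Dom C g = Cod C f"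
  shows "X \<otimes> (g \<cdot> f) = (X \<otimes> g) \<cdot> (X \<otimes> f)"
  using assms by (simp add: tensor_comp)

lemma whisker_r:
  assumes "X \<in> objects C" "f \<in> Arr C" "g \<in> Arr C" "Dom C g = Cod C f"
  shows "(g \<cdot> f) \<otimes> X = (g \<otimes> X) \<cdot> (f \<otimes> X)"
  using assms by (simp add: tensor_comp)

text \<open>Both sides equal \<open>f \<otimes> g\<close>: arrows on disjoint strands may be applied
  in either order.\<close>

lemma slide:
  assumes "f \<in> Arr C" "g \<in> Arr C"
  shows "(Cod C f \<otimes> g) \<cdot> (f \<otimes> Dom C g) = (f \<otimes> Cod C g) \<cdot> (Dom C f \<otimes> g)"
  using assms by (simp add: tensor_comp)

lemma slide_cont:
  assumes "f \<in> Arr C" "g \<in> Arr C" "k \<in> Arr C" "Cod C k = Dom C f \<otimes> Dom C g"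
  shows "(Cod C f \<otimes> g) \<cdot> (f \<otimes> Dom C g) \<cdot> k = (f \<otimes> Cod C g) \<cdot> (Dom C f \<otimes> g) \<cdot> k"
  using assms by (simp add: tensor_comp_cont)

lemma braid_nat:
  assumes "f \<in> Arr C" "g \<in> Arr C"
  shows "\<Phi> (Cod C f) (Cod C g) \<cdot> (f \<otimes> g) = (g \<otimes> f) \<cdot> \<Phi> (Dom C f) (Dom C g)"
  using assms by (intro braid_natural) (auto simp: hom_iff)

lemma inverse_arrows_unique:
  assumes "inverse_arrows C f g" "inverse_arrows C f g'"
  shows "g = g'"
proof -
  have "g = g \<cdot> (f \<cdot> g')"
    using assms by (auto simp: inverse_arrows_def hom_iff)
  also have "\<dots> = (g \<cdot> f) \<cdot> g'"
    using assms by (intro comp_assoc'[symmetric]) (auto simp: inverse_arrows_def hom_iff)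
  also have "\<dots> = g'"
    using assms by (auto simp: inverse_arrows_def hom_iff)
  finally show ?thesis .
qed

lemma inv_arrow_inverse:
  assumes "is_iso C f"
  shows "inverse_arrows C f (inv_arrow C f)"
  using assms inverse_arrows_unique unfolding is_iso_def inv_arrow_def
  by (metis theI)

lemma inv_arrow_facts:
  assumes "is_iso C f"
  shows "f \<in> Arr C" "inv_arrow C f \<in> Arr C" "Dom C (inv_arrow C f) = Cod C f"
    "Cod C (inv_arrow C f) = Dom C f" "inv_arrow C f \<cdot> f = Dom C f" "f \<cdot> inv_arrow C f = Cod C f"
  using inv_arrow_inverse[OF assms] by (auto simp: inverse_arrows_def hom_iff)

lemma iso_left_cancel:
  assumes "is_iso C k" "f \<in> Arr C" "g \<in> Arr C" "Cod C f = Dom C k" "Cod C g = Dom C k"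
    "k \<cdot> f = k \<cdot> g"
  shows "f = g"
proof -
  note k = inv_arrow_facts[OF assms(1)]
  have "h = inv_arrow C k \<cdot> k \<cdot> h" if "h \<in> Arr C" "Cod C h = Dom C k" for h
    using k that comp_assoc'[of h k "inv_arrow C k"] by (simp del: comp_assoc')
  then show ?thesis using assms by metis
qed

text \<open>A hexagon with unit objects makes this braiding idempotent, and an idempotent
  isomorphism is an identity by cancellation.\<close>

lemma braid_unit [simp]:
  assumes "X \<in> objects C"
  shows "\<Phi> \<one> X = X" "\<Phi> X \<one> = X"
proof -
  have "\<Phi> \<one> X = \<Phi> \<one> X \<cdot> \<Phi> \<one> X"
    using hexagon2[of \<one> \<one> X] assms by simp
  then show "\<Phi> \<one> X = X"
    using iso_left_cancel[OF braid_iso, of \<one> X X "\<Phi> \<one> X"] assms by simp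
  have "\<Phi> X \<one> = \<Phi> X \<one> \<cdot> \<Phi> X \<one>"
    using hexagon1[of X \<one> \<one>] assms by simp
  then show "\<Phi> X \<one> = X"
    using iso_left_cancel[OF braid_iso, of X \<one> X "\<Phi> X \<one>"] assms by simp
qed

text \<open>Naturality of the braiding of \<open>X\<close> past a tensor product, applied to
  \<open>\<Phi> Y Z\<close> and expanded by the first hexagon.\<close>

lemma yang_baxter:
  assumes "X \<in> objects C" "Y \<in> objects C" "Z \<in> objects C"
  shows "(\<Phi> Y Z \<otimes> X) \<cdot> (Y \<otimes> \<Phi> X Z) \<cdot> (\<Phi> X Y \<otimes> Z) = (Z \<otimes> \<Phi> X Y) \<cdot> (\<Phi> X Z \<otimes> Y) \<cdot> (X \<otimes> \<Phi> Y Z)"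
  using braid_nat[of X "\<Phi> Y Z"] assms by (simp add: hexagon1)

end

section \<open>Circuits of named wires\<close>

text \<open>Wires are names with an object attached, so that two strands carrying the same object
  remain distinguishable.\<close>

locale wires = strict_braided_monoidal_category C for C :: "'a braided_cat" (structure) +
  fixes ty :: "'w \<Rightarrow> 'a"
  assumes ty_object [simp]: "ty v \<in> objects C"
    and braid_sym: "\<Phi> (ty v) (ty w) \<cdot> \<Phi> (ty w) (ty v) = ty w \<otimes> ty v"
begin

section \<open>Permutations of wires and their coherence\<close>

fun tens :: "'w list \<Rightarrow> 'a" where
  "tens [] = \<one>"
| "tens (x # xs) = ty x \<otimes> tens xs"

lemma tens_object [simp]: "tens xs \<in> objects C"
  by (induction xs) auto

lemma tens_append [simp]: "tens (xs @ ys) = tens xs \<otimes> tens ys"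
  by (induction xs) auto

text \<open>The wire \<open>y\<close> crosses, one at a time, the wires to its left. The value for
  the empty list is a placeholder, reached only if \<open>y\<close> does not occur.\<close>

fun pull :: "'w \<Rightarrow> 'w list \<Rightarrow> 'a" where
  "pull y [] = \<one>"
| "pull y (x # xs) = (if x = y then ty x \<otimes> tens xs
     else (\<Phi> (ty x) (ty y) \<otimes> tens (remove1 y xs)) \<cdot> (ty x \<otimes> pull y xs))"

lemma pull_typing [simp]:
  assumes "y \<in> set xs"
  shows "pull y xs \<in> Arr C" "Dom C (pull y xs) = tens xs" "Cod C (pull y xs) = ty y \<otimes> tens (remove1 y xs)"
proof -
  have "pull y xs \<in> Arr C \<and> Dom C (pull y xs) = tens xs \<and> Cod C (pull y xs) = ty y \<otimes> tens (remove1 y xs)"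
    using assms by (induction xs) auto
  then show "pull y xs \<in> Arr C" "Dom C (pull y xs) = tens xs" "Cod C (pull y xs) = ty y \<otimes> tens (remove1 y xs)"
    by auto
qed

text \<open>Selection sort by crossings: the wire that has to come first is pulled out first. This
  fixes one route among many; that all routes agree is the content of
  \<open>perm_comp\<close>.\<close>

fun perm :: "'w list \<Rightarrow> 'w list \<Rightarrow> 'a" where
  "perm xs [] = \<one>"
| "perm xs (y # ys) = (ty y \<otimes> perm (remove1 y xs) ys) \<cdot> pull y xs"

lemma perm_typing [simp]:
  assumes "mset xs = mset ys"
  shows "perm xs ys \<in> Arr C" "Dom C (perm xs ys) = tens xs" "Cod C (perm xs ys) = tens ys"
proof -
  have "perm xs ys \<in> Arr C \<and> Dom C (perm xs ys) = tens xs \<and> Cod C (perm xs ys) = tens ys"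
    using assms
  proof (induction ys arbitrary: xs)
    case (Cons y ys)
    have y: "y \<in> set xs" using Cons.prems by (metis list.set_intros(1) mset_eq_setD)
    have "mset (remove1 y xs) = mset ys" using Cons.prems by simp
    from Cons.IH[OF this] y show ?case by auto
  qed auto
  then show "perm xs ys \<in> Arr C" "Dom C (perm xs ys) = tens xs" "Cod C (perm xs ys) = tens ys"
    by auto
qed

lemma perm_refl [simp]: "perm xs xs = tens xs"
  by (induction xs) (auto simp: tensor_comp)

lemma pull_append:
  assumes "y \<in> set xs"
  shows "pull y (xs @ us) = pull y xs \<otimes> tens us"
  using assms
proof (induction xs)
  case (Cons x xs)
  show ?case
  proof (cases "x = y")
    case False
    then have y: "y \<in> set xs" using Cons by simp
    show ?thesis using False Cons.IH[OF y] y
      by (simp add: remove1_append whisker_r)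
  qed simp
qed simp

lemma perm_append:
  assumes "mset xs = mset ys"
  shows "perm (xs @ us) (ys @ us) = perm xs ys \<otimes> tens us"
  using assms
proof (induction ys arbitrary: xs)
  case (Cons y ys)
  have y: "y \<in> set xs" using Cons.prems by (metis list.set_intros(1) mset_eq_setD)
  have m: "mset (remove1 y xs) = mset ys" using Cons.prems by simp
  show ?case using Cons.IH[OF m] y m
    by (simp add: remove1_append pull_append whisker_r)
qed simp

lemma perm_prepend:
  assumes "mset xs = mset ys"
  shows "perm (us @ xs) (us @ ys) = tens us \<otimes> perm xs ys"
  using assms by (induction us) (auto simp: tensor_comp)

text \<open>If \<open>z\<close> is at the front, the extra crossing is undone by the involution law;
  if the front wire is neither \<open>y\<close> nor \<open>z\<close>, it crosses both, and
  Yang-Baxter applies. These are the two relations behind the coherence of permutations.\<close>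

lemma pull_pull:
  assumes "distinct xs" "y \<in> set xs" "z \<in> set xs" "y \<noteq> z"
  shows "(\<Phi> (ty y) (ty z) \<otimes> tens (remove1 z (remove1 y xs))) \<cdot> (ty y \<otimes> pull z (remove1 y xs)) \<cdot> pull y xs
    = (ty z \<otimes> pull y (remove1 z xs)) \<cdot> pull z xs"
  using assms
proof (induction xs)
  case (Cons x xs)
  consider "x = y" | "x = z" | "x \<noteq> y" "x \<noteq> z" by blast
  then show ?case
  proof cases
    case 1
    then show ?thesis using Cons.prems by auto
  next
    case 2
    then have z: "z \<notin> set xs" "remove1 z xs = xs" and y: "y \<in> set xs" "y \<noteq> z"
      using Cons.prems by (auto simp: remove1_idem)
    let ?R = "tens (remove1 y xs)"
    have zr: "remove1 z (remove1 y xs) = remove1 y xs"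
      using z by (metis remove1_commute)
    have "(\<Phi> (ty y) (ty z) \<otimes> ?R) \<cdot> (\<Phi> (ty z) (ty y) \<otimes> ?R) \<cdot> (ty z \<otimes> pull y xs)
      = ((\<Phi> (ty y) (ty z) \<cdot> \<Phi> (ty z) (ty y)) \<otimes> (?R \<cdot> ?R)) \<cdot> (ty z \<otimes> pull y xs)"
      using y by (intro tensor_comp_cont) auto
    also have "\<dots> = ty z \<otimes> pull y xs"
      unfolding braid_sym using y by simp
    finally show ?thesis using 2 y z zr by simp
  next
    case 3
    then have y: "y \<in> set xs" and z: "z \<in> set xs" and d: "distinct xs" using Cons.prems by auto
    let ?R = "tens (remove1 z (remove1 y xs))"
    have zy: "z \<in> set (remove1 y xs)" "y \<in> set (remove1 z xs)"
      using y z Cons.prems(4) by (auto simp: in_set_remove1)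
    have rc: "remove1 y (remove1 z xs) = remove1 z (remove1 y xs)" by (rule remove1_commute)
    have IH: "(\<Phi> (ty y) (ty z) \<otimes> ?R) \<cdot> (ty y \<otimes> pull z (remove1 y xs)) \<cdot> pull y xs
      = (ty z \<otimes> pull y (remove1 z xs)) \<cdot> pull z xs"
      using Cons.IH y z d Cons.prems(4) by blast
    \<comment> \<open>The second extraction takes place to the right of the crossing of
      \<open>x\<close> and \<open>y\<close>, so it slides past it.\<close>
    have e1: "(ty y \<otimes> ty x \<otimes> pull z (remove1 y xs)) \<cdot> (\<Phi> (ty x) (ty y) \<otimes> tens (remove1 y xs)) \<cdot> k
      = (\<Phi> (ty x) (ty y) \<otimes> ty z \<otimes> ?R) \<cdot> (ty x \<otimes> ty y \<otimes> pull z (remove1 y xs)) \<cdot> k"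
      if "k \<in> Arr C" "Cod C k = ty x \<otimes> ty y \<otimes> tens (remove1 y xs)" for k
      using slide_cont[of "\<Phi> (ty x) (ty y)" "pull z (remove1 y xs)" k] zy that by simp
    have e2: "(ty z \<otimes> ty x \<otimes> pull y (remove1 z xs)) \<cdot> (\<Phi> (ty x) (ty z) \<otimes> tens (remove1 z xs)) \<cdot> k
      = (\<Phi> (ty x) (ty z) \<otimes> ty y \<otimes> ?R) \<cdot> (ty x \<otimes> ty z \<otimes> pull y (remove1 z xs)) \<cdot> k"
      if "k \<in> Arr C" "Cod C k = ty x \<otimes> ty z \<otimes> tens (remove1 z xs)" for k
      using slide_cont[of "\<Phi> (ty x) (ty z)" "pull y (remove1 z xs)" k] zy that rc by simp
    have YB: "(\<Phi> (ty y) (ty z) \<otimes> ty x \<otimes> ?R) \<cdot> (ty y \<otimes> \<Phi> (ty x) (ty z) \<otimes> ?R) \<cdot> (\<Phi> (ty x) (ty y) \<otimes> ty z \<otimes> ?R)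
      = (ty z \<otimes> \<Phi> (ty x) (ty y) \<otimes> ?R) \<cdot> (\<Phi> (ty x) (ty z) \<otimes> ty y \<otimes> ?R) \<cdot> (ty x \<otimes> \<Phi> (ty y) (ty z) \<otimes> ?R)"
      using arg_cong[OF yang_baxter[of "ty x" "ty y" "ty z"], of "\<lambda>f. f \<otimes> ?R"]
      by (simp add: whisker_r)
    have YB': "(\<Phi> (ty y) (ty z) \<otimes> ty x \<otimes> ?R) \<cdot> (ty y \<otimes> \<Phi> (ty x) (ty z) \<otimes> ?R) \<cdot> (\<Phi> (ty x) (ty y) \<otimes> ty z \<otimes> ?R) \<cdot> k
      = (ty z \<otimes> \<Phi> (ty x) (ty y) \<otimes> ?R) \<cdot> (\<Phi> (ty x) (ty z) \<otimes> ty y \<otimes> ?R) \<cdot> (ty x \<otimes> \<Phi> (ty y) (ty z) \<otimes> ?R) \<cdot> k"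
      if "k \<in> Arr C" "Cod C k = ty x \<otimes> ty y \<otimes> ty z \<otimes> ?R" for k
      using arg_cong[OF YB, of "\<lambda>f. f \<cdot> k"] that by simp
    have IH': "(ty x \<otimes> \<Phi> (ty y) (ty z) \<otimes> ?R) \<cdot> (ty x \<otimes> ty y \<otimes> pull z (remove1 y xs)) \<cdot> (ty x \<otimes> pull y xs)
      = (ty x \<otimes> ty z \<otimes> pull y (remove1 z xs)) \<cdot> (ty x \<otimes> pull z xs)"
      using arg_cong[OF IH, of "\<lambda>f. ty x \<otimes> f"] y z zy rc by (simp add: whisker_l)
    show ?thesis
      using 3 y z zy rc by (simp add: whisker_l whisker_r e1 e2 YB' IH')
  qed
qed simp


lemma mset_remove1_eq:
  assumes "mset xs = mset ys"
  shows "mset (remove1 z xs) = mset (remove1 z ys)"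
  using assms by simp

text \<open>By induction along \<open>ys\<close>: each wire placed ahead of \<open>z\<close> costs
  one use of \<open>pull_pull\<close>, and the permutation of the remaining wires slides past the
  crossing.\<close>

lemma pull_perm:
  assumes "distinct xs" "mset xs = mset ys" "z \<in> set ys"
  shows "pull z ys \<cdot> perm xs ys = (ty z \<otimes> perm (remove1 z xs) (remove1 z ys)) \<cdot> pull z xs"
  using assms
proof (induction ys arbitrary: xs)
  case (Cons y ys)
  have y: "y \<in> set xs" and zx: "z \<in> set xs"
    using Cons.prems by (metis list.set_intros(1) mset_eq_setD)+
  have m: "mset (remove1 y xs) = mset ys" using Cons.prems by simp
  show ?case
  proof (cases "y = z")
    case True
    then show ?thesis using y m by (simp del: mset_remove1)
  next
    case False
    then have z: "z \<in> set ys" using Cons.prems by simp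
    have zy: "z \<in> set (remove1 y xs)" "y \<in> set (remove1 z xs)"
      using y zx False by (auto simp: in_set_remove1)
    have rc: "remove1 y (remove1 z xs) = remove1 z (remove1 y xs)" by (rule remove1_commute)
    have m2: "mset (remove1 z (remove1 y xs)) = mset (remove1 z ys)"
      by (rule mset_remove1_eq[OF m])
    let ?p = "perm (remove1 z (remove1 y xs)) (remove1 z ys)"
    have IH: "pull z ys \<cdot> perm (remove1 y xs) ys = (ty z \<otimes> ?p) \<cdot> pull z (remove1 y xs)"
      using Cons.IH[OF _ m z] Cons.prems(1) by simp
    have "pull z (y # ys) \<cdot> perm xs (y # ys)
      = (\<Phi> (ty y) (ty z) \<otimes> tens (remove1 z ys)) \<cdot> (ty y \<otimes> (pull z ys \<cdot> perm (remove1 y xs) ys)) \<cdot> pull y xs"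
      using False y z m by (simp add: whisker_l del: mset_remove1)
    also have "\<dots> = (\<Phi> (ty y) (ty z) \<otimes> tens (remove1 z ys)) \<cdot> (ty y \<otimes> ty z \<otimes> ?p) \<cdot> (ty y \<otimes> pull z (remove1 y xs)) \<cdot> pull y xs"
      unfolding IH using y z m m2 zy by (simp add: whisker_l del: mset_remove1)
    also have "\<dots> = (ty z \<otimes> ty y \<otimes> ?p) \<cdot> (\<Phi> (ty y) (ty z) \<otimes> tens (remove1 z (remove1 y xs))) \<cdot> (ty y \<otimes> pull z (remove1 y xs)) \<cdot> pull y xs"
      using slide_cont[of "\<Phi> (ty y) (ty z)" ?p "(ty y \<otimes> pull z (remove1 y xs)) \<cdot> pull y xs"] y m2 zy
      by (simp del: mset_remove1)
    also have "\<dots> = (ty z \<otimes> ty y \<otimes> ?p) \<cdot> (ty z \<otimes> pull y (remove1 z xs)) \<cdot> pull z xs"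
      using pull_pull[OF Cons.prems(1) y zx False] by simp
    also have "\<dots> = (ty z \<otimes> perm (remove1 z xs) (y # remove1 z ys)) \<cdot> pull z xs"
      using y m2 zy zx rc by (simp add: whisker_l del: mset_remove1)
    finally show ?thesis using False by simp
  qed
qed simp

text \<open>The first wire of the final order is extracted before everything else;
  \<open>pull_perm\<close> moves this extraction through the first permutation, and induction treats
  the rest. This is coherence: only the initial and the final order count.\<close>

lemma perm_comp:
  assumes "distinct xs" "mset xs = mset ys" "mset ys = mset zs"
  shows "perm ys zs \<cdot> perm xs ys = perm xs zs"
  using assms
proof (induction zs arbitrary: xs ys)
  case (Cons z zs)
  have z: "z \<in> set ys" "z \<in> set xs"
    using Cons.prems by (metis list.set_intros(1) mset_eq_setD)+
  have m: "mset (remove1 z ys) = mset zs" "mset (remove1 z xs) = mset (remove1 z ys)"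
    using Cons.prems by simp_all
  have "perm ys (z # zs) \<cdot> perm xs ys = (ty z \<otimes> perm (remove1 z ys) zs) \<cdot> pull z ys \<cdot> perm xs ys"
    using z m Cons.prems by (simp del: mset_remove1)
  also have "\<dots> = (ty z \<otimes> perm (remove1 z ys) zs) \<cdot> (ty z \<otimes> perm (remove1 z xs) (remove1 z ys)) \<cdot> pull z xs"
    using pull_perm[OF Cons.prems(1,2) z(1)] by simp
  also have "\<dots> = (ty z \<otimes> (perm (remove1 z ys) zs \<cdot> perm (remove1 z xs) (remove1 z ys))) \<cdot> pull z xs"
    using z m by (simp add: whisker_l del: mset_remove1)
  also have "perm (remove1 z ys) zs \<cdot> perm (remove1 z xs) (remove1 z ys) = perm (remove1 z xs) zs"
    using Cons.IH[OF _ m(2) m(1)] Cons.prems(1) by simp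
  finally show ?case by simp
qed simp

lemma pull_middle:
  assumes "y \<notin> set xs"
  shows "pull y (xs @ y # ys) = \<Phi> (tens xs) (ty y) \<otimes> tens ys"
  using assms
  by (induction xs) (auto simp: remove1_append hexagon2 whisker_r)

text \<open>By the hexagons the crossings of two blocks of wires assemble into a single braiding.
  This links permutations of names to the braidings that occur in the axioms.\<close>

lemma perm_swap:
  assumes "distinct (xs @ ys)"
  shows "perm (xs @ ys) (ys @ xs) = \<Phi> (tens xs) (tens ys)"
  using assms
  by (induction ys) (simp_all add: remove1_append pull_middle hexagon1)

section \<open>Circuits, their evaluation and their rewriting\<close>

definition rem :: "'w list \<Rightarrow> 'w list \<Rightarrow> 'w list" where
  "rem ws xs = filter (\<lambda>x. x \<notin> set ws) xs"

lemma rem_simps [simp]: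
  "rem ws [] = []"
  "rem ws (x # xs) = (if x \<in> set ws then rem ws xs else x # rem ws xs)"
  "rem ws (xs @ ys) = rem ws xs @ rem ws ys"
  "set (rem ws xs) = set xs - set ws"
  "distinct xs \<Longrightarrow> distinct (rem ws xs)"
  by (auto simp: rem_def)

lemma rem_disjoint: "set ws \<inter> set xs = {} \<Longrightarrow> rem ws xs = xs"
  unfolding rem_def by (auto intro!: filter_True)

lemma rem_all: "set xs \<subseteq> set ws \<Longrightarrow> rem ws xs = []"
  unfolding rem_def by (auto simp: filter_empty_conv)

lemma mset_rem:
  assumes "distinct xs" "distinct ws" "set ws \<subseteq> set xs"
  shows "mset xs = mset (ws @ rem ws xs)"
  using assms by (subst set_eq_iff_mset_eq_distinct[symmetric]) auto

lemma mset_rem_cong: "mset xs = mset xs' \<Longrightarrow> mset (rem ws xs) = mset (rem ws xs')"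
  by (simp add: rem_def)

type_synonym ('v, 'b) gate = "'v list \<times> 'v list \<times> 'b"

definition ins :: "('w, 'a) gate \<Rightarrow> 'w list" where "ins g = fst g"
definition outs :: "('w, 'a) gate \<Rightarrow> 'w list" where "outs g = fst (snd g)"
definition arr :: "('w, 'a) gate \<Rightarrow> 'a" where "arr g = snd (snd g)"

definition gate :: "('w, 'a) gate \<Rightarrow> bool" where
  "gate g \<longleftrightarrow> arr g \<in> Arr C \<and> Dom C (arr g) = tens (ins g) \<and> Cod C (arr g) = tens (outs g)"

lemma gate_triple [simp]: "ins (xs, ys, f) = xs" "outs (xs, ys, f) = ys" "arr (xs, ys, f) = f"
  by (simp_all add: ins_def outs_def arr_def)

lemma gate_typing [simp]:
  assumes "gate g"
  shows "arr g \<in> Arr C" "Dom C (arr g) = tens (ins g)" "Cod C (arr g) = tens (outs g)"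
  using assms by (auto simp: gate_def)

text \<open>A gate takes its inputs from anywhere in the current list and puts its outputs in front.
  The final condition compares sets only, since \<open>ok\<close> asks for distinctness of all names
  at once.\<close>

fun flow :: "('w, 'a) gate list \<Rightarrow> 'w list \<Rightarrow> 'w list \<Rightarrow> bool" where
  "flow [] ys xs \<longleftrightarrow> set xs = set ys"
| "flow (g # gl) ys xs \<longleftrightarrow> gate g \<and> distinct (ins g) \<and> set (ins g) \<subseteq> set xs \<and>
     flow gl ys (outs g @ rem (ins g) xs)"

text \<open>
  Circuits are in single-assignment form: no name is ever used for two wires. Therefore the order of
  the gates is irrelevant as long as each gate comes after those that produce its inputs.
\<close>

definition ok :: "('w, 'a) gate list \<Rightarrow> 'w list \<Rightarrow> 'w list \<Rightarrow> bool" where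
  "ok gl ys xs \<longleftrightarrow> distinct ys \<and> distinct (xs @ concat (map outs gl)) \<and> flow gl ys xs"

text \<open>Before each gate its inputs are brought to the front; the last permutation establishes
  the requested order of the outputs.\<close>

fun run :: "('w, 'a) gate list \<Rightarrow> 'w list \<Rightarrow> 'w list \<Rightarrow> 'a" where
  "run [] ys xs = perm xs ys"
| "run (g # gl) ys xs = run gl ys (outs g @ rem (ins g) xs) \<cdot> (arr g \<otimes> tens (rem (ins g) xs)) \<cdot>
     perm xs (ins g @ rem (ins g) xs)"

lemma ok_Nil: "ok [] ys xs \<longleftrightarrow> distinct xs \<and> distinct ys \<and> mset xs = mset ys"
  by (auto simp: ok_def set_eq_iff_mset_eq_distinct dest: mset_eq_setD)

lemma ok_ConsD:
  assumes "ok (g # gl) ys xs"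
  shows "gate g" "distinct (ins g)" "distinct (outs g)" "set (ins g) \<subseteq> set xs" "distinct xs"
    "set (outs g) \<inter> set xs = {}" "ok gl ys (outs g @ rem (ins g) xs)"
    "mset xs = mset (ins g @ rem (ins g) xs)"
  using assms mset_rem[of xs "ins g"] by (auto simp: ok_def)

lemma flow_set_cong: "set xs = set xs' \<Longrightarrow> flow gl ys xs = flow gl ys xs'"
proof (induction gl arbitrary: xs xs')
  case (Cons g gl)
  have "set (outs g @ rem (ins g) xs) = set (outs g @ rem (ins g) xs')" using Cons.prems by simp
  from Cons.IH[OF this] show ?case using Cons.prems by simp
qed simp

lemma ok_perm_in:
  assumes "ok gl ys xs" "mset xs = mset xs'"
  shows "ok gl ys xs'"
proof -
  have "set xs = set xs'" using assms(2) by (rule mset_eq_setD)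
  then show ?thesis
    using assms flow_set_cong[of xs xs' gl ys] mset_eq_imp_distinct_iff[of xs xs']
    by (auto simp: ok_def)
qed

lemma run_typing [simp]:
  assumes "ok gl ys xs"
  shows "run gl ys xs \<in> Arr C" "Dom C (run gl ys xs) = tens xs" "Cod C (run gl ys xs) = tens ys"
proof -
  have "run gl ys xs \<in> Arr C \<and> Dom C (run gl ys xs) = tens xs \<and> Cod C (run gl ys xs) = tens ys"
    using assms
  proof (induction gl arbitrary: xs)
    case Nil
    then show ?case by (auto simp: ok_Nil)
  next
    case (Cons g gl)
    note d = ok_ConsD[OF Cons.prems]
    have "perm xs (ins g @ rem (ins g) xs) \<in> Arr C" "Dom C (perm xs (ins g @ rem (ins g) xs)) = tens xs"
      "Cod C (perm xs (ins g @ rem (ins g) xs)) = tens (ins g @ rem (ins g) xs)"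
      using d(8) by (auto simp del: mset_append)
    then show ?case using Cons.IH[OF d(7)] d(1) by simp
  qed
  then show "run gl ys xs \<in> Arr C" "Dom C (run gl ys xs) = tens xs" "Cod C (run gl ys xs) = tens ys"
    by auto
qed

text \<open>By \<open>perm_comp\<close> the two permutations before the first gate combine; what is
  left of them acts on wires that the gate does not touch, and so slides past the gate.\<close>

lemma run_perm_in:
  assumes "ok gl ys xs" "mset xs = mset xs'"
  shows "run gl ys xs' \<cdot> perm xs xs' = run gl ys xs"
  using assms
proof (induction gl arbitrary: xs xs')
  case Nil
  then show ?case by (auto simp: ok_Nil intro!: perm_comp)
next
  case (Cons g gl)
  note d = ok_ConsD[OF Cons.prems(1)]
  note d' = ok_ConsD[OF ok_perm_in[OF Cons.prems]]
  let ?i = "ins g" and ?o = "outs g"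
  have m: "mset (rem ?i xs) = mset (rem ?i xs')" by (rule mset_rem_cong[OF Cons.prems(2)])
  have IH: "run gl ys (?o @ rem ?i xs') \<cdot> perm (?o @ rem ?i xs) (?o @ rem ?i xs') = run gl ys (?o @ rem ?i xs)"
    using Cons.IH[OF d(7), of "?o @ rem ?i xs'"] m by simp
  have "perm xs' (?i @ rem ?i xs') \<cdot> perm xs xs' = perm xs (?i @ rem ?i xs')"
    by (rule perm_comp) (use d d' Cons.prems(2) in auto)
  also have "\<dots> = perm (?i @ rem ?i xs) (?i @ rem ?i xs') \<cdot> perm xs (?i @ rem ?i xs)"
    by (rule perm_comp[symmetric]) (use d m in auto)
  finally have p: "perm xs' (?i @ rem ?i xs') \<cdot> perm xs xs'
    = (tens ?i \<otimes> perm (rem ?i xs) (rem ?i xs')) \<cdot> perm xs (?i @ rem ?i xs)"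
    using m by (simp add: perm_prepend)
  let ?p = "perm xs (?i @ rem ?i xs)" and ?q = "perm (rem ?i xs) (rem ?i xs')"
  note pt = perm_typing[OF d(8)] perm_typing[OF d'(8)] perm_typing[OF Cons.prems(2)]
  have "run (g # gl) ys xs' \<cdot> perm xs xs' = run gl ys (?o @ rem ?i xs') \<cdot> (arr g \<otimes> tens (rem ?i xs')) \<cdot>
     perm xs' (?i @ rem ?i xs') \<cdot> perm xs xs'"
    using d(1) run_typing[OF d'(7)] pt by simp
  also have "\<dots> = run gl ys (?o @ rem ?i xs') \<cdot> (arr g \<otimes> tens (rem ?i xs')) \<cdot> (tens ?i \<otimes> ?q) \<cdot> ?p"
    unfolding p ..
  also have "\<dots> = run gl ys (?o @ rem ?i xs') \<cdot> (tens ?o \<otimes> ?q) \<cdot> (arr g \<otimes> tens (rem ?i xs)) \<cdot> ?p"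
    using slide_cont[of "arr g" ?q ?p] d(1) m pt by simp
  also have "\<dots> = (run gl ys (?o @ rem ?i xs') \<cdot> perm (?o @ rem ?i xs) (?o @ rem ?i xs')) \<cdot> (arr g \<otimes> tens (rem ?i xs)) \<cdot> ?p"
    using d(1) m run_typing[OF d'(7)] pt by (simp add: perm_prepend)
  finally show ?case unfolding IH by simp
qed

lemma ok_append_rest:
  assumes "ok L os is" "ok (L @ rest) ys (is @ r)"
  shows "ok rest ys (os @ r)"
  using assms
proof (induction L arbitrary: "is")
  case Nil
  then show ?case using ok_perm_in[of rest ys "is @ r" "os @ r"] by (auto simp: ok_Nil)
next
  case (Cons g L)
  note d = ok_ConsD[OF Cons.prems(1)]
  have "ok ((g # L) @ rest) ys (is @ r)" by (rule Cons.prems)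
  then have e: "ok (g # (L @ rest)) ys (is @ r)" by simp
  have "rem (ins g) r = r" using ok_ConsD(5)[OF e] d(4) by (intro rem_disjoint) auto
  then have "ok (L @ rest) ys ((outs g @ rem (ins g) is) @ r)" using ok_ConsD(7)[OF e] by simp
  from Cons.IH[OF d(7) this] show ?case .
qed

text \<open>Since names are distinct, removing the inputs of a gate of \<open>L\<close> leaves
  \<open>r\<close> intact. This is locality: bystanders only tensor with the value of
  \<open>L\<close>.\<close>

lemma run_append_rest:
  assumes "ok L os is" "ok (L @ rest) ys (is @ r)"
  shows "run (L @ rest) ys (is @ r) = run rest ys (os @ r) \<cdot> (run L os is \<otimes> tens r)"
  using assms
proof (induction L arbitrary: "is")
  case Nil
  then have "mset is = mset os" by (simp add: ok_Nil)
  then show ?case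
    using run_perm_in[of rest ys "is @ r" "os @ r"] Nil.prems by (simp add: perm_append)
next
  case (Cons g L)
  note d = ok_ConsD[OF Cons.prems(1)]
  have e: "ok (g # (L @ rest)) ys (is @ r)" using Cons.prems by simp
  have r: "rem (ins g) r = r" using ok_ConsD(5)[OF e] d(4) by (intro rem_disjoint) auto
  let ?i = "outs g @ rem (ins g) is" and ?p = "perm is (ins g @ rem (ins g) is)"
  have e': "ok (L @ rest) ys (?i @ r)" using ok_ConsD(7)[OF e] r by simp
  have "perm (is @ r) (ins g @ rem (ins g) (is @ r)) = ?p \<otimes> tens r"
    using perm_append[OF d(8), of r] r by simp
  then have "run ((g # L) @ rest) ys (is @ r) = run (L @ rest) ys (?i @ r) \<cdot> (arr g \<otimes> tens (rem (ins g) is) \<otimes> tens r) \<cdot> (?p \<otimes> tens r)"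
    using r by simp
  also have "\<dots> = run rest ys (os @ r) \<cdot> (run L os ?i \<otimes> tens r) \<cdot> (arr g \<otimes> tens (rem (ins g) is) \<otimes> tens r) \<cdot> (?p \<otimes> tens r)"
    unfolding Cons.IH[OF d(7) e']
    using run_typing[OF ok_append_rest[OF d(7) e']] run_typing[OF d(7)] d(1) perm_typing[OF d(8)] by simp
  also have "(run L os ?i \<otimes> tens r) \<cdot> (arr g \<otimes> tens (rem (ins g) is) \<otimes> tens r) \<cdot> (?p \<otimes> tens r) = run (g # L) os is \<otimes> tens r"
    using run_typing[OF d(7)] d(1) perm_typing[OF d(8)] by (simp add: whisker_r)
  finally show ?case .
qed

text \<open>The second hypothesis says that \<open>g'\<close> consumes no output of
  \<open>g\<close>. Isolated on their joint inputs, both orders have the value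
  \<open>arr g \<otimes> arr g'\<close>; locality carries this over to the whole circuit.\<close>

lemma run_exchange:
  assumes "ok (g # g' # gl) ys xs" "set (ins g') \<subseteq> set xs"
  shows "ok (g' # g # gl) ys xs" "run (g # g' # gl) ys xs = run (g' # g # gl) ys xs"
proof -
  note d = ok_ConsD[OF assms(1)]
  note d' = ok_ConsD[OF d(7)]
  let ?i = "ins g" and ?i' = "ins g'" and ?o = "outs g" and ?o' = "outs g'"
  have ds: "set ?i \<inter> set ?i' = {}" "set ?o \<inter> set ?i = {}" "set ?o' \<inter> set ?i' = {}"
    "set ?o \<inter> set ?o' = {}" "set ?o \<inter> set ?i' = {}" "set ?o' \<inter> set ?i = {}" "set ?o' \<inter> set xs = {}"
    using assms d d' by (auto simp: ok_def)
  then have ds': "set ?i' \<inter> set ?i = {}" "set ?i \<inter> set ?o = {}" "set ?i' \<inter> set ?o' = {}"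
    "set ?o' \<inter> set ?o = {}" "set ?i' \<inter> set ?o = {}" "set ?i \<inter> set ?o' = {}" by auto
  have rr: "rem ?i ?i' = ?i'" "rem ?i' ?i = ?i" "rem ?i' ?o = ?o" "rem ?i ?o' = ?o'" "rem ?i ?i = []" "rem ?i' ?i' = []"
    using ds ds' by (auto intro!: rem_disjoint rem_all)
  have "flow (g' # g # gl) ys xs = (gate g' \<and> gate g \<and> distinct ?i \<and> distinct ?i' \<and> flow gl ys (?o @ rem ?i (?o' @ rem ?i' xs)))"
    using assms(2) d d' ds by auto
  also have "flow gl ys (?o @ rem ?i (?o' @ rem ?i' xs)) = flow gl ys (?o' @ rem ?i' (?o @ rem ?i xs))"
    using ds by (intro flow_set_cong) auto
  finally show ok': "ok (g' # g # gl) ys xs"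
    using assms d d' by (auto simp: ok_def)
  let ?r = "rem (?i @ ?i') xs"
  \<comment> \<open>The inputs of both gates first, then the bystanders: the shape to which
    \<open>run_append_rest\<close> applies.\<close>
  have m: "mset xs = mset ((?i @ ?i') @ ?r)"
    using assms(2) d d' ds by (intro mset_rem) auto
  have k1: "ok [g, g'] (?o @ ?o') (?i @ ?i')" and k2: "ok [g', g] (?o @ ?o') (?i @ ?i')"
    using d d' ds rr by (auto simp: ok_def)
  have D: "distinct (?i @ ?i')" "distinct (?i' @ ?i)" "distinct (?o @ ?o')" "distinct (?o' @ ?o)"
    "distinct (?o @ ?i')" "distinct (?o' @ ?i)" using d d' ds by auto
  \<comment> \<open>Blocks of wires inherit the involution law from coherence.\<close>
  have sI: "\<Phi> (tens ?i') (tens ?i) \<cdot> \<Phi> (tens ?i) (tens ?i') = tens ?i \<otimes> tens ?i'"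
    using perm_comp[OF D(1), of "?i' @ ?i" "?i @ ?i'"] D by (simp add: perm_swap del: distinct_append)
  have r1: "run [g, g'] (?o @ ?o') (?i @ ?i') = arr g \<otimes> arr g'"
  proof -
    have "run [g, g'] (?o @ ?o') (?i @ ?i') = \<Phi> (tens ?o') (tens ?o) \<cdot> (arr g' \<otimes> tens ?o) \<cdot> \<Phi> (tens ?o) (tens ?i') \<cdot> (arr g \<otimes> tens ?i')"
      using d(1) d'(1) D rr by (simp add: perm_swap[simplified])
    also have "\<Phi> (tens ?o) (tens ?i') \<cdot> (arr g \<otimes> tens ?i') = (tens ?i' \<otimes> arr g) \<cdot> \<Phi> (tens ?i) (tens ?i')"
      using braid_nat[of "arr g" "tens ?i'"] d(1) by simp
    also have "\<Phi> (tens ?o') (tens ?o) \<cdot> (arr g' \<otimes> tens ?o) \<cdot> (tens ?i' \<otimes> arr g) \<cdot> \<Phi> (tens ?i) (tens ?i')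
      = (\<Phi> (tens ?o') (tens ?o) \<cdot> (arr g' \<otimes> arr g)) \<cdot> \<Phi> (tens ?i) (tens ?i')"
      using d(1) d'(1) by (simp add: tensor_comp_cont)
    also have "\<Phi> (tens ?o') (tens ?o) \<cdot> (arr g' \<otimes> arr g) = (arr g \<otimes> arr g') \<cdot> \<Phi> (tens ?i') (tens ?i)"
      using braid_nat[of "arr g'" "arr g"] d(1) d'(1) by simp
    finally show ?thesis using sI d(1) d'(1) by simp
  qed
  have r2: "run [g', g] (?o @ ?o') (?i @ ?i') = arr g \<otimes> arr g'"
  proof -
    have "run [g', g] (?o @ ?o') (?i @ ?i') = (arr g \<otimes> tens ?o') \<cdot> \<Phi> (tens ?o') (tens ?i) \<cdot> (arr g' \<otimes> tens ?i) \<cdot> \<Phi> (tens ?i) (tens ?i')"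
      using d(1) d'(1) D rr by (simp add: perm_swap[simplified])
    also have "\<dots> = (arr g \<otimes> tens ?o') \<cdot> (\<Phi> (tens ?o') (tens ?i) \<cdot> (arr g' \<otimes> tens ?i)) \<cdot> \<Phi> (tens ?i) (tens ?i')"
      using d(1) d'(1) by simp
    also have "\<Phi> (tens ?o') (tens ?i) \<cdot> (arr g' \<otimes> tens ?i) = (tens ?i \<otimes> arr g') \<cdot> \<Phi> (tens ?i') (tens ?i)"
      using braid_nat[of "arr g'" "tens ?i"] d'(1) by simp
    finally show ?thesis using sI d(1) d'(1) by (simp add: tensor_comp tensor_comp_cont)
  qed
  have o1: "ok ([g, g'] @ gl) ys ((?i @ ?i') @ ?r)" and o2: "ok ([g', g] @ gl) ys ((?i @ ?i') @ ?r)"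
    using ok_perm_in[OF assms(1) m] ok_perm_in[OF ok' m] by simp_all
  have "run ([g, g'] @ gl) ys ((?i @ ?i') @ ?r) = run ([g', g] @ gl) ys ((?i @ ?i') @ ?r)"
    unfolding run_append_rest[OF k1 o1] run_append_rest[OF k2 o2] r1 r2 ..
  then show "run (g # g' # gl) ys xs = run (g' # g # gl) ys xs"
    using run_perm_in[OF assms(1) m] run_perm_in[OF ok' m] by simp
qed

lemma flow_ins:
  assumes "flow (A @ g # B) ys xs"
  shows "set (ins g) \<subseteq> set xs \<union> set (concat (map outs A))" and "gate g"
proof -
  have "set (ins g) \<subseteq> set xs \<union> set (concat (map outs A)) \<and> gate g"
    using assms by (induction A arbitrary: xs) fastforce+
  then show "set (ins g) \<subseteq> set xs \<union> set (concat (map outs A))" and "gate g" by auto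
qed

lemma run_move:
  assumes "ok (A @ g # B) ys xs" "set (ins g) \<subseteq> set xs"
  shows "ok (g # A @ B) ys xs \<and> run (A @ g # B) ys xs = run (g # A @ B) ys xs"
  using assms
proof (induction A arbitrary: xs)
  case (Cons a A)
  have e: "ok (a # (A @ g # B)) ys xs" using Cons.prems by simp
  note d = ok_ConsD[OF e]
  let ?xs = "outs a @ rem (ins a) xs"
  \<comment> \<open>No gate of \<open>A\<close> produces an input of \<open>g\<close>, because that
    name already occurs in \<open>xs\<close>. As \<open>g\<close> still finds the wire later, gate
    \<open>a\<close> has not consumed it.\<close>
  have "set (ins g) \<subseteq> set ?xs \<union> set (concat (map outs A))"
    using flow_ins(1)[of A g B ys ?xs] d(7) by (simp add: ok_def)
  moreover have "set (ins g) \<inter> set (concat (map outs A)) = {}"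
    using Cons.prems by (auto simp: ok_def)
  ultimately have s: "set (ins g) \<subseteq> set ?xs" by blast
  note IH = Cons.IH[OF d(7) s]
  have ok2: "ok (a # g # A @ B) ys xs"
    using IH e unfolding ok_def by auto
  show ?case
    using run_exchange[OF ok2 Cons.prems(2)] IH by simp
qed simp

text \<open>The gate that heads \<open>gl'\<close> occurs somewhere in \<open>gl\<close>, and its
  inputs are initial wires, so it can be moved to the front there too. A circuit is thus determined
  by its multiset of gates.\<close>

lemma run_mset:
  assumes "ok gl ys xs" "ok gl' ys xs" "mset gl = mset gl'"
  shows "run gl ys xs = run gl' ys xs"
  using assms
proof (induction gl' arbitrary: gl xs)
  case (Cons g gl')
  have "g \<in> set gl" using Cons.prems(3) by (metis list.set_intros(1) mset_eq_setD)
  then obtain A B where gl: "gl = A @ g # B" by (auto simp: in_set_conv_decomp)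
  have "set (ins g) \<subseteq> set xs" using ok_ConsD[OF Cons.prems(2)] by simp
  then have mv: "ok (g # A @ B) ys xs" "run gl ys xs = run (g # A @ B) ys xs"
    using run_move[of A g B ys xs] Cons.prems(1) gl by auto
  have "run (A @ B) ys (outs g @ rem (ins g) xs) = run gl' ys (outs g @ rem (ins g) xs)"
    by (rule Cons.IH) (use ok_ConsD[OF mv(1)] ok_ConsD[OF Cons.prems(2)] Cons.prems(3) gl in auto)
  then show ?case using mv by simp
qed simp

text \<open>The last conjunct ensures that wherever \<open>L\<close> occurs inside a circuit, all
  interface wires \<open>is\<close> are present. It concerns \<open>L\<close> alone, which is why
  reversing a rule in \<open>eqv_sym\<close> carries a condition.\<close>

definition eqv :: "'w list \<Rightarrow> 'w list \<Rightarrow> ('w, 'a) gate list \<Rightarrow> ('w, 'a) gate list \<Rightarrow> bool" where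
  "eqv is os L R \<longleftrightarrow> ok L os is \<and> ok R os is \<and> run L os is = run R os is \<and>
     set is \<subseteq> set (concat (map ins L))"

lemma flow_ins_all:
  assumes "flow (L @ B) ys xs" "x \<in> set (concat (map ins L))" "x \<notin> set (concat (map outs L))"
  shows "x \<in> set xs"
  using assms by (induction L arbitrary: xs) fastforce+

text \<open>Once the prefix \<open>A\<close> has been executed, the interface wires are collected in
  front, and locality isolates \<open>L\<close> and \<open>R\<close>, whose values agree.\<close>

lemma run_rewrite:
  assumes "eqv is os L R" "ok (A @ L @ B) ys xs" "ok (A @ R @ B) ys xs"
  shows "run (A @ L @ B) ys xs = run (A @ R @ B) ys xs"
  using assms
proof (induction A arbitrary: xs)
  case Nil
  have L: "ok L os is" and R: "ok R os is" and e: "run L os is = run R os is" and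
    c: "set is \<subseteq> set (concat (map ins L))" using Nil.prems(1) by (auto simp: eqv_def)
  have "set is \<inter> set (concat (map outs L)) = {}" using L by (auto simp: ok_def)
  then have "set is \<subseteq> set xs"
    using flow_ins_all[of L B ys xs] c Nil.prems(2) unfolding ok_def by fastforce
  then have m: "mset xs = mset (is @ rem is xs)"
    using L Nil.prems(2) by (intro mset_rem) (auto simp: ok_def)
  have o: "ok (L @ B) ys xs" "ok (R @ B) ys xs" using Nil.prems by simp_all
  have "run (L @ B) ys (is @ rem is xs) = run (R @ B) ys (is @ rem is xs)"
    unfolding run_append_rest[OF L ok_perm_in[OF o(1) m]] run_append_rest[OF R ok_perm_in[OF o(2) m]] e ..
  then show ?case using run_perm_in[OF o(1) m] run_perm_in[OF o(2) m] by simp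
next
  case (Cons a A)
  have "ok (a # (A @ L @ B)) ys xs" "ok (a # (A @ R @ B)) ys xs" using Cons.prems by simp_all
  from Cons.IH[OF Cons.prems(1) ok_ConsD(7)[OF this(1)] ok_ConsD(7)[OF this(2)]]
  show ?case by simp
qed

declare run.simps [simp del]

text \<open>The format of the calculations: \<open>L\<close> stands at position \<open>n\<close>,
  and \<open>gl'\<close> may list the new gates in any admissible order. On concrete lists the other
  premises are evaluated, so a calculation consists of its intermediate circuits.\<close>

lemma run_step:
  assumes "eqv is os L R" "take (length L) (drop n gl) = L" "ok gl ys xs"
    "ok (take n gl @ R @ drop (n + length L) gl) ys xs"
    "mset gl' = mset (take n gl @ R @ drop (n + length L) gl)" "ok gl' ys xs"
  shows "run gl ys xs = run gl' ys xs"
proof -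
  have e: "gl = take n gl @ L @ drop (n + length L) gl"
    using assms(2) by (metis append_take_drop_id drop_drop add.commute)
  have "run gl ys xs = run (take n gl @ R @ drop (n + length L) gl) ys xs"
    using run_rewrite[OF assms(1), of "take n gl" "drop (n + length L) gl" ys xs] assms(3,4) e by metis
  also have "\<dots> = run gl' ys xs"
    using assms by (intro run_mset) simp_all
  finally show ?thesis .
qed

lemma flow_append:
  assumes "flow R os is" "distinct os" "distinct (is @ concat (map outs R))" "flow B ys (os @ r)"
    "set r \<inter> (set is \<union> set (concat (map outs R))) = {}"
  shows "flow (R @ B) ys (is @ r)"
  using assms
proof (induction R arbitrary: "is")
  case Nil
  then show ?case using flow_set_cong[of "is @ r" "os @ r" B ys] by auto
next
  case (Cons g R)
  have r: "rem (ins g) r = r" using Cons.prems by (intro rem_disjoint) auto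
  have "flow (R @ B) ys ((outs g @ rem (ins g) is) @ r)"
    by (rule Cons.IH) (use Cons.prems in auto)
  then show ?case using Cons.prems r by auto
qed

text \<open>In a symbolic context the well-formedness of the result cannot be evaluated. It is
  inherited if the internal names of \<open>R\<close> are fresh; the names in \<open>os\<close> are
  safe because \<open>L\<close> already owned them.\<close>

lemma ok_rewrite:
  assumes "eqv is os L R" "ok (A @ L @ B) ys xs"
    "(set (concat (map outs R)) - set os) \<inter> (set xs \<union> set (concat (map outs (A @ B)))) = {}"
  shows "ok (A @ R @ B) ys xs"
proof -
  have L: "ok L os is" and R: "ok R os is" and c: "set is \<subseteq> set (concat (map ins L))"
    using assms(1) by (auto simp: eqv_def)
  \<comment> \<open>An interface output comes from an input or from a gate of \<open>L\<close>. One
    that \<open>R\<close> produces is no input, hence was an output of a gate of \<open>L\<close>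
    and clashes with nothing outside.\<close>
  have new: "set os \<subseteq> set is \<union> set (concat (map outs L))"
  proof -
    have "flow L os is \<Longrightarrow> set os \<subseteq> set is \<union> set (concat (map outs L))" for "is"
      by (induction L arbitrary: "is") fastforce+
    then show ?thesis using L by (simp add: ok_def)
  qed
  have Ris: "set (concat (map outs R)) \<inter> set is = {}" using R by (auto simp: ok_def)
  have out: "set (concat (map outs R)) \<inter> (set xs \<union> set (concat (map outs (A @ B)))) = {}"
    using assms(2,3) new Ris unfolding ok_def by fastforce
  have main: "flow (A @ R @ B) ys xs"
    if "flow (A @ L @ B) ys xs" "distinct (xs @ concat (map outs (A @ L @ B)))"
      "set (concat (map outs R)) \<inter> (set xs \<union> set (concat (map outs (A @ B)))) = {}" for xs
    using that
  proof (induction A arbitrary: xs)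
    case Nil
    have "distinct ys" using assms(2) by (simp add: ok_def)
    then have okL: "ok (L @ B) ys xs" using Nil.prems by (simp add: ok_def)
    have "set is \<inter> set (concat (map outs L)) = {}" using L by (auto simp: ok_def)
    then have sub: "set is \<subseteq> set xs"
      using flow_ins_all[of L B ys xs] c Nil.prems(1) by fastforce
    then have m: "mset xs = mset (is @ rem is xs)"
      using L Nil.prems by (intro mset_rem) (auto simp: ok_def)
    have "ok B ys (os @ rem is xs)"
      by (rule ok_append_rest[OF L ok_perm_in[OF okL m]])
    then have "flow (R @ B) ys (is @ rem is xs)"
      using R Nil.prems(3) by (intro flow_append[of R os]) (auto simp: ok_def)
    then show ?case using flow_set_cong[OF mset_eq_setD[OF m], of "R @ B" ys] by simp
  next
    case (Cons a A)
    have "flow (A @ R @ B) ys (outs a @ rem (ins a) xs)"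
      by (rule Cons.IH) (use Cons.prems in auto)
    then show ?case using Cons.prems by simp
  qed
  show ?thesis
    using assms(2) main[of xs] out R by (auto simp: ok_def)
qed

lemma rewrite_step:
  assumes "eqv is os L R" "gl = A @ L @ B" "ok gl ys xs"
    "(set (concat (map outs R)) - set os) \<inter> (set xs \<union> set (concat (map outs (A @ B)))) = {}"
  shows "ok (A @ R @ B) ys xs \<and> run gl ys xs = run (A @ R @ B) ys xs"
  using run_rewrite[OF assms(1)] ok_rewrite[OF assms(1)] assms(2-4) by simp

text \<open>A dictionary from arrow terms to circuits. It is closed under composition and tensor
  product and covers braidings, so both sides of an axiom are translated along their syntax and then
  compared as circuits.\<close>

definition rep :: "'w list \<Rightarrow> 'a \<Rightarrow> ('w, 'a) gate list \<Rightarrow> 'w list \<Rightarrow> bool" where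
  "rep xs f gl ys \<longleftrightarrow> ok gl ys xs \<and> f = run gl ys xs"

lemma rep_perm:
  assumes "distinct xs" "distinct ys" "mset xs = mset ys"
  shows "rep xs (perm xs ys) [] ys"
  using assms by (simp add: rep_def ok_Nil run.simps)

lemma rep_id: "distinct xs \<Longrightarrow> rep xs (tens xs) [] xs"
  using rep_perm[of xs xs] by simp

lemma rep_braid: "distinct (xs @ ys) \<Longrightarrow> rep (xs @ ys) (\<Phi> (tens xs) (tens ys)) [] (ys @ xs)"
  using rep_perm[of "xs @ ys" "ys @ xs"] by (auto simp: perm_swap)

lemma rep_gate:
  assumes "gate g" "distinct (ins g @ outs g)"
  shows "rep (ins g) (arr g) [g] (outs g)"
  using assms by (auto simp: rep_def ok_def rem_all run.simps)

lemma rep_comp: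
  assumes "rep xs f gl zs" "rep zs h gl' ys" "ok (gl @ gl') ys xs"
  shows "rep xs (h \<cdot> f) (gl @ gl') ys"
  using assms run_append_rest[of gl zs xs gl' ys "[]"] by (auto simp: rep_def run.simps)

text \<open>Side by side is executed as one after the other: \<open>gl\<close> while
  \<open>xs'\<close> waits, then \<open>gl'\<close> while \<open>ys\<close> waits. The second
  circuit sits to the right of the waiting wires; a block braiding brings it to the left, and
  naturality removes the braiding again.\<close>

lemma rep_tensor:
  assumes f: "rep xs f gl ys" and h: "rep xs' h gl' ys'" and o: "ok (gl @ gl') (ys @ ys') (xs @ xs')"
  shows "rep (xs @ xs') (f \<otimes> h) (gl @ gl') (ys @ ys')"
proof -
  have f: "ok gl ys xs" "f = run gl ys xs" and h: "ok gl' ys' xs'" "h = run gl' ys' xs'"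
    using f h by (auto simp: rep_def)
  have o': "ok gl' (ys @ ys') (ys @ xs')" by (rule ok_append_rest[OF f(1) o])
  have o'': "ok gl' (ys @ ys') (xs' @ ys)" by (rule ok_perm_in[OF o']) simp
  have o3: "ok (gl' @ []) (ys @ ys') (xs' @ ys)" using o'' by simp
  have D: "distinct (ys @ xs')" "distinct (xs' @ ys)" "distinct (ys' @ ys)"
    using o' by (auto simp: ok_def)
  have "run gl' (ys @ ys') (ys @ xs') = run gl' (ys @ ys') (xs' @ ys) \<cdot> perm (ys @ xs') (xs' @ ys)"
    by (rule run_perm_in[OF o', symmetric]) simp
  also have "run gl' (ys @ ys') (xs' @ ys) = perm (ys' @ ys) (ys @ ys') \<cdot> (h \<otimes> tens ys)"
    using run_append_rest[OF h(1) o3] h(2) by (simp add: run.simps)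
  also have "perm (ys' @ ys) (ys @ ys') \<cdot> (h \<otimes> tens ys) = (tens ys \<otimes> h) \<cdot> \<Phi> (tens xs') (tens ys)"
    using braid_nat[of h "tens ys"] run_typing[OF h(1)] h(2) D by (simp add: perm_swap)
  also have "((tens ys \<otimes> h) \<cdot> \<Phi> (tens xs') (tens ys)) \<cdot> perm (ys @ xs') (xs' @ ys)
    = (tens ys \<otimes> h) \<cdot> perm (xs' @ ys) (ys @ xs') \<cdot> perm (ys @ xs') (xs' @ ys)"
    using run_typing[OF h(1)] h(2) D by (simp add: perm_swap)
  also have "perm (xs' @ ys) (ys @ xs') \<cdot> perm (ys @ xs') (xs' @ ys) = tens ys \<otimes> tens xs'"
    using perm_comp[OF D(1), of "xs' @ ys" "ys @ xs'"] by simp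
  finally have e: "run gl' (ys @ ys') (ys @ xs') = tens ys \<otimes> h"
    using run_typing[OF h(1)] h(2) by simp
  have "run (gl @ gl') (ys @ ys') (xs @ xs') = (tens ys \<otimes> h) \<cdot> (f \<otimes> tens xs')"
    using run_append_rest[OF f(1) o] e f(2) by simp
  also have "\<dots> = f \<otimes> h"
    using run_typing[OF f(1)] run_typing[OF h(1)] f(2) h(2) by (simp add: tensor_comp)
  finally show ?thesis using o by (simp add: rep_def)
qed

lemma rep_eq:
  assumes "rep xs f gl ys" "rep xs f' gl' ys" "run gl ys xs = run gl' ys xs"
  shows "f = f'"
  using assms by (simp add: rep_def)

lemma eqv_rep:
  assumes "rep is f L os" "rep is f R os" "set is \<subseteq> set (concat (map ins L))"
  shows "eqv is os L R"
  using assms by (simp add: rep_def eqv_def)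

lemma rep_mset:
  assumes "rep xs f gl ys" "mset gl = mset gl'" "ok gl' ys xs"
  shows "rep xs f gl' ys"
  using assms run_mset[of gl ys xs gl'] by (auto simp: rep_def)

fun state :: "('w, 'a) gate list \<Rightarrow> 'w list \<Rightarrow> 'w list" where
  "state [] xs = xs"
| "state (g # gl) xs = state gl (outs g @ rem (ins g) xs)"

lemma state_append: "state (A @ B) xs = state B (state A xs)"
  by (induction A arbitrary: xs) auto

text \<open>This brings a product gate next to the coproduct against which it is to be cancelled;
  \<open>state A xs\<close> lists the wires present after \<open>A\<close>.\<close>

lemma run_move_prefix:
  assumes "ok (A @ B @ g # E) ys xs" "set (ins g) \<subseteq> set (state A xs)"
  shows "ok (A @ g # B @ E) ys xs \<and> run (A @ B @ g # E) ys xs = run (A @ g # B @ E) ys xs"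
  using assms
proof (induction A arbitrary: xs)
  case Nil
  then show ?case using run_move[of B g E ys xs] by simp
next
  case (Cons a A)
  have e: "ok (a # (A @ B @ g # E)) ys xs" using Cons.prems by simp
  have "ok (A @ g # B @ E) ys (outs a @ rem (ins a) xs) \<and>
      run (A @ B @ g # E) ys (outs a @ rem (ins a) xs) = run (A @ g # B @ E) ys (outs a @ rem (ins a) xs)"
    by (rule Cons.IH) (use ok_ConsD[OF e] Cons.prems(2) in auto)
  then show ?case using e by (auto simp: ok_def run.simps)
qed

end

section \<open>Duals\<close>

locale dual_object = strict_braided_monoidal_category C for C :: "'a braided_cat" (structure) +
  fixes X D ev coev :: 'a
  assumes X_object [simp]: "X \<in> objects C" and D_object [simp]: "D \<in> objects C"
    and ev_hom: "ev \<in> hom C (D \<otimes> X) \<one>" and coev_hom: "coev \<in> hom C \<one> (X \<otimes> D)"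
    and triangle_X: "(X \<otimes> ev) \<cdot> (coev \<otimes> X) = X"
    and triangle_D: "(ev \<otimes> D) \<cdot> (D \<otimes> coev) = D"
begin

lemma dual_typing [simp]:
  "ev \<in> Arr C" "Dom C ev = D \<otimes> X" "Cod C ev = \<one>"
  "coev \<in> Arr C" "Dom C coev = \<one>" "Cod C coev = X \<otimes> D"
  using ev_hom coev_hom by (auto simp: hom_iff)

text \<open>The triangle law for \<open>D\<close> straightens the zigzag. The extra factor
  \<open>Y\<close> allows one output in \<open>D\<close> to be tested while others are still
  present; the universal property of the internal hom covers only the unit object in this
  place.\<close>

lemma transpose_inverse:
  assumes "Y \<in> objects C" "g \<in> Arr C" "Cod C g = Y \<otimes> D"
  shows "(((Y \<otimes> ev) \<cdot> (g \<otimes> X)) \<otimes> D) \<cdot> (Dom C g \<otimes> coev) = g"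
proof -
  have "(((Y \<otimes> ev) \<cdot> (g \<otimes> X)) \<otimes> D) \<cdot> (Dom C g \<otimes> coev)
    = (Y \<otimes> ev \<otimes> D) \<cdot> (g \<otimes> X \<otimes> D) \<cdot> (Dom C g \<otimes> coev)"
    using assms by (simp add: whisker_r)
  also have "\<dots> = (Y \<otimes> ev \<otimes> D) \<cdot> (Y \<otimes> D \<otimes> coev) \<cdot> g"
    using slide[of g coev] assms by simp
  also have "\<dots> = (Y \<otimes> ((ev \<otimes> D) \<cdot> (D \<otimes> coev))) \<cdot> g"
    using assms by (simp add: whisker_l)
  finally show ?thesis unfolding triangle_D using assms by simp
qed

lemma transpose_inj:
  assumes "Y \<in> objects C" "g \<in> Arr C" "Cod C g = Y \<otimes> D" "g' \<in> Arr C" "Cod C g' = Y \<otimes> D"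
    "Dom C g = Dom C g'" "(Y \<otimes> ev) \<cdot> (g \<otimes> X) = (Y \<otimes> ev) \<cdot> (g' \<otimes> X)"
  shows "g = g'"
  using transpose_inverse[of Y g] transpose_inverse[of Y g'] assms by metis

lemma transpose_exists:
  assumes "Z \<in> objects C" "f \<in> Arr C" "Dom C f = Z \<otimes> X"
  obtains g where "g \<in> Arr C" "Dom C g = Z" "Cod C g = Cod C f \<otimes> D" "(Cod C f \<otimes> ev) \<cdot> (g \<otimes> X) = f"
proof
  let ?g = "(f \<otimes> D) \<cdot> (Z \<otimes> coev)"
  show "?g \<in> Arr C" "Dom C ?g = Z" "Cod C ?g = Cod C f \<otimes> D" using assms by simp_all
  have "(Cod C f \<otimes> ev) \<cdot> (?g \<otimes> X) = (Cod C f \<otimes> ev) \<cdot> (f \<otimes> D \<otimes> X) \<cdot> (Z \<otimes> coev \<otimes> X)"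
    using assms by (simp add: whisker_r)
  also have "\<dots> = f \<cdot> (Z \<otimes> X \<otimes> ev) \<cdot> (Z \<otimes> coev \<otimes> X)"
    using slide_cont[of f ev "Z \<otimes> coev \<otimes> X"] assms by simp
  also have "(Z \<otimes> X \<otimes> ev) \<cdot> (Z \<otimes> coev \<otimes> X) = Z \<otimes> X"
    using whisker_l[of Z "coev \<otimes> X" "X \<otimes> ev"] assms by (simp add: triangle_X)
  finally show "(Cod C f \<otimes> ev) \<cdot> (?g \<otimes> X) = f" using assms by simp
qed

text \<open>Naturality lets \<open>ev\<close> pass a strand \<open>D\<close> on either side. One
  passage, with the crossing of \<open>X\<close> and \<open>D\<close> inverted by the hypothesis,
  converts the first \<open>\<Phi> D D\<close> under the pairing into a crossing of \<open>D\<close>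
  with \<open>X\<close>; the other passage absorbs the second \<open>\<Phi> D D\<close>.\<close>

lemma braid_dual_sym:
  assumes "\<Phi> X D \<cdot> \<Phi> D X = D \<otimes> X"
  shows "\<Phi> D D \<cdot> \<Phi> D D = D \<otimes> D"
proof -
  have "(D \<otimes> ev) \<cdot> (\<Phi> D D \<otimes> X) \<cdot> (D \<otimes> \<Phi> X D) = ev \<otimes> D"
    using braid_nat[of ev D] by (simp add: hexagon2)
  then have "((D \<otimes> ev) \<cdot> (\<Phi> D D \<otimes> X) \<cdot> (D \<otimes> \<Phi> X D)) \<cdot> (D \<otimes> \<Phi> D X) = (ev \<otimes> D) \<cdot> (D \<otimes> \<Phi> D X)"
    by simp
  moreover have "(D \<otimes> \<Phi> X D) \<cdot> (D \<otimes> \<Phi> D X) = D \<otimes> D \<otimes> X"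
    using whisker_l[of D "\<Phi> D X" "\<Phi> X D"] assms by simp
  ultimately have A: "(D \<otimes> ev) \<cdot> (\<Phi> D D \<otimes> X) = (ev \<otimes> D) \<cdot> (D \<otimes> \<Phi> D X)"
    by simp
  have B: "(ev \<otimes> D) \<cdot> (D \<otimes> \<Phi> D X) \<cdot> (\<Phi> D D \<otimes> X) = D \<otimes> ev"
    using braid_nat[of D ev] by (simp add: hexagon1)
  have "(D \<otimes> ev) \<cdot> ((\<Phi> D D \<cdot> \<Phi> D D) \<otimes> X) = ((D \<otimes> ev) \<cdot> (\<Phi> D D \<otimes> X)) \<cdot> (\<Phi> D D \<otimes> X)"
    by (simp add: whisker_r)
  also have "\<dots> = D \<otimes> ev" unfolding A using B by simp
  finally show ?thesis
    using transpose_inj[of D "\<Phi> D D \<cdot> \<Phi> D D" "D \<otimes> D"] by simp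
qed

end

context strict_braided_monoidal_category
begin

text \<open>The coevaluation is the dual basis: the preimage, under the dual basis isomorphism, of
  the element of [X,X] that names the identity. One triangle law expresses this; the other holds
  because both of its sides have the same pairing with \<open>ev\<close>.\<close>

lemma finite_object_dual:
  assumes "finite_object C X" "internal_hom C X \<one> D ev"
  shows "\<exists>coev. dual_object C X D ev coev"
proof -
  obtain D' ev' E e where ih': "internal_hom C X \<one> D' ev'" and ihE: "internal_hom C X X E e"
    and iso: "is_iso C (dual_basis_morphism C X D' ev' E e)"
    using assms(1) by (auto simp: finite_object_def)
  have obj [simp]: "X \<in> objects C" "D \<in> objects C" "D' \<in> objects C" "E \<in> objects C"
    using ih' ihE assms(2) by (auto simp: internal_hom_def)
  have ar [simp]: "ev \<in> Arr C" "Dom C ev = D \<otimes> X" "Cod C ev = \<one>"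
    "ev' \<in> Arr C" "Dom C ev' = D' \<otimes> X" "Cod C ev' = \<one>" "e \<in> Arr C" "Dom C e = E \<otimes> X" "Cod C e = X"
    using ih' ihE assms(2) by (auto simp: internal_hom_def hom_iff)
  let ?d = "dual_basis_morphism C X D' ev' E e"
  have "\<exists>!d. d \<in> hom C (X \<otimes> D') E \<and> e \<cdot> (d \<otimes> X) = X \<otimes> ev'"
    using ihE unfolding internal_hom_def by (auto simp: hom_iff)
  from theI'[OF this] have d: "?d \<in> hom C (X \<otimes> D') E" "e \<cdot> (?d \<otimes> X) = X \<otimes> ev'"
    unfolding dual_basis_morphism_def by auto
  \<comment> \<open>\<open>j\<close> is the name of the identity of \<open>X\<close>.\<close>
  obtain j where j: "j \<in> hom C \<one> E" "e \<cdot> (j \<otimes> X) = X"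
    using ihE unfolding internal_hom_def by (metis hom_iff object_typing objects_closed(1) tensor_unit_left)
  \<comment> \<open>\<open>finite_object\<close> supplies some internal hom \<open>D'\<close>, which
    may differ from the given \<open>D\<close>; \<open>u\<close> compares their evaluations.\<close>
  obtain u where u: "u \<in> hom C D' D" "ev \<cdot> (u \<otimes> X) = ev'"
    using assms(2) ih' unfolding internal_hom_def by metis
  note ty = d(1) j(1) u(1)
  have ty' [simp]: "?d \<in> Arr C" "Dom C ?d = X \<otimes> D'" "Cod C ?d = E" "j \<in> Arr C" "Dom C j = \<one>" "Cod C j = E"
    "u \<in> Arr C" "Dom C u = D'" "Cod C u = D"
    using ty by (auto simp: hom_iff)
  note i [simp] = inv_arrow_facts[OF iso, simplified]
  define c' where "c' = inv_arrow C ?d \<cdot> j"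
  have c' [simp]: "c' \<in> Arr C" "Dom C c' = \<one>" "Cod C c' = X \<otimes> D'" by (simp_all add: c'_def)
  have dc: "?d \<cdot> c' = j"
    using comp_assoc'[of j "inv_arrow C ?d" ?d] by (simp add: c'_def del: comp_assoc')
  have "(X \<otimes> ev') \<cdot> (c' \<otimes> X) = e \<cdot> (?d \<otimes> X) \<cdot> (c' \<otimes> X)"
    unfolding d(2)[symmetric] by simp
  also have "\<dots> = X" using whisker_r[of X c' ?d] dc j(2) by simp
  finally have t': "(X \<otimes> ev') \<cdot> (c' \<otimes> X) = X" .
  define c where "c = (X \<otimes> u) \<cdot> c'"
  have c [simp]: "c \<in> Arr C" "Dom C c = \<one>" "Cod C c = X \<otimes> D" by (simp_all add: c_def)
  have "(X \<otimes> ev) \<cdot> (c \<otimes> X) = (X \<otimes> (ev \<cdot> (u \<otimes> X))) \<cdot> (c' \<otimes> X)"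
    by (simp add: c_def whisker_l whisker_r)
  then have tX: "(X \<otimes> ev) \<cdot> (c \<otimes> X) = X" using u(2) t' by simp
  \<comment> \<open>The left side of the second triangle law; sliding the two evaluations past each
    other reduces its pairing to the first law.\<close>
  let ?g = "(ev \<otimes> D) \<cdot> (D \<otimes> c)"
  have "ev \<cdot> (?g \<otimes> X) = ev \<cdot> (ev \<otimes> D \<otimes> X) \<cdot> (D \<otimes> c \<otimes> X)"
    by (simp add: whisker_r)
  also have "\<dots> = ev \<cdot> (D \<otimes> X \<otimes> ev) \<cdot> (D \<otimes> c \<otimes> X)"
    using slide_cont[of ev ev "D \<otimes> c \<otimes> X"] by simp
  also have "\<dots> = ev \<cdot> (D \<otimes> X)"
    using whisker_l[of D "c \<otimes> X" "X \<otimes> ev"] by (simp add: tX)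
  finally have "ev \<cdot> (?g \<otimes> X) = ev" by simp
  moreover have "ev \<cdot> (D \<otimes> X) = ev" by simp
  moreover have "\<exists>!g. g \<in> hom C D D \<and> ev \<cdot> (g \<otimes> X) = ev"
    using assms(2) unfolding internal_hom_def by (auto simp: hom_iff)
  moreover have "?g \<in> hom C D D" "D \<in> hom C D D" by (simp_all add: hom_iff)
  ultimately have "?g = D" by blast
  then have "dual_object C X D ev c"
    by unfold_locales (simp_all add: hom_iff tX)
  then show ?thesis ..
qed

end

section \<open>Words in a bialgebra\<close>

text \<open>The constructor determines the object. Thus \<open>hw 1\<close> and \<open>dw 1\<close>
  are different wires, and the same numbers serve for both kinds.\<close>

datatype wire = hw nat | dw nat

locale hopf_dual = dual_object C "\<langle>H\<rangle>" D ev coev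
  for C :: "'a braided_cat" (structure) and H :: "'a bialg_data" and D ev coev :: 'a +
  assumes bialgebra: "bialgebra C H"
    and sym_HH: "\<Phi> \<langle>H\<rangle> \<langle>H\<rangle> \<cdot> \<Phi> \<langle>H\<rangle> \<langle>H\<rangle> = \<langle>H\<rangle> \<otimes> \<langle>H\<rangle>"
    and sym_HD: "\<Phi> \<langle>H\<rangle> D \<cdot> \<Phi> D \<langle>H\<rangle> = D \<otimes> \<langle>H\<rangle>"
    and sym_DH: "\<Phi> D \<langle>H\<rangle> \<cdot> \<Phi> \<langle>H\<rangle> D = \<langle>H\<rangle> \<otimes> D"
begin

abbreviation "A \<equiv> \<langle>H\<rangle>"

primrec wire_object :: "wire \<Rightarrow> 'a" where
  "wire_object (hw n) = A"
| "wire_object (dw n) = D"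

end

sublocale hopf_dual \<subseteq> wires C wire_object
proof unfold_locales
  show "wire_object v \<in> objects C" for v by (cases v) simp_all
  show "\<Phi> (wire_object v) (wire_object w) \<cdot> \<Phi> (wire_object w) (wire_object v) = wire_object w \<otimes> wire_object v"
    for v w
    by (cases v; cases w) (simp_all add: sym_HH sym_HD sym_DH braid_dual_sym)
qed

context hopf_dual
begin

abbreviation "hmult \<equiv> \<nabla>\<^bsub>H\<^esub>"
abbreviation "hunit \<equiv> \<eta>\<^bsub>H\<^esub>"
abbreviation "hcomult \<equiv> \<Delta>\<^bsub>H\<^esub>"
abbreviation "hcounit \<equiv> \<epsilon>\<^bsub>H\<^esub>"

lemma hopf_typing [simp]:
  "hmult \<in> Arr C" "Dom C hmult = A \<otimes> A" "Cod C hmult = A"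
  "hunit \<in> Arr C" "Dom C hunit = \<one>" "Cod C hunit = A"
  "hcomult \<in> Arr C" "Dom C hcomult = A" "Cod C hcomult = A \<otimes> A"
  "hcounit \<in> Arr C" "Dom C hcounit = A" "Cod C hcounit = \<one>"
  using bialgebra by (auto simp: bialgebra_def algebra_def coalgebra_def hom_iff)

lemma hopf_laws:
  "hmult \<cdot> (hmult \<otimes> A) = hmult \<cdot> (A \<otimes> hmult)"
  "hmult \<cdot> (hunit \<otimes> A) = A" "hmult \<cdot> (A \<otimes> hunit) = A"
  "(hcomult \<otimes> A) \<cdot> hcomult = (A \<otimes> hcomult) \<cdot> hcomult"
  "(hcounit \<otimes> A) \<cdot> hcomult = A" "(A \<otimes> hcounit) \<cdot> hcomult = A"
  "hcomult \<cdot> hmult = (hmult \<otimes> hmult) \<cdot> (A \<otimes> \<Phi> A A \<otimes> A) \<cdot> (hcomult \<otimes> hcomult)"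
  "hcomult \<cdot> hunit = hunit \<otimes> hunit" "hcounit \<cdot> hmult = hcounit \<otimes> hcounit" "hcounit \<cdot> hunit = \<one>"
  using bialgebra by (auto simp: bialgebra_def algebra_def coalgebra_def)

text \<open>Only the length of the list matters; the entries are there to name the input wires. The
  unit is the product of no factors, and dually for \<open>copl\<close>, so one family of gates
  covers units and products.\<close>

primrec prodl :: "nat list \<Rightarrow> 'a" where
  "prodl [] = hunit"
| "prodl (a # as) = hmult \<cdot> (A \<otimes> prodl as)"

primrec copl :: "nat list \<Rightarrow> 'a" where
  "copl [] = hcounit"
| "copl (a # as) = (A \<otimes> copl as) \<cdot> hcomult"

lemma prodl_typing [simp]:
  "prodl as \<in> Arr C" "Dom C (prodl as) = tens (map hw as)" "Cod C (prodl as) = A"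
  by (induction as) auto

lemma copl_typing [simp]:
  "copl as \<in> Arr C" "Dom C (copl as) = A" "Cod C (copl as) = tens (map hw as)"
  by (induction as) auto

lemma prodl_small: "prodl [a] = A" "prodl [a, b] = hmult"
  by (simp_all add: hopf_laws)

lemma copl_small: "copl [a] = A" "copl [a, b] = hcomult"
  by (simp_all add: hopf_laws)

lemma prodl_append: "prodl (as @ bs) = hmult \<cdot> (prodl as \<otimes> prodl bs)"
proof (induction as)
  case Nil
  have "hmult \<cdot> (hunit \<otimes> prodl bs) = (hmult \<cdot> (hunit \<otimes> A)) \<cdot> prodl bs"
    by (simp add: tensor_comp) (use tensor_comp[of "\<one>" hunit "prodl bs" "A"] in simp)
  then show ?case by (simp add: hopf_laws)
next
  case (Cons a as)
  have "prodl ((a # as) @ bs) = (hmult \<cdot> (A \<otimes> hmult)) \<cdot> (A \<otimes> prodl as \<otimes> prodl bs)"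
    by (simp add: Cons.IH whisker_l)
  also have "\<dots> = hmult \<cdot> (hmult \<otimes> A) \<cdot> (A \<otimes> prodl as \<otimes> prodl bs)"
    unfolding hopf_laws(1)[symmetric] by simp
  also have "(hmult \<otimes> A) \<cdot> (A \<otimes> prodl as \<otimes> prodl bs) = prodl (a # as) \<otimes> prodl bs"
    using tensor_comp[of "A \<otimes> prodl as" hmult "prodl bs" "A"] by simp
  finally show ?case .
qed

lemma copl_append: "copl (as @ bs) = (copl as \<otimes> copl bs) \<cdot> hcomult"
proof (induction as)
  case Nil
  have "(hcounit \<otimes> copl bs) \<cdot> hcomult = copl bs \<cdot> (hcounit \<otimes> A) \<cdot> hcomult"
    using tensor_comp_cont[of hcounit "\<one>" "A" "copl bs" hcomult] by simp
  then show ?case by (simp add: hopf_laws)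
next
  case (Cons a as)
  have "copl ((a # as) @ bs) = (A \<otimes> copl as \<otimes> copl bs) \<cdot> (A \<otimes> hcomult) \<cdot> hcomult"
    by (simp add: Cons.IH whisker_l)
  also have "\<dots> = ((A \<otimes> copl as \<otimes> copl bs) \<cdot> (hcomult \<otimes> A)) \<cdot> hcomult"
    unfolding hopf_laws(4)[symmetric] by simp
  also have "(A \<otimes> copl as \<otimes> copl bs) \<cdot> (hcomult \<otimes> A) = copl (a # as) \<otimes> copl bs"
    using tensor_comp[of hcomult "A \<otimes> copl as" "A" "copl bs"] by simp
  finally show ?case .
qed

definition Mul :: "nat list \<Rightarrow> nat \<Rightarrow> (wire, 'a) gate" where
  "Mul as z = (map hw as, [hw z], prodl as)"

definition Cop :: "nat \<Rightarrow> nat list \<Rightarrow> (wire, 'a) gate" where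
  "Cop x as = ([hw x], map hw as, copl as)"

definition Ap :: "'a \<Rightarrow> nat \<Rightarrow> nat \<Rightarrow> (wire, 'a) gate" where
  "Ap f x y = ([hw x], [hw y], f)"

definition Ev :: "nat \<Rightarrow> nat \<Rightarrow> (wire, 'a) gate" where
  "Ev f x = ([dw f, hw x], [], ev)"

abbreviation endo :: "'a \<Rightarrow> bool" where
  "endo f \<equiv> f \<in> hom C A A"

lemma gate_simps [simp]:
  "ins (Mul as z) = map hw as" "outs (Mul as z) = [hw z]" "gate (Mul as z)"
  "ins (Cop x as) = [hw x]" "outs (Cop x as) = map hw as" "gate (Cop x as)"
  "ins (Ap f x y) = [hw x]" "outs (Ap f x y) = [hw y]" "gate (Ap f x y) \<longleftrightarrow> endo f"
  "ins (Ev k x) = [dw k, hw x]" "outs (Ev k x) = []" "gate (Ev k x)"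
  by (simp_all add: Mul_def Cop_def Ap_def Ev_def gate_def hom_iff)

lemma arr_simps:
  "arr (Mul as z) = prodl as" "arr (Cop x as) = copl as" "arr (Ap f x y) = f" "arr (Ev k x) = ev"
  by (simp_all add: Mul_def Cop_def Ap_def Ev_def)

lemma distinct_hw [simp]: "distinct (map hw xs) \<longleftrightarrow> distinct xs"
  by (simp add: distinct_map inj_on_def)

lemma rep_Mul: "distinct (z # as) \<Longrightarrow> rep (map hw as) (prodl as) [Mul as z] [hw z]"
  using rep_gate[of "Mul as z"] by (auto simp: arr_simps)

lemma rep_Cop: "distinct (x # as) \<Longrightarrow> rep [hw x] (copl as) [Cop x as] (map hw as)"
  using rep_gate[of "Cop x as"] by (auto simp: arr_simps)

lemma rep_Ap: "endo f \<Longrightarrow> x \<noteq> y \<Longrightarrow> rep [hw x] f [Ap f x y] [hw y]"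
  using rep_gate[of "Ap f x y"] by (auto simp: arr_simps)

lemma rep_Ev: "rep [dw k, hw x] ev [Ev k x] []"
  using rep_gate[of "Ev k x"] by (auto simp: arr_simps)

lemma rep_hw: "rep [hw x] A [] [hw x]"
  using rep_id[of "[hw x]"] by simp

lemma rep_dw: "rep [dw x] D [] [dw x]"
  using rep_id[of "[dw x]"] by simp

lemma rep_hws: "distinct xs \<Longrightarrow> rep (map hw xs) (tens (map hw xs)) [] (map hw xs)"
  using rep_id[of "map hw xs"] by simp

section \<open>Rewriting rules for bialgebra circuits\<close>

context
  notes ok_def [simp]
begin

text \<open>One rule for associativity and both unit laws: a product feeding a product is flattened,
  and an empty \<open>as\<close> deletes a unit.\<close>

lemma eqv_prods:
  assumes "distinct (y # z # us @ as @ ws)"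
  shows "eqv (map hw (us @ as @ ws)) [hw y] [Mul as z, Mul (us @ z # ws) y] [Mul (us @ as @ ws) y]"
proof (rule eqv_rep)
  show "rep (map hw (us @ as @ ws)) (prodl (us @ as @ ws)) [Mul (us @ as @ ws) y] [hw y]"
    by (rule rep_Mul) (use assms in auto)
  have "rep (map hw as @ map hw ws) (prodl as \<otimes> tens (map hw ws)) ([Mul as z] @ []) ([hw z] @ map hw ws)"
    by (rule rep_tensor[OF rep_Mul rep_hws]) (use assms in auto)
  then have "rep (map hw us @ map hw as @ map hw ws) (tens (map hw us) \<otimes> prodl as \<otimes> tens (map hw ws))
      ([] @ [Mul as z] @ []) (map hw us @ [hw z] @ map hw ws)"
    by (rule rep_tensor[OF rep_hws, rotated]) (use assms in auto)
  then have "rep (map hw (us @ as @ ws)) (tens (map hw us) \<otimes> prodl as \<otimes> tens (map hw ws)) [Mul as z] (map hw (us @ z # ws))"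
    by simp
  then have "rep (map hw (us @ as @ ws)) (prodl (us @ z # ws) \<cdot> (tens (map hw us) \<otimes> prodl as \<otimes> tens (map hw ws)))
      ([Mul as z] @ [Mul (us @ z # ws) y]) [hw y]"
    by (rule rep_comp[OF _ rep_Mul]) (use assms in auto)
  moreover have "prodl (us @ z # ws) \<cdot> (tens (map hw us) \<otimes> prodl as \<otimes> tens (map hw ws)) = prodl (us @ as @ ws)"
    by (simp add: prodl_append tensor_comp)
  ultimately show "rep (map hw (us @ as @ ws)) (prodl (us @ as @ ws)) [Mul as z, Mul (us @ z # ws) y] [hw y]"
    by simp
qed auto

lemma eqv_cops:
  assumes "distinct (x # a # us @ as @ ws)"
  shows "eqv [hw x] (map hw (us @ as @ ws)) [Cop x (us @ a # ws), Cop a as] [Cop x (us @ as @ ws)]"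
proof (rule eqv_rep)
  show "rep [hw x] (copl (us @ as @ ws)) [Cop x (us @ as @ ws)] (map hw (us @ as @ ws))"
    by (rule rep_Cop) (use assms in auto)
  have "rep ([hw a] @ map hw ws) (copl as \<otimes> tens (map hw ws)) ([Cop a as] @ []) (map hw as @ map hw ws)"
    by (rule rep_tensor[OF rep_Cop rep_hws]) (use assms in auto)
  then have "rep (map hw us @ [hw a] @ map hw ws) (tens (map hw us) \<otimes> copl as \<otimes> tens (map hw ws))
      ([] @ [Cop a as] @ []) (map hw us @ map hw as @ map hw ws)"
    by (rule rep_tensor[OF rep_hws, rotated]) (use assms in auto)
  then have "rep (map hw (us @ a # ws)) (tens (map hw us) \<otimes> copl as \<otimes> tens (map hw ws)) [Cop a as] (map hw (us @ as @ ws))"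
    by simp
  then have "rep [hw x] ((tens (map hw us) \<otimes> copl as \<otimes> tens (map hw ws)) \<cdot> copl (us @ a # ws))
      ([Cop x (us @ a # ws)] @ [Cop a as]) (map hw (us @ as @ ws))"
    by (rule rep_comp[OF rep_Cop, rotated]) (use assms in auto)
  moreover have "(tens (map hw us) \<otimes> copl as \<otimes> tens (map hw ws)) \<cdot> copl (us @ a # ws) = copl (us @ as @ ws)"
    by (simp add: copl_append tensor_comp tensor_comp_cont)
  ultimately show "rep [hw x] (copl (us @ as @ ws)) [Cop x (us @ a # ws), Cop a as] (map hw (us @ as @ ws))"
    by simp
qed auto

lemma eqv_sym:
  assumes "eqv is os L R" "set is \<subseteq> set (concat (map ins R))"
  shows "eqv is os R L"
  using assms by (auto simp: eqv_def)

text \<open>Stated for two factors and two legs only; longer gates are first split by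
  \<open>split_prods\<close> or \<open>split_cops\<close>.\<close>

lemma eqv_bialg:
  assumes "distinct [x, y, z, a, b, x1, x2, y1, y2]"
  shows "eqv [hw x, hw y] [hw a, hw b] [Mul [x, y] z, Cop z [a, b]]
    [Cop x [x1, x2], Cop y [y1, y2], Mul [x1, y1] a, Mul [x2, y2] b]"
proof (rule eqv_rep)
  have "rep (map hw [x, y]) (copl [a, b] \<cdot> prodl [x, y]) ([Mul [x, y] z] @ [Cop z [a, b]]) (map hw [a, b])"
    by (rule rep_comp[OF rep_Mul rep_Cop]) (use assms in auto)
  then show "rep [hw x, hw y] (hcomult \<cdot> hmult) [Mul [x, y] z, Cop z [a, b]] [hw a, hw b]"
    unfolding copl_small prodl_small by simp
  have 1: "rep ([hw x] @ [hw y]) (copl [x1, x2] \<otimes> copl [y1, y2]) ([Cop x [x1, x2]] @ [Cop y [y1, y2]])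
     (map hw [x1, x2] @ map hw [y1, y2])"
    by (rule rep_tensor[OF rep_Cop rep_Cop]) (use assms in auto)
  have "rep ([hw x2] @ [hw y1]) (\<Phi> (tens [hw x2]) (tens [hw y1])) [] ([hw y1] @ [hw x2])"
    by (rule rep_braid) (use assms in auto)
  then have "rep (([hw x2] @ [hw y1]) @ [hw y2]) (\<Phi> (tens [hw x2]) (tens [hw y1]) \<otimes> A) ([] @ []) (([hw y1] @ [hw x2]) @ [hw y2])"
    by (rule rep_tensor[OF _ rep_hw]) (use assms in auto)
  then have "rep ([hw x1] @ ([hw x2] @ [hw y1]) @ [hw y2]) (A \<otimes> \<Phi> (tens [hw x2]) (tens [hw y1]) \<otimes> A)
     ([] @ [] @ []) ([hw x1] @ ([hw y1] @ [hw x2]) @ [hw y2])"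
    by (rule rep_tensor[OF rep_hw]) (use assms in auto)
  then have 2: "rep (map hw [x1, x2] @ map hw [y1, y2]) (A \<otimes> \<Phi> A A \<otimes> A) [] (map hw [x1, y1] @ map hw [x2, y2])"
    by simp
  have 3: "rep (map hw [x1, y1] @ map hw [x2, y2]) (prodl [x1, y1] \<otimes> prodl [x2, y2])
     ([Mul [x1, y1] a] @ [Mul [x2, y2] b]) ([hw a] @ [hw b])"
    by (rule rep_tensor[OF rep_Mul rep_Mul]) (use assms in auto)
  have 4: "rep ([hw x] @ [hw y]) ((prodl [x1, y1] \<otimes> prodl [x2, y2]) \<cdot> (A \<otimes> \<Phi> A A \<otimes> A) \<cdot> (copl [x1, x2] \<otimes> copl [y1, y2]))
    ((([Cop x [x1, x2]] @ [Cop y [y1, y2]]) @ []) @ [Mul [x1, y1] a] @ [Mul [x2, y2] b]) ([hw a] @ [hw b])"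
    by (rule rep_comp[OF rep_comp[OF 1 2] 3]) (use assms in auto)
  then show "rep [hw x, hw y] (hcomult \<cdot> hmult)
    [Cop x [x1, x2], Cop y [y1, y2], Mul [x1, y1] a, Mul [x2, y2] b] [hw a, hw b]"
    unfolding copl_small prodl_small hopf_laws(7) by simp
qed auto

lemma eqv_mult_counit:
  assumes "distinct [x, y, z]"
  shows "eqv [hw x, hw y] [] [Mul [x, y] z, Cop z []] [Cop x [], Cop y []]"
proof (rule eqv_rep)
  have "rep (map hw [x, y]) (copl [] \<cdot> prodl [x, y]) ([Mul [x, y] z] @ [Cop z []]) (map hw [])"
    by (rule rep_comp[OF rep_Mul rep_Cop]) (use assms in auto)
  then show "rep [hw x, hw y] (hcounit \<otimes> hcounit) [Mul [x, y] z, Cop z []] []"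
    unfolding prodl_small by (simp add: hopf_laws)
  have "rep ([hw x] @ [hw y]) (copl [] \<otimes> copl []) ([Cop x []] @ [Cop y []]) (map hw [] @ map hw [])"
    by (rule rep_tensor[OF rep_Cop rep_Cop]) (use assms in auto)
  then show "rep [hw x, hw y] (hcounit \<otimes> hcounit) [Cop x [], Cop y []] []" by simp
qed auto

lemma eqv_unit_comult:
  assumes "distinct [z, a, b]"
  shows "eqv [] [hw a, hw b] [Mul [] z, Cop z [a, b]] [Mul [] a, Mul [] b]"
proof (rule eqv_rep)
  have "rep (map hw []) (copl [a, b] \<cdot> prodl []) ([Mul [] z] @ [Cop z [a, b]]) (map hw [a, b])"
    by (rule rep_comp[OF rep_Mul rep_Cop]) (use assms in auto)
  then show "rep [] (hunit \<otimes> hunit) [Mul [] z, Cop z [a, b]] [hw a, hw b]"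
    unfolding copl_small by (simp add: hopf_laws)
  have "rep (map hw [] @ map hw []) (prodl [] \<otimes> prodl []) ([Mul [] a] @ [Mul [] b]) ([hw a] @ [hw b])"
    by (rule rep_tensor[OF rep_Mul rep_Mul]) (use assms in auto)
  then show "rep [] (hunit \<otimes> hunit) [Mul [] a, Mul [] b] [hw a, hw b]" by simp
qed auto

lemma eqv_unit_counit: "eqv [] [] [Mul [] z, Cop z []] []"
proof (rule eqv_rep)
  have "rep (map hw []) (copl [] \<cdot> prodl []) ([Mul [] z] @ [Cop z []]) (map hw [])"
    by (rule rep_comp[OF rep_Mul rep_Cop]) auto
  then show "rep [] \<one> [Mul [] z, Cop z []] []" by (simp add: hopf_laws)
  show "rep [] \<one> [] []" using rep_id[of "[]"] by simp
qed auto

lemma eqv_cop_ap: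
  assumes "distinct [x, a, c]" "endo f"
  shows "eqv [hw x] [hw c] [Cop x [a], Ap f a c] [Ap f x c]"
proof (rule eqv_rep)
  have "rep [hw x] (f \<cdot> copl [a]) ([Cop x [a]] @ [Ap f a c]) [hw c]"
    by (rule rep_comp[OF rep_Cop]) (use assms rep_Ap[of f a c] in auto)
  then show "rep [hw x] f [Cop x [a], Ap f a c] [hw c]"
    unfolding copl_small using assms by (simp add: hom_iff)
  show "rep [hw x] f [Ap f x c] [hw c]" using assms by (simp add: rep_Ap)
qed auto

lemma eqv_ap_prod:
  assumes "distinct [x, a, c]" "endo f"
  shows "eqv [hw x] [hw c] [Ap f x a, Mul [a] c] [Ap f x c]"
proof (rule eqv_rep)
  have "rep [hw x] (prodl [a] \<cdot> f) ([Ap f x a] @ [Mul [a] c]) [hw c]"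
    by (rule rep_comp[OF rep_Ap]) (use assms rep_Mul[of c "[a]"] in auto)
  then show "rep [hw x] f [Ap f x a, Mul [a] c] [hw c]"
    unfolding prodl_small using assms by (simp add: hom_iff)
  show "rep [hw x] f [Ap f x c] [hw c]" using assms by (simp add: rep_Ap)
qed auto

text \<open>Both gates are the identity and merely rename a wire. Such gates remain after
  cancellations and are absorbed by the rules that follow.\<close>

lemma Cop_single: "Cop x [a] = Mul [x] a"
  by (simp add: Cop_def Mul_def copl_small(1)[simplified] prodl_small(1)[simplified])

lemma eqv_cop_prod:
  assumes "distinct (x # a # z # us @ ws)"
  shows "eqv (map hw (us @ x # ws)) [hw z] [Cop x [a], Mul (us @ a # ws) z] [Mul (us @ x # ws) z]"
  using eqv_prods[of z a us "[x]" ws] assms by (auto simp: Cop_single)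

lemma eqv_cops_prod:
  assumes "distinct (x # a # z # us @ ws)"
  shows "eqv [hw x] (map hw (us @ z # ws)) [Cop x (us @ a # ws), Mul [a] z] [Cop x (us @ z # ws)]"
  using eqv_cops[of x a us "[z]" ws] assms by (auto simp: Cop_single)

lemma eqv_prod_ev:
  assumes "a \<noteq> z"
  shows "eqv [dw f, hw a] [] [Mul [a] z, Ev f z] [Ev f a]"
proof (rule eqv_rep)
  have "rep (map hw [a]) (prodl [a]) [Mul [a] z] [hw z]"
    by (rule rep_Mul) (use assms in auto)
  then have "rep ([dw f] @ map hw [a]) (D \<otimes> prodl [a]) ([] @ [Mul [a] z]) ([dw f] @ [hw z])"
    by (rule rep_tensor[OF rep_dw]) (use assms in auto)
  then have "rep [dw f, hw a] (ev \<cdot> (D \<otimes> prodl [a])) (([] @ [Mul [a] z]) @ [Ev f z]) []"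
    using rep_comp[OF _ rep_Ev, of "[dw f, hw a]" "D \<otimes> prodl [a]" "[Mul [a] z]" f z] assms
    by auto
  then show "rep [dw f, hw a] ev [Mul [a] z, Ev f z] []"
    unfolding prodl_small by simp
qed (auto simp: rep_Ev)

lemma eqv_cop_ev: "a \<noteq> z \<Longrightarrow> eqv [dw f, hw a] [] [Cop a [z], Ev f z] [Ev f a]"
  using eqv_prod_ev[of a z f] by (simp add: Cop_single)

end

lemma fresh_names: "\<exists>p q. p \<noteq> q \<and> hw p \<notin> set ns \<and> hw q \<notin> set ns"
proof -
  have "finite (hw -` set ns)" by (rule finite_vimageI) (auto simp: inj_def)
  then obtain p where p: "p \<notin> hw -` set ns" using ex_new_if_finite[OF infinite_UNIV_nat] by blast
  have "finite (insert p (hw -` set ns))" using \<open>finite (hw -` set ns)\<close> by simp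
  then obtain q where "q \<notin> insert p (hw -` set ns)" using ex_new_if_finite[OF infinite_UNIV_nat] by blast
  then show ?thesis using p by auto
qed

text \<open>
  An antipode identity that has been checked on the two factors alone may be applied to adjacent factors
  of an iterated coproduct and of an iterated product. The other factors may interact in between, so
  that this is not an instance of rewriting a subcircuit.
\<close>

lemma cancel_in_context:
  assumes core: "\<And>p q. distinct [p, q, a, b, c] \<Longrightarrow>
      eqv [hw p] [hw q] [Cop p [a, b], Ap f i c, Mul [d, e] q] [Cop p [], Mul [] q]"
    and dist: "distinct (x # z # a # b # c # us @ ws)" "distinct (z # a # b # c # ps @ qs)"
    and de: "d \<noteq> e" "set [d, e] \<subseteq> {a, b, c} - {i}"
    and ok: "ok (G @ [Cop x (us @ [a, b] @ ws), Ap f i c] @ B @ [Mul (ps @ [d, e] @ qs) z] @ E) ys xs"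
    and ok': "ok (G @ [Cop x (us @ ws)] @ B @ [Mul (ps @ qs) z] @ E) ys xs"
  shows "run (G @ [Cop x (us @ [a, b] @ ws), Ap f i c] @ B @ [Mul (ps @ [d, e] @ qs) z] @ E) ys xs
    = run (G @ [Cop x (us @ ws)] @ B @ [Mul (ps @ qs) z] @ E) ys xs"
proof -
  \<comment> \<open>\<open>p\<close> is to carry the part of \<open>x\<close> that feeds the
    cancelling pair and \<open>q\<close> the value of that pair, so neither name may occur in the
    context.\<close>
  obtain p q where "p \<noteq> q" and
    fresh: "hw p \<notin> set (hw x # hw z # map hw (a # b # c # us @ ws @ ps @ qs) @ xs @ concat (map outs (G @ B @ E)))"
      "hw q \<notin> set (hw x # hw z # map hw (a # b # c # us @ ws @ ps @ qs) @ xs @ concat (map outs (G @ B @ E)))"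
    using fresh_names by blast
  then have pq: "p \<noteq> q" "q \<noteq> p" "p \<noteq> x" "p \<noteq> z" "p \<noteq> a" "p \<noteq> b" "p \<noteq> c" "p \<notin> set us" "p \<notin> set ws"
    "q \<noteq> x" "q \<noteq> z" "q \<noteq> a" "q \<noteq> b" "q \<noteq> c" "q \<notin> set ps" "q \<notin> set qs" "d \<noteq> q" "e \<noteq> q"
    using de(2) by auto
  have D: "distinct (x # p # us @ [a, b] @ ws)" "distinct (z # q # ps @ [d, e] @ qs)" "distinct [p, q, a, b, c]"
    "distinct (x # p # us @ [] @ ws)" "distinct (z # q # ps @ [] @ qs)"
    using dist de pq by auto
  let ?X = "Cop x (us @ p # ws)" and ?Z = "Mul (ps @ q # qs) z" and ?P = "Cop p [a, b]" and ?Q = "Mul [d, e] q"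
  \<comment> \<open>The two adjacent legs are split off the coproduct of \<open>x\<close>, and next
    the two adjacent factors off the product \<open>z\<close>.\<close>
  have g1: "ok (G @ [?X, ?P] @ ([Ap f i c] @ B @ [Mul (ps @ [d, e] @ qs) z] @ E)) ys xs \<and>
      run (G @ [Cop x (us @ [a, b] @ ws), Ap f i c] @ B @ [Mul (ps @ [d, e] @ qs) z] @ E) ys xs =
      run (G @ [?X, ?P] @ ([Ap f i c] @ B @ [Mul (ps @ [d, e] @ qs) z] @ E)) ys xs"
    by (rule rewrite_step[OF eqv_sym[OF eqv_cops[OF D(1)]] _ ok]) (use fresh pq in auto)
  have g2: "ok ((G @ [?X, ?P, Ap f i c] @ B) @ [?Q, ?Z] @ E) ys xs \<and>
      run (G @ [?X, ?P] @ ([Ap f i c] @ B @ [Mul (ps @ [d, e] @ qs) z] @ E)) ys xs =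
      run ((G @ [?X, ?P, Ap f i c] @ B) @ [?Q, ?Z] @ E) ys xs"
    by (rule rewrite_step[OF eqv_sym[OF eqv_prods[OF D(2)]] _ conjunct1[OF g1]]) (use fresh pq in auto)
  \<comment> \<open>All inputs of the small product are present before \<open>B\<close>, so it moves
    ahead of \<open>B\<close>. Only now do the gates of the pair form a subcircuit.\<close>
  have "set (ins ?Q) \<subseteq> set (state (G @ [?X, ?P, Ap f i c]) xs)"
    using de pq by (auto simp: state_append)
  then have g3: "ok ((G @ [?X, ?P, Ap f i c]) @ ?Q # B @ [?Z] @ E) ys xs \<and>
      run ((G @ [?X, ?P, Ap f i c]) @ B @ ?Q # [?Z] @ E) ys xs = run ((G @ [?X, ?P, Ap f i c]) @ ?Q # B @ [?Z] @ E) ys xs"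
    using run_move_prefix[of "G @ [?X, ?P, Ap f i c]" B ?Q "[?Z] @ E" ys xs] g2 by simp
  have g4: "ok ((G @ [?X]) @ [Cop p [], Mul [] q] @ (B @ [?Z] @ E)) ys xs \<and>
      run ((G @ [?X, ?P, Ap f i c]) @ ?Q # B @ [?Z] @ E) ys xs =
      run ((G @ [?X]) @ [Cop p [], Mul [] q] @ (B @ [?Z] @ E)) ys xs"
    by (rule rewrite_step[OF core[OF D(3)] _ conjunct1[OF g3]]) auto
  \<comment> \<open>The claimed result is expanded in the same manner with empty lists, a unit at
    \<open>q\<close> and a counit at \<open>p\<close>, until both expansions meet.\<close>
  have h1: "ok ((G @ [Cop x (us @ ws)] @ B) @ [Mul [] q, ?Z] @ E) ys xs \<and>
      run (G @ [Cop x (us @ ws)] @ B @ [Mul (ps @ qs) z] @ E) ys xs =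
      run ((G @ [Cop x (us @ ws)] @ B) @ [Mul [] q, ?Z] @ E) ys xs"
    by (rule rewrite_step[OF eqv_sym[OF eqv_prods[OF D(5)]] _ ok']) (use fresh pq in auto)
  have h2: "ok (G @ [?X, Cop p []] @ (B @ [Mul [] q, ?Z] @ E)) ys xs \<and>
      run ((G @ [Cop x (us @ ws)] @ B) @ [Mul [] q, ?Z] @ E) ys xs =
      run (G @ [?X, Cop p []] @ (B @ [Mul [] q, ?Z] @ E)) ys xs"
    by (rule rewrite_step[OF eqv_sym[OF eqv_cops[OF D(4)]] _ conjunct1[OF h1]]) (use fresh pq in auto)
  have h3: "run ((G @ [?X, Cop p []]) @ B @ Mul [] q # [?Z] @ E) ys xs = run ((G @ [?X, Cop p []]) @ Mul [] q # B @ [?Z] @ E) ys xs"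
    using run_move_prefix[of "G @ [?X, Cop p []]" B "Mul [] q" "[?Z] @ E" ys xs] h2 by simp
  show ?thesis using g1 g2 g3 g4 h1 h2 h3 by simp
qed

text \<open>\<open>cancel_in_context\<close> in the format of \<open>run_step\<close>: coproduct and
  antipode stand at positions \<open>n\<close> and \<open>n + 1\<close>, and \<open>m\<close> gates
  separate them from the product, whence the offsets \<open>n + 2\<close> and
  \<open>n + 3 + m\<close>.\<close>

lemma cancel_step:
  assumes core: "\<And>p q. distinct [p, q, a, b, c] \<Longrightarrow>
      eqv [hw p] [hw q] [Cop p [a, b], Ap f i c, Mul [d, e] q] [Cop p [], Mul [] q]"
    and de: "d \<noteq> e" "set [d, e] \<subseteq> {a, b, c} - {i}"
    and dist: "distinct (x # z # a # b # c # us @ ws)" "distinct (z # a # b # c # ps @ qs)"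
    and gl: "take 2 (drop n gl) = [Cop x (us @ [a, b] @ ws), Ap f i c]"
      "take 1 (drop (n + 2 + m) gl) = [Mul (ps @ [d, e] @ qs) z]"
    and ok: "ok gl ys xs"
    and ok': "ok (take n gl @ [Cop x (us @ ws)] @ take m (drop (n + 2) gl) @ [Mul (ps @ qs) z] @ drop (n + 3 + m) gl) ys xs"
    and gl': "mset gl' = mset (take n gl @ [Cop x (us @ ws)] @ take m (drop (n + 2) gl) @ [Mul (ps @ qs) z] @ drop (n + 3 + m) gl)"
      "ok gl' ys xs"
  shows "run gl ys xs = run gl' ys xs"
proof -
  have "drop (n + 2 + m) gl = [Mul (ps @ [d, e] @ qs) z] @ drop (n + 3 + m) gl"
    using gl(2) append_take_drop_id[of 1 "drop (n + 2 + m) gl"] by (simp add: eval_nat_numeral ac_simps)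
  then have "drop (n + 2) gl = take m (drop (n + 2) gl) @ [Mul (ps @ [d, e] @ qs) z] @ drop (n + 3 + m) gl"
    using append_take_drop_id[of m "drop (n + 2) gl"] by (simp add: ac_simps)
  then have "drop n gl = [Cop x (us @ [a, b] @ ws), Ap f i c] @ take m (drop (n + 2) gl) @ [Mul (ps @ [d, e] @ qs) z] @ drop (n + 3 + m) gl"
    using gl(1) append_take_drop_id[of 2 "drop n gl"] by (simp add: ac_simps)
  then have e: "gl = take n gl @ [Cop x (us @ [a, b] @ ws), Ap f i c] @ take m (drop (n + 2) gl) @ [Mul (ps @ [d, e] @ qs) z] @ drop (n + 3 + m) gl"
    using append_take_drop_id[of n gl] by simp
  have "run gl ys xs = run (take n gl @ [Cop x (us @ ws)] @ take m (drop (n + 2) gl) @ [Mul (ps @ qs) z] @ drop (n + 3 + m) gl) ys xs"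
    using cancel_in_context[OF core dist de, of "take n gl" "take m (drop (n + 2) gl)" "drop (n + 3 + m) gl" ys xs] ok ok' e
    by simp
  also have "\<dots> = run gl' ys xs"
    by (rule run_mset[OF ok' gl'(2)]) (rule gl'(1)[symmetric])
  finally show ?thesis .
qed

declare ok_def [simp] insert_commute [simp] insert_Diff_if [simp]

text \<open>Merging brings words into flattened form; splitting exposes a binary gate to which a
  bialgebra rule applies.\<close>

lemmas merge_prods = run_step[OF eqv_prods]
lemmas split_prods = run_step[OF eqv_sym[OF eqv_prods]]
lemmas merge_cops = run_step[OF eqv_cops]
lemmas split_cops = run_step[OF eqv_sym[OF eqv_cops]]
lemmas expand_bialg = run_step[OF eqv_bialg]

lemma rep_antipode_words:
  assumes "endo f" "distinct [p, q, a, b, c]"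
  shows "rep [hw p] (hmult \<cdot> (f \<otimes> A) \<cdot> hcomult) [Cop p [a, b], Ap f a c, Mul [c, b] q] [hw q]"
    "rep [hw p] (hmult \<cdot> (A \<otimes> f) \<cdot> hcomult) [Cop p [a, b], Ap f b c, Mul [a, c] q] [hw q]"
    "rep [hw p] (hmult \<cdot> \<Phi> A A \<cdot> (f \<otimes> A) \<cdot> hcomult) [Cop p [a, b], Ap f a c, Mul [b, c] q] [hw q]"
    "rep [hw p] (hmult \<cdot> \<Phi> A A \<cdot> (A \<otimes> f) \<cdot> hcomult) [Cop p [a, b], Ap f b c, Mul [c, a] q] [hw q]"
proof -
  have f [simp]: "f \<in> Arr C" "Dom C f = A" "Cod C f = A" using assms(1) by (auto simp: hom_iff)
  have cop: "rep [hw p] hcomult [Cop p [a, b]] [hw a, hw b]"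
    using rep_Cop[of p "[a, b]"] assms unfolding copl_small by simp
  have prod: "rep [hw m, hw n] hmult [Mul [m, n] q] [hw q]" if "distinct [q, m, n]" for m n
    using rep_Mul[of q "[m, n]"] that unfolding prodl_small by simp
  have fl: "rep [hw a, hw b] (f \<otimes> A) [Ap f a c] [hw c, hw b]"
    using rep_tensor[OF rep_Ap[OF assms(1), of a c] rep_hw[of b]] assms by auto
  have fr: "rep [hw a, hw b] (A \<otimes> f) [Ap f b c] [hw a, hw c]"
    using rep_tensor[OF rep_hw[of a] rep_Ap[OF assms(1), of b c]] assms by auto
  have br: "rep [hw m, hw n] (\<Phi> A A) [] [hw n, hw m]" if "m \<noteq> n" for m n
    using rep_braid[of "[hw m]" "[hw n]"] that by simp
  have cf: "rep [hw p] ((f \<otimes> A) \<cdot> hcomult) [Cop p [a, b], Ap f a c] [hw c, hw b]"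
    using rep_comp[OF cop fl] assms by auto
  have cg: "rep [hw p] ((A \<otimes> f) \<cdot> hcomult) [Cop p [a, b], Ap f b c] [hw a, hw c]"
    using rep_comp[OF cop fr] assms by auto
  have cf': "rep [hw p] (\<Phi> A A \<cdot> (f \<otimes> A) \<cdot> hcomult) [Cop p [a, b], Ap f a c] [hw b, hw c]"
    using rep_comp[OF cf br[of c b]] assms by auto
  have cg': "rep [hw p] (\<Phi> A A \<cdot> (A \<otimes> f) \<cdot> hcomult) [Cop p [a, b], Ap f b c] [hw c, hw a]"
    using rep_comp[OF cg br[of a c]] assms by auto
  show "rep [hw p] (hmult \<cdot> (f \<otimes> A) \<cdot> hcomult) [Cop p [a, b], Ap f a c, Mul [c, b] q] [hw q]"
    using rep_comp[OF cf prod] assms by auto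
  show "rep [hw p] (hmult \<cdot> (A \<otimes> f) \<cdot> hcomult) [Cop p [a, b], Ap f b c, Mul [a, c] q] [hw q]"
    using rep_comp[OF cg prod] assms by auto
  show "rep [hw p] (hmult \<cdot> \<Phi> A A \<cdot> (f \<otimes> A) \<cdot> hcomult) [Cop p [a, b], Ap f a c, Mul [b, c] q] [hw q]"
    using rep_comp[OF cf' prod] assms by auto
  show "rep [hw p] (hmult \<cdot> \<Phi> A A \<cdot> (A \<otimes> f) \<cdot> hcomult) [Cop p [a, b], Ap f b c, Mul [c, a] q] [hw q]"
    using rep_comp[OF cg' prod] assms by auto
qed

lemma rep_unit_counit:
  assumes "p \<noteq> q"
  shows "rep [hw p] (hunit \<cdot> hcounit) [Cop p [], Mul [] q] [hw q]"
  using rep_comp[of "[hw p]" hcounit "[Cop p []]" "[]" hunit "[Mul [] q]" "[hw q]"] rep_Cop[of p "[]"] rep_Mul[of q "[]"] assms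
  by simp

text \<open>The antipode-like arrow sits on the first or the second leg, and the product follows or
  reverses the order of the legs. The first two cases serve \<open>S\<close>, the last two its
  inverse.\<close>

lemma antipode_core:
  assumes "endo f" "distinct [p, q, a, b, c]"
  shows "hmult \<cdot> (f \<otimes> A) \<cdot> hcomult = hunit \<cdot> hcounit \<Longrightarrow>
      eqv [hw p] [hw q] [Cop p [a, b], Ap f a c, Mul [c, b] q] [Cop p [], Mul [] q]"
    "hmult \<cdot> (A \<otimes> f) \<cdot> hcomult = hunit \<cdot> hcounit \<Longrightarrow>
      eqv [hw p] [hw q] [Cop p [a, b], Ap f b c, Mul [a, c] q] [Cop p [], Mul [] q]"
    "hmult \<cdot> \<Phi> A A \<cdot> (f \<otimes> A) \<cdot> hcomult = hunit \<cdot> hcounit \<Longrightarrow>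
      eqv [hw p] [hw q] [Cop p [a, b], Ap f a c, Mul [b, c] q] [Cop p [], Mul [] q]"
    "hmult \<cdot> \<Phi> A A \<cdot> (A \<otimes> f) \<cdot> hcomult = hunit \<cdot> hcounit \<Longrightarrow>
      eqv [hw p] [hw q] [Cop p [a, b], Ap f b c, Mul [c, a] q] [Cop p [], Mul [] q]"
  using rep_antipode_words[OF assms] rep_unit_counit[of p q] assms(2) by (auto intro: eqv_rep)

text \<open>
  The antipode reverses products because \<open>S(xy)\<close> and \<open>S(y)S(x)\<close> are a left and a right convolution inverse
  of \<open>xy\<close>; both cancellations apply to \<open>S(x1 y1) x2 y2 S(y3) S(x3)\<close>.
\<close>

context
  fixes S :: 'a
  assumes S [simp]: "endo S"
    and S_left: "hmult \<cdot> (S \<otimes> A) \<cdot> hcomult = hunit \<cdot> hcounit"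
    and S_right: "hmult \<cdot> (A \<otimes> S) \<cdot> hcomult = hunit \<cdot> hcounit"
begin

lemma antipode_mult: "S \<cdot> hmult = hmult \<cdot> \<Phi> A A \<cdot> (S \<otimes> S)"
proof -
  note sl = cancel_step[OF antipode_core(1)[OF S _ S_left]] and sr = cancel_step[OF antipode_core(2)[OF S _ S_right]]
  let ?is = "[hw 1, hw 2]" and ?os = "[hw 3]"
  let ?W = "run [Cop 2 [21, 22, 23], Ap S 23 24, Cop 1 [11, 12, 13], Ap S 13 14, Mul [11, 21] 4, Ap S 4 5,
      Mul [5, 12, 22, 24, 14] 3] ?os ?is"
  \<comment> \<open>First evaluation: y2 S(y3) cancels, which makes the legs x2 and S(x3) adjacent
    factors; they cancel next and S(xy) remains.\<close>
  have "?W = run [Cop 2 [21], Cop 1 [11, 12, 13], Ap S 13 14, Mul [11, 21] 4, Ap S 4 5, Mul [5, 12, 14] 3] ?os ?is"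
    by (rule sr[of 22 23 24 2 3 "[21]" "[]" "[5, 12]" "[14]" 0 _ 4]) simp_all
  also have "\<dots> = run [Cop 1 [11], Cop 2 [21], Mul [11, 21] 4, Ap S 4 5, Mul [5] 3] ?os ?is"
    by (rule sr[of 12 13 14 1 3 "[11]" "[]" "[5]" "[]" 1 _ 2]) simp_all
  also have "\<dots> = run [Cop 1 [11], Cop 2 [21], Mul [11, 21] 4, Ap S 4 3] ?os ?is"
    by (rule run_step[OF eqv_ap_prod[of 4 5 3 S], of 3]) simp_all
  also have "\<dots> = run [Cop 1 [11], Mul [11, 2] 4, Ap S 4 3] ?os ?is"
    by (rule run_step[OF eqv_cop_prod[of 2 21 4 "[11]" "[]"], of 1]) simp_all
  also have "\<dots> = run [Mul [1, 2] 4, Ap S 4 3] ?os ?is"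
    by (rule run_step[OF eqv_cop_prod[of 1 11 4 "[]" "[2]"], of 0]) simp_all
  finally have e1: "?W = run [Mul [1, 2] 4, Ap S 4 3] ?os ?is" .
  \<comment> \<open>Second evaluation: the bialgebra law read backwards exhibits S(z1) z2 for a
    product z of a part of x with a part of y. This cancels and S(y) S(x) remains.\<close>
  have "?W = run [Cop 1 [6, 13], Cop 6 [11, 12], Cop 2 [21, 22, 23], Mul [11, 21] 4, Ap S 4 5, Ap S 13 14, Ap S 23 24,
      Mul [5, 12, 22, 24, 14] 3] ?os ?is"
    by (rule split_cops[of 1 6 "[]" "[11, 12]" "[13]" 2]) simp_all
  also have "\<dots> = run [Cop 1 [6, 13], Cop 2 [7, 23], Cop 6 [11, 12], Cop 7 [21, 22], Mul [11, 21] 4, Ap S 4 5, Ap S 13 14, Ap S 23 24,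
      Mul [5, 12, 22, 24, 14] 3] ?os ?is"
    by (rule split_cops[of 2 7 "[]" "[21, 22]" "[23]" 2]) simp_all
  also have "\<dots> = run [Cop 1 [6, 13], Cop 2 [7, 23], Cop 6 [11, 12], Cop 7 [21, 22], Mul [11, 21] 4, Mul [12, 22] 8,
      Ap S 4 5, Ap S 13 14, Ap S 23 24, Mul [5, 8, 24, 14] 3] ?os ?is"
    by (rule split_prods[of 3 8 "[5]" "[12, 22]" "[24, 14]" 8]) simp_all
  also have "\<dots> = run [Cop 1 [6, 13], Cop 2 [7, 23], Ap S 13 14, Ap S 23 24, Mul [6, 7] 9, Cop 9 [4, 8],
      Ap S 4 5, Mul [5, 8, 24, 14] 3] ?os ?is"
    by (rule run_step[OF eqv_sym[OF eqv_bialg[of 6 7 9 4 8 11 12 21 22]], of 2]) simp_all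
  also have "\<dots> = run [Cop 1 [6, 13], Cop 2 [7, 23], Ap S 13 14, Ap S 23 24, Mul [6, 7] 9, Cop 9 [], Mul [24, 14] 3] ?os ?is"
    by (rule sl[of 4 8 5 9 3 "[]" "[]" "[]" "[24, 14]" 5 _ 0]) simp_all
  also have "\<dots> = run [Cop 1 [6, 13], Cop 6 [], Cop 2 [7, 23], Cop 7 [], Ap S 13 14, Ap S 23 24, Mul [24, 14] 3] ?os ?is"
    by (rule run_step[OF eqv_mult_counit[of 6 7 9], of 4]) simp_all
  also have "\<dots> = run [Cop 1 [13], Cop 2 [7, 23], Cop 7 [], Ap S 13 14, Ap S 23 24, Mul [24, 14] 3] ?os ?is"
    by (rule merge_cops[of 1 6 "[]" "[]" "[13]" 0]) simp_all
  also have "\<dots> = run [Cop 1 [13], Ap S 13 14, Cop 2 [23], Ap S 23 24, Mul [24, 14] 3] ?os ?is"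
    by (rule merge_cops[of 2 7 "[]" "[]" "[23]" 1]) simp_all
  also have "\<dots> = run [Ap S 1 14, Cop 2 [23], Ap S 23 24, Mul [24, 14] 3] ?os ?is"
    by (rule run_step[OF eqv_cop_ap[of 1 13 14 S], of 0]) simp_all
  also have "\<dots> = run [Ap S 1 14, Ap S 2 24, Mul [24, 14] 3] ?os ?is"
    by (rule run_step[OF eqv_cop_ap[of 2 23 24 S], of 1]) simp_all
  finally have e2: "?W = run [Ap S 1 14, Ap S 2 24, Mul [24, 14] 3] ?os ?is" .
  have prod: "rep [hw m, hw n] hmult [Mul [m, n] q] [hw q]" if "distinct [q, m, n]" for m n q
    using rep_Mul[of q "[m, n]"] that unfolding prodl_small by simp
  have l: "rep ?is (S \<cdot> hmult) [Mul [1, 2] 4, Ap S 4 3] ?os"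
    using rep_comp[OF prod[of 4 1 2] rep_Ap[OF S, of 4 3]] by simp
  have "rep ?is (S \<otimes> S) [Ap S 1 14, Ap S 2 24] [hw 14, hw 24]"
    using rep_tensor[OF rep_Ap[OF S, of 1 14] rep_Ap[OF S, of 2 24]] by simp
  then have "rep ?is (\<Phi> A A \<cdot> (S \<otimes> S)) [Ap S 1 14, Ap S 2 24] [hw 24, hw 14]"
    using rep_comp[OF _ rep_braid[of "[hw 14]" "[hw 24]"], of ?is "S \<otimes> S" "[Ap S 1 14, Ap S 2 24]"] by simp
  then have r: "rep ?is (hmult \<cdot> \<Phi> A A \<cdot> (S \<otimes> S)) [Ap S 1 14, Ap S 2 24, Mul [24, 14] 3] ?os"
    using rep_comp[OF _ prod[of 3 24 14], of ?is "\<Phi> A A \<cdot> (S \<otimes> S)" "[Ap S 1 14, Ap S 2 24]"] by simp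
  show ?thesis using rep_eq[OF l r] e1 e2 by simp
qed

text \<open>The dual argument, with left and right convolution inverses of the coproduct among
  arrows from \<open>H\<close> to two copies of \<open>H\<close>. The word has components S(x1)_1 x2
  S(x5) and S(x1)_2 x3 S(x4), the outer indices referring to the coproduct of S(x1).\<close>

lemma antipode_comult: "hcomult \<cdot> S = (S \<otimes> S) \<cdot> \<Phi> A A \<cdot> hcomult"
proof -
  note sl = cancel_step[OF antipode_core(1)[OF S _ S_left]] and sr = cancel_step[OF antipode_core(2)[OF S _ S_right]]
  let ?is = "[hw 1]" and ?os = "[hw 2, hw 3]"
  let ?W = "run [Cop 1 [11, 12, 13, 14, 15], Ap S 14 4, Ap S 15 5, Ap S 11 10, Cop 10 [6, 7],
      Mul [6, 12, 5] 2, Mul [7, 13, 4] 3] ?os ?is"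
  \<comment> \<open>First x3 S(x4), then x2 S(x5): the legs x2 and x5 become adjacent only after the
    inner pair has gone.\<close>
  have "?W = run [Cop 1 [11, 12, 15], Ap S 15 5, Ap S 11 10, Cop 10 [6, 7], Mul [7] 3, Mul [6, 12, 5] 2] ?os ?is"
    by (rule sr[of 13 14 4 1 3 "[11, 12]" "[15]" "[7]" "[]" 0 _ 4]) simp_all
  also have "\<dots> = run [Cop 1 [11], Ap S 11 10, Cop 10 [6, 7], Mul [7] 3, Mul [6] 2] ?os ?is"
    by (rule sr[of 12 15 5 1 2 "[11]" "[]" "[6]" "[]" 0 _ 3]) simp_all
  also have "\<dots> = run [Ap S 1 10, Cop 10 [6, 7], Mul [7] 3, Mul [6] 2] ?os ?is"
    by (rule run_step[OF eqv_cop_ap[of 1 11 10 S], of 0]) simp_all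
  also have "\<dots> = run [Ap S 1 10, Cop 10 [6, 3], Mul [6] 2] ?os ?is"
    by (rule run_step[OF eqv_cops_prod[of 10 7 3 "[6]" "[]"], of 1]) simp_all
  also have "\<dots> = run [Ap S 1 10, Cop 10 [2, 3]] ?os ?is"
    by (rule run_step[OF eqv_cops_prod[of 10 6 2 "[]" "[3]"], of 1]) simp_all
  finally have e1: "?W = run [Ap S 1 10, Cop 10 [2, 3]] ?os ?is" .
  \<comment> \<open>Now the coproducts of S(x1) and of the next leg are combined into the coproduct
    of their product, which cancels to a unit.\<close>
  have "?W = run [Cop 1 [11, 8, 14, 15], Cop 8 [12, 13], Ap S 14 4, Ap S 15 5, Ap S 11 10, Cop 10 [6, 7],
      Mul [7, 13, 4] 3, Mul [6, 12, 5] 2] ?os ?is"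
    by (rule split_cops[of 1 8 "[11]" "[12, 13]" "[14, 15]" 0]) simp_all
  also have "\<dots> = run [Cop 1 [11, 8, 14, 15], Cop 8 [12, 13], Ap S 14 4, Ap S 15 5, Ap S 11 10, Cop 10 [6, 7],
      Mul [7, 13] 20, Mul [20, 4] 3, Mul [6, 12, 5] 2] ?os ?is"
    by (rule split_prods[of 3 20 "[]" "[7, 13]" "[4]" 6]) simp_all
  also have "\<dots> = run [Cop 1 [11, 8, 14, 15], Ap S 14 4, Ap S 15 5, Ap S 11 10, Cop 10 [6, 7], Cop 8 [12, 13],
      Mul [6, 12] 21, Mul [7, 13] 20, Mul [20, 4] 3, Mul [21, 5] 2] ?os ?is"
    by (rule split_prods[of 2 21 "[]" "[6, 12]" "[5]" 8]) simp_all
  also have "\<dots> = run [Cop 1 [11, 8, 14, 15], Ap S 11 10, Mul [10, 8] 22, Ap S 14 4, Ap S 15 5, Cop 22 [21, 20],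
      Mul [20, 4] 3, Mul [21, 5] 2] ?os ?is"
    by (rule run_step[OF eqv_sym[OF eqv_bialg[of 10 8 22 21 20 6 7 12 13]], of 4]) simp_all
  also have "\<dots> = run [Cop 1 [14, 15], Mul [] 22, Cop 22 [21, 20], Ap S 14 4, Ap S 15 5,
      Mul [20, 4] 3, Mul [21, 5] 2] ?os ?is"
    by (rule sl[of 11 8 10 1 22 "[]" "[14, 15]" "[]" "[]" 0 _ 0]) simp_all
  also have "\<dots> = run [Cop 1 [14, 15], Ap S 14 4, Ap S 15 5, Mul [] 20, Mul [20, 4] 3, Mul [] 21, Mul [21, 5] 2] ?os ?is"
    by (rule run_step[OF eqv_unit_comult[of 22 21 20], of 1]) simp_all
  also have "\<dots> = run [Cop 1 [14, 15], Ap S 15 5, Ap S 14 4, Mul [4] 3, Mul [] 21, Mul [21, 5] 2] ?os ?is"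
    by (rule merge_prods[of 3 20 "[]" "[]" "[4]" 3]) simp_all
  also have "\<dots> = run [Cop 1 [14, 15], Ap S 15 5, Ap S 14 4, Mul [4] 3, Mul [5] 2] ?os ?is"
    by (rule merge_prods[of 2 21 "[]" "[]" "[5]" 4]) simp_all
  also have "\<dots> = run [Cop 1 [14, 15], Ap S 14 3, Ap S 15 5, Mul [5] 2] ?os ?is"
    by (rule run_step[OF eqv_ap_prod[of 14 4 3 S], of 2]) simp_all
  also have "\<dots> = run [Cop 1 [14, 15], Ap S 15 2, Ap S 14 3] ?os ?is"
    by (rule run_step[OF eqv_ap_prod[of 15 5 2 S], of 2]) simp_all
  finally have e2: "?W = run [Cop 1 [14, 15], Ap S 15 2, Ap S 14 3] ?os ?is" .
  have cop: "rep [hw p] hcomult [Cop p [a, b]] [hw a, hw b]" if "distinct [p, a, b]" for p a b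
    using rep_Cop[of p "[a, b]"] that unfolding copl_small by simp
  have l: "rep ?is (hcomult \<cdot> S) [Ap S 1 10, Cop 10 [2, 3]] ?os"
    using rep_comp[OF rep_Ap[OF S, of 1 10] cop[of 10 2 3]] by simp
  have "rep [hw 15, hw 14] (S \<otimes> S) [Ap S 15 2, Ap S 14 3] ?os"
    using rep_tensor[OF rep_Ap[OF S, of 15 2] rep_Ap[OF S, of 14 3]] by simp
  moreover have "rep ?is (\<Phi> A A \<cdot> hcomult) [Cop 1 [14, 15]] [hw 15, hw 14]"
    using rep_comp[OF cop[of 1 14 15] rep_braid[of "[hw 14]" "[hw 15]", simplified]] by simp
  ultimately have r: "rep ?is ((S \<otimes> S) \<cdot> \<Phi> A A \<cdot> hcomult) [Cop 1 [14, 15], Ap S 15 2, Ap S 14 3] ?os"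
    using rep_comp[of ?is "\<Phi> A A \<cdot> hcomult" "[Cop 1 [14, 15]]"] by simp
  show ?thesis using rep_eq[OF l r] e1 e2 by simp
qed

end

end

section \<open>The inverse of the antipode\<close>

locale hopf_double = hopf_dual C H D ev coev
  for C :: "'a braided_cat" (structure) and H :: "'a bialg_data" and D ev coev :: 'a +
  fixes S T :: 'a
  assumes hopf: "hopf_algebra C H S" and T_inverse: "inverse_arrows C S T"
begin

lemma antipode_typing [simp]:
  "S \<in> Arr C" "Dom C S = A" "Cod C S = A" "T \<in> Arr C" "Dom C T = A" "Cod C T = A"
  using hopf T_inverse by (auto simp: hopf_algebra_def inverse_arrows_def hom_iff)

lemma antipode_endo [simp]: "endo S" "endo T"
  by (simp_all add: hom_iff)

lemma antipode_inverse: "S \<cdot> T = A" "T \<cdot> S = A"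
  using T_inverse by (auto simp: inverse_arrows_def)

lemma antipode_laws:
  "hmult \<cdot> (S \<otimes> A) \<cdot> hcomult = hunit \<cdot> hcounit" "hmult \<cdot> (A \<otimes> S) \<cdot> hcomult = hunit \<cdot> hcounit"
  using hopf by (auto simp: hopf_algebra_def)

lemmas S_mult = antipode_mult[OF antipode_endo(1) antipode_laws]
lemmas S_comult = antipode_comult[OF antipode_endo(1) antipode_laws]

lemma braid_endo:
  assumes "f \<in> Arr C" "Dom C f = A" "Cod C f = A" "g \<in> Arr C" "Dom C g = A" "Cod C g = A"
  shows "\<Phi> A A \<cdot> (f \<otimes> g) = (g \<otimes> f) \<cdot> \<Phi> A A"
  using braid_nat[of f g] assms by simp

text \<open>The inverse of an order-reversing map reverses order. Symmetry of
  \<open>\<Phi> A A\<close> moves the crossing from one side of the identity for \<open>S\<close> to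
  the other.\<close>

lemma T_mult: "T \<cdot> hmult = hmult \<cdot> \<Phi> A A \<cdot> (T \<otimes> T)"
proof -
  have "hmult \<cdot> (S \<otimes> S) = (hmult \<cdot> \<Phi> A A \<cdot> (S \<otimes> S)) \<cdot> \<Phi> A A"
    using comp_assoc'[of "\<Phi> A A" "\<Phi> A A" "S \<otimes> S"] by (simp add: braid_endo sym_HH)
  also have "\<dots> = S \<cdot> hmult \<cdot> \<Phi> A A"
    unfolding S_mult[symmetric] by simp
  finally have s: "hmult \<cdot> (S \<otimes> S) = S \<cdot> hmult \<cdot> \<Phi> A A" .
  have "T \<cdot> hmult = T \<cdot> (hmult \<cdot> (S \<otimes> S)) \<cdot> (T \<otimes> T)"
    by (simp add: tensor_comp antipode_inverse)
  also have "\<dots> = (T \<cdot> S) \<cdot> hmult \<cdot> \<Phi> A A \<cdot> (T \<otimes> T)"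
    unfolding s by simp
  finally show ?thesis by (simp add: antipode_inverse)
qed

lemma T_comult: "hcomult \<cdot> T = (T \<otimes> T) \<cdot> \<Phi> A A \<cdot> hcomult"
proof -
  have "hcomult = (hcomult \<cdot> S) \<cdot> T" by (simp add: antipode_inverse)
  also have "\<dots> = (S \<otimes> S) \<cdot> \<Phi> A A \<cdot> hcomult \<cdot> T"
    unfolding S_comult by simp
  finally have "(T \<otimes> T) \<cdot> \<Phi> A A \<cdot> hcomult = (T \<otimes> T) \<cdot> \<Phi> A A \<cdot> (S \<otimes> S) \<cdot> \<Phi> A A \<cdot> hcomult \<cdot> T"
    by simp
  also have "\<dots> = (T \<otimes> T) \<cdot> (S \<otimes> S) \<cdot> (\<Phi> A A \<cdot> \<Phi> A A) \<cdot> hcomult \<cdot> T"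
    using comp_assoc'[of "\<Phi> A A \<cdot> hcomult \<cdot> T" "S \<otimes> S" "\<Phi> A A", symmetric] by (simp add: braid_endo)
  also have "\<dots> = hcomult \<cdot> T"
    unfolding sym_HH by (simp add: tensor_comp_cont antipode_inverse)
  finally show ?thesis ..
qed

text \<open>The antipode law evaluated on the unit gives S(1) = 1; then apply
  \<open>T\<close>.\<close>

lemma T_unit: "T \<cdot> hunit = hunit"
proof -
  have "hunit = (hunit \<cdot> hcounit) \<cdot> hunit" by (simp add: hopf_laws)
  also have "\<dots> = hmult \<cdot> (S \<otimes> A) \<cdot> (hunit \<otimes> hunit)"
    unfolding antipode_laws(1)[symmetric] by (simp add: hopf_laws)
  also have "\<dots> = (hmult \<cdot> (A \<otimes> hunit)) \<cdot> S \<cdot> hunit"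
    using tensor_comp[of "S \<cdot> hunit" "A" "\<one>" hunit] by (simp add: tensor_comp)
  finally have "T \<cdot> hunit = T \<cdot> S \<cdot> hunit" by (simp add: hopf_laws)
  also have "\<dots> = hunit" using comp_assoc'[of hunit S T] by (simp add: antipode_inverse del: comp_assoc')
  finally show ?thesis .
qed

text \<open>The counit applied to the antipode law gives the same statement for
  \<open>S\<close>.\<close>

lemma T_counit: "hcounit \<cdot> T = hcounit"
proof -
  have "hcounit = hcounit \<cdot> (hunit \<cdot> hcounit)"
    using comp_assoc'[of hcounit hunit hcounit] by (simp add: hopf_laws del: comp_assoc')
  also have "\<dots> = (hcounit \<cdot> hmult) \<cdot> (S \<otimes> A) \<cdot> hcomult"
    unfolding antipode_laws(1)[symmetric] by simp
  also have "\<dots> = ((hcounit \<cdot> S) \<otimes> hcounit) \<cdot> hcomult"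
    unfolding hopf_laws by (simp add: tensor_comp tensor_comp_cont)
  also have "\<dots> = hcounit \<cdot> S \<cdot> (A \<otimes> hcounit) \<cdot> hcomult"
    using tensor_comp_cont[of "A" "hcounit \<cdot> S" hcounit "\<one>" hcomult] by simp
  finally have "hcounit = hcounit \<cdot> S" by (simp add: hopf_laws)
  then have "hcounit \<cdot> T = (hcounit \<cdot> S) \<cdot> T" by simp
  then show ?thesis by (simp add: antipode_inverse)
qed

text \<open>Apply \<open>T\<close> to the two antipode laws: it reverses the product and undoes
  \<open>S\<close>, so S(h1) h2 becomes T(h2) h1 and h1 S(h2) becomes h2 T(h1). Hence
  \<open>T\<close> is an antipode for the opposite product.\<close>

lemma T_laws:
  "hmult \<cdot> \<Phi> A A \<cdot> (A \<otimes> T) \<cdot> hcomult = hunit \<cdot> hcounit"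
  "hmult \<cdot> \<Phi> A A \<cdot> (T \<otimes> A) \<cdot> hcomult = hunit \<cdot> hcounit"
proof -
  have u: "T \<cdot> hunit \<cdot> hcounit = hunit \<cdot> hcounit"
    using comp_assoc'[of hcounit hunit T] by (simp add: T_unit del: comp_assoc')
  have e: "T \<cdot> hmult \<cdot> k = hmult \<cdot> \<Phi> A A \<cdot> (T \<otimes> T) \<cdot> k" if "k \<in> Arr C" "Cod C k = A \<otimes> A" for k
    using arg_cong[OF T_mult, of "\<lambda>f. f \<cdot> k"] that by simp
  show "hmult \<cdot> \<Phi> A A \<cdot> (A \<otimes> T) \<cdot> hcomult = hunit \<cdot> hcounit"
    using arg_cong[OF antipode_laws(1), of "\<lambda>f. T \<cdot> f"] by (simp add: e u tensor_comp_cont antipode_inverse)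
  show "hmult \<cdot> \<Phi> A A \<cdot> (T \<otimes> A) \<cdot> hcomult = hunit \<cdot> hcounit"
    using arg_cong[OF antipode_laws(2), of "\<lambda>f. T \<cdot> f"] by (simp add: e u tensor_comp_cont antipode_inverse)
qed

text \<open>\<open>cancel_mid\<close> removes h2 T(h1), the pair created inside a word where two
  actions meet; \<open>cancel_out\<close> removes T(h2) h1, the pair left when nothing stands
  between these factors.\<close>

lemmas cancel_mid = cancel_step[OF antipode_core(3)[OF antipode_endo(2) _ T_laws(2)]]
lemmas cancel_out = cancel_step[OF antipode_core(4)[OF antipode_endo(2) _ T_laws(1)]]

lemma rep_mult: "distinct [q, m, n] \<Longrightarrow> rep [hw m, hw n] hmult [Mul [m, n] q] [hw q]"
  using rep_Mul[of q "[m, n]"] unfolding prodl_small by simp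

lemma rep_comult: "distinct [p, a, b] \<Longrightarrow> rep [hw p] hcomult [Cop p [a, b]] [hw a, hw b]"
  using rep_Cop[of p "[a, b]"] unfolding copl_small by simp

lemma rep_unit: "rep [] hunit [Mul [] q] [hw q]"
  using rep_Mul[of q "[]"] by simp

lemma rep_counit: "rep [hw p] hcounit [Cop p []] []"
  using rep_Cop[of p "[]"] by simp

lemma eqv_T_prod:
  assumes "distinct [x, y, z, t, a, b]"
  shows "eqv [hw x, hw y] [hw t] [Mul [x, y] z, Ap T z t] [Ap T x a, Ap T y b, Mul [b, a] t]"
proof (rule eqv_rep)
  show "rep [hw x, hw y] (T \<cdot> hmult) [Mul [x, y] z, Ap T z t] [hw t]"
    using rep_comp[OF rep_mult[of z x y] rep_Ap[of T z t]] assms by auto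
  have "rep [hw x, hw y] (T \<otimes> T) [Ap T x a, Ap T y b] [hw a, hw b]"
    using rep_tensor[OF rep_Ap[of T x a] rep_Ap[of T y b]] assms by auto
  then have "rep [hw x, hw y] (\<Phi> A A \<cdot> (T \<otimes> T)) [Ap T x a, Ap T y b] [hw b, hw a]"
    using rep_comp[OF _ rep_braid[of "[hw a]" "[hw b]"], of "[hw x, hw y]" "T \<otimes> T" "[Ap T x a, Ap T y b]"] assms
    by auto
  then show "rep [hw x, hw y] (T \<cdot> hmult) [Ap T x a, Ap T y b, Mul [b, a] t] [hw t]"
    unfolding T_mult
    using rep_comp[OF _ rep_mult[of t b a], of "[hw x, hw y]" "\<Phi> A A \<cdot> (T \<otimes> T)" "[Ap T x a, Ap T y b]"] assms
    by auto
qed auto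

lemma eqv_T_cop:
  assumes "distinct [x, y, a, b, c, d]"
  shows "eqv [hw x] [hw a, hw b] [Ap T x y, Cop y [a, b]] [Cop x [c, d], Ap T d a, Ap T c b]"
proof (rule eqv_rep)
  show "rep [hw x] (hcomult \<cdot> T) [Ap T x y, Cop y [a, b]] [hw a, hw b]"
    using rep_comp[OF rep_Ap[of T x y] rep_comult[of y a b]] assms by auto
  have 1: "rep [hw d, hw c] (T \<otimes> T) [Ap T d a, Ap T c b] [hw a, hw b]"
    using rep_tensor[OF rep_Ap[of T d a] rep_Ap[of T c b]] assms by auto
  have 2: "rep [hw x] (\<Phi> A A \<cdot> hcomult) [Cop x [c, d]] [hw d, hw c]"
    using rep_comp[OF rep_comult[of x c d] rep_braid[of "[hw c]" "[hw d]", simplified]] assms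
    by auto
  show "rep [hw x] (hcomult \<cdot> T) [Cop x [c, d], Ap T d a, Ap T c b] [hw a, hw b]"
    unfolding T_comult using rep_comp[OF 2 1] assms by auto
qed auto

lemma eqv_T_unit:
  assumes "z \<noteq> t"
  shows "eqv [] [hw t] [Mul [] z, Ap T z t] [Mul [] t]"
proof (rule eqv_rep)
  show "rep [] hunit [Mul [] z, Ap T z t] [hw t]"
    using rep_comp[OF rep_unit[of z] rep_Ap[of T z t]] assms by (simp add: T_unit)
qed (simp_all add: rep_unit)

lemma eqv_T_counit:
  assumes "x \<noteq> y"
  shows "eqv [hw x] [] [Ap T x y, Cop y []] [Cop x []]"
proof (rule eqv_rep)
  show "rep [hw x] hcounit [Ap T x y, Cop y []] []"
    using rep_comp[OF rep_Ap[of T x y] rep_counit[of y]] assms by (simp add: T_counit)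
qed (simp_all add: rep_counit)

section \<open>Pairing with the dual\<close>

lemma rep_pairing2:
  assumes "f \<noteq> g" "a \<noteq> b"
  shows "rep [dw f, dw g, hw a, hw b] ((ev \<otimes> ev) \<cdot> (D \<otimes> \<Phi> D A \<otimes> A)) [Ev f a, Ev g b] []"
proof -
  have "rep [dw g, hw a] (\<Phi> D A) [] [hw a, dw g]"
    using rep_braid[of "[dw g]" "[hw a]"] by simp
  from rep_tensor[OF this rep_hw[of b]]
  have "rep [dw g, hw a, hw b] (\<Phi> D A \<otimes> A) [] [hw a, dw g, hw b]"
    using assms by simp
  from rep_tensor[OF rep_dw[of f] this]
  have 1: "rep [dw f, dw g, hw a, hw b] (D \<otimes> \<Phi> D A \<otimes> A) [] [dw f, hw a, dw g, hw b]"
    using assms by simp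
  have "rep [dw f, hw a, dw g, hw b] (ev \<otimes> ev) [Ev f a, Ev g b] []"
    using rep_tensor[OF rep_Ev[of f a] rep_Ev[of g b]] assms by simp
  from rep_comp[OF 1 this] show ?thesis using assms by simp
qed

text \<open>The circuit form of testing an output in \<open>D\<close>: an evaluation gate with a new
  \<open>H\<close> wire is appended. The test is faithful by \<open>transpose_inj\<close>.\<close>

lemma rep_test:
  assumes "rep xs f gl (ys @ [dw k])" "ok (gl @ [Ev k x]) ys (xs @ [hw x])"
  shows "rep (xs @ [hw x]) ((tens ys \<otimes> ev) \<cdot> (f \<otimes> A)) (gl @ [Ev k x]) ys"
proof -
  have f: "ok gl (ys @ [dw k]) xs" using assms(1) by (simp add: rep_def)
  have x: "hw x \<notin> set xs" "hw x \<notin> set (concat (map outs gl))" using assms(2) by (auto simp: ok_def)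
  have "flow gl zs us \<Longrightarrow> set zs \<subseteq> set us \<union> set (concat (map outs gl))" for zs us
    by (induction gl arbitrary: us) fastforce+
  then have ys: "set ys \<subseteq> set xs \<union> set (concat (map outs gl))" using f by (force simp: ok_def)
  have d: "distinct (ys @ [dw k])" "distinct xs" using f by (auto simp: ok_def)
  have x': "hw x \<notin> set ys" using x ys by blast
  have "flow (gl @ []) ((ys @ [dw k]) @ [hw x]) (xs @ [hw x])"
    by (rule flow_append[of gl "ys @ [dw k]"]) (use f x in \<open>auto simp: ok_def\<close>)
  then have "ok gl ((ys @ [dw k]) @ [hw x]) (xs @ [hw x])"
    using d x x' f by (auto simp: ok_def)
  then have 1: "rep (xs @ [hw x]) (f \<otimes> A) gl ((ys @ [dw k]) @ [hw x])"
    using rep_tensor[OF assms(1) rep_hw[of x]] by simp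
  have "ok ([] @ [Ev k x]) (ys @ []) (ys @ [dw k, hw x])"
    using d x' by (auto simp: ok_def rem_disjoint)
  then have 2: "rep (ys @ [dw k, hw x]) (tens ys \<otimes> ev) [Ev k x] ys"
    using rep_tensor[OF rep_id[of ys] rep_Ev[of k x]] d by simp
  show ?thesis using rep_comp[OF 1 _ assms(2)] 2 by simp
qed

lemma rep_hom: "rep xs f gl ys \<Longrightarrow> f \<in> Arr C \<and> Dom C f = tens xs \<and> Cod C f = tens ys"
  by (auto simp: rep_def)

lemma test_D:
  assumes "rep xs f gl (ys @ [dw k])" "rep xs f' gl' (ys' @ [dw k'])" "tens ys = tens ys'"
    "rep (xs @ [hw x]) ((tens ys \<otimes> ev) \<cdot> (f \<otimes> A)) h zs"
    "rep (xs @ [hw x]) ((tens ys' \<otimes> ev) \<cdot> (f' \<otimes> A)) h' zs"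
    "run h zs (xs @ [hw x]) = run h' zs (xs @ [hw x])"
  shows "f = f'"
proof -
  have "(tens ys \<otimes> ev) \<cdot> (f \<otimes> A) = (tens ys \<otimes> ev) \<cdot> (f' \<otimes> A)"
    using rep_eq[OF assms(4,5,6)] assms(3) by simp
  then show ?thesis
    using transpose_inj[of "tens ys" f f'] rep_hom[OF assms(1)] rep_hom[OF assms(2)] assms(3) by simp
qed

lemma test1:
  assumes "rep xs f gl (ys @ [dw k])" "rep xs f' gl' (ys @ [dw k'])"
    "ok (gl @ [Ev k x]) ys (xs @ [hw x])" "ok (gl' @ [Ev k' x]) ys (xs @ [hw x])"
    "run (gl @ [Ev k x]) ys (xs @ [hw x]) = run (gl' @ [Ev k' x]) ys (xs @ [hw x])"
  shows "f = f'"
  using test_D[OF assms(1,2) refl rep_test[OF assms(1,3)] rep_test[OF assms(2,4)] assms(5)] .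

text \<open>Outputs are tested from the right, so the last output is paired with the first of the
  new wires; \<open>test3\<close> continues in the same way.\<close>

lemma test2:
  assumes "rep xs f gl (ys @ [dw p] @ [dw q])" "rep xs f' gl' (ys @ [dw p'] @ [dw q'])"
    "ok (gl @ [Ev q y]) (ys @ [dw p]) (xs @ [hw y])" "ok (gl' @ [Ev q' y]) (ys @ [dw p']) (xs @ [hw y])"
    "ok (gl @ [Ev q y, Ev p x]) ys (xs @ [hw y, hw x])" "ok (gl' @ [Ev q' y, Ev p' x]) ys (xs @ [hw y, hw x])"
    "run (gl @ [Ev q y, Ev p x]) ys (xs @ [hw y, hw x]) = run (gl' @ [Ev q' y, Ev p' x]) ys (xs @ [hw y, hw x])"
  shows "f = f'"
proof -
  have 1: "rep xs f gl ((ys @ [dw p]) @ [dw q])" "rep xs f' gl' ((ys @ [dw p']) @ [dw q'])"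
    using assms(1,2) by simp_all
  note t = rep_test[OF 1(1) assms(3)] rep_test[OF 1(2) assms(4)]
  have "(tens (ys @ [dw p]) \<otimes> ev) \<cdot> (f \<otimes> A) = (tens (ys @ [dw p']) \<otimes> ev) \<cdot> (f' \<otimes> A)"
    by (rule test1[OF t, of x]) (use assms in simp_all)
  then show ?thesis
    using transpose_inj[of "tens (ys @ [dw p])" f f'] rep_hom[OF 1(1)] rep_hom[OF 1(2)] by simp
qed

lemma test3:
  assumes "rep xs f gl [dw p, dw q, dw r]" "rep xs f' gl' [dw p', dw q', dw r']"
    "ok (gl @ [Ev r z]) [dw p, dw q] (xs @ [hw z])" "ok (gl' @ [Ev r' z]) [dw p', dw q'] (xs @ [hw z])"
    "ok (gl @ [Ev r z, Ev q y]) [dw p] (xs @ [hw z, hw y])" "ok (gl' @ [Ev r' z, Ev q' y]) [dw p'] (xs @ [hw z, hw y])"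
    "ok (gl @ [Ev r z, Ev q y, Ev p x]) [] (xs @ [hw z, hw y, hw x])"
    "ok (gl' @ [Ev r' z, Ev q' y, Ev p' x]) [] (xs @ [hw z, hw y, hw x])"
    "run (gl @ [Ev r z, Ev q y, Ev p x]) [] (xs @ [hw z, hw y, hw x])
      = run (gl' @ [Ev r' z, Ev q' y, Ev p' x]) [] (xs @ [hw z, hw y, hw x])"
  shows "f = f'"
proof -
  have 1: "rep xs f gl ([dw p, dw q] @ [dw r])" "rep xs f' gl' ([dw p', dw q'] @ [dw r'])"
    using assms(1,2) by simp_all
  have t: "rep (xs @ [hw z]) ((D \<otimes> D \<otimes> ev) \<cdot> (f \<otimes> A)) (gl @ [Ev r z]) ([] @ [dw p] @ [dw q])"
    "rep (xs @ [hw z]) ((D \<otimes> D \<otimes> ev) \<cdot> (f' \<otimes> A)) (gl' @ [Ev r' z]) ([] @ [dw p'] @ [dw q'])"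
    using rep_test[OF 1(1) assms(3)] rep_test[OF 1(2) assms(4)] by simp_all
  have "(D \<otimes> D \<otimes> ev) \<cdot> (f \<otimes> A) = (D \<otimes> D \<otimes> ev) \<cdot> (f' \<otimes> A)"
    by (rule test2[OF t, of y x]) (use assms in simp_all)
  then show ?thesis
    using transpose_inj[of "D \<otimes> D" f f'] rep_hom[OF 1(1)] rep_hom[OF 1(2)] by simp
qed

lemma rep_comp_eq:
  assumes "rep xs f gl zs" "rep zs' h gl' ys" "zs = zs'" "ok (gl @ gl') ys xs"
  shows "rep xs (h \<cdot> f) (gl @ gl') ys"
  using assms rep_comp by simp

text \<open>Transposing twice yields nested evaluations, in which the second factor \<open>D\<close>
  meets the first factor \<open>H\<close>, whereas the dual is defined by pairing in parallel. The
  two differ by a swap of the \<open>H\<close> inputs.\<close>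

lemma pairing2_nested:
  "(ev \<otimes> ev) \<cdot> (D \<otimes> \<Phi> D A \<otimes> A) \<cdot> (D \<otimes> D \<otimes> \<Phi> A A) = ev \<cdot> (D \<otimes> ev \<otimes> A)"
proof -
  let ?is = "[dw 1, dw 2, hw 1, hw 2]"
  have 1: "rep ?is (((ev \<otimes> ev) \<cdot> (D \<otimes> \<Phi> D A \<otimes> A)) \<cdot> (D \<otimes> D \<otimes> \<Phi> A A)) [Ev 1 2, Ev 2 1] []"
    using rep_comp_eq[OF rep_tensor[OF rep_id[of "[dw 1, dw 2]"] rep_braid[of "[hw 1]" "[hw 2]"]] rep_pairing2[of 1 2 2 1]]
    by simp
  have 2: "rep ?is (ev \<cdot> (D \<otimes> ev \<otimes> A)) [Ev 2 1, Ev 1 2] []"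
    using rep_comp_eq[OF rep_tensor[OF rep_dw[of 1] rep_tensor[OF rep_Ev[of 2 1] rep_hw[of 2]]] rep_Ev[of 1 2]]
    by simp
  have "run [Ev 1 2, Ev 2 1] [] ?is = run [Ev 2 1, Ev 1 2] [] ?is"
    by (rule run_mset) (simp_all add: ok_def)
  from rep_eq[OF 1 2 this] show ?thesis by simp
qed

lemma pairing2_transpose:
  assumes "g \<in> hom C D (D \<otimes> D)"
  shows "((ev \<otimes> ev) \<cdot> (D \<otimes> \<Phi> D A \<otimes> A) \<cdot> (g \<otimes> A \<otimes> A)) \<cdot> (D \<otimes> \<Phi> A A)
    = ev \<cdot> (((D \<otimes> ev) \<cdot> (g \<otimes> A)) \<otimes> A)"
proof -
  have g [simp]: "g \<in> Arr C" "Dom C g = D" "Cod C g = D \<otimes> D" using assms by (auto simp: hom_iff)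
  have "((ev \<otimes> ev) \<cdot> (D \<otimes> \<Phi> D A \<otimes> A) \<cdot> (g \<otimes> A \<otimes> A)) \<cdot> (D \<otimes> \<Phi> A A)
    = (ev \<otimes> ev) \<cdot> (D \<otimes> \<Phi> D A \<otimes> A) \<cdot> (D \<otimes> D \<otimes> \<Phi> A A) \<cdot> (g \<otimes> A \<otimes> A)"
    using slide[of g "\<Phi> A A"] by simp
  also have "\<dots> = ((ev \<otimes> ev) \<cdot> (D \<otimes> \<Phi> D A \<otimes> A) \<cdot> (D \<otimes> D \<otimes> \<Phi> A A)) \<cdot> (g \<otimes> A \<otimes> A)"
    by simp
  also have "\<dots> = ev \<cdot> (((D \<otimes> ev) \<cdot> (g \<otimes> A)) \<otimes> A)"
    unfolding pairing2_nested by (simp add: whisker_r)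
  finally show ?thesis .
qed

lemma id_braid_sym: "(D \<otimes> \<Phi> A A) \<cdot> (D \<otimes> \<Phi> A A) = D \<otimes> A \<otimes> A"
  using whisker_l[of D "\<Phi> A A" "\<Phi> A A"] by (simp add: sym_HH)

text \<open>Up to the invertible swap, this pairing is a double transposition, each stage of which
  is bijective. This justifies the definite description of the comultiplication of the dual.\<close>

lemma pairing2_unique:
  assumes f: "f \<in> hom C (D \<otimes> A \<otimes> A) \<one>"
  shows "\<exists>!g. g \<in> hom C D (D \<otimes> D) \<and>
    (ev \<otimes> ev) \<cdot> (D \<otimes> \<Phi> D A \<otimes> A) \<cdot> (g \<otimes> A \<otimes> A) = f"
proof -
  have f' [simp]: "f \<in> Arr C" "Dom C f = D \<otimes> A \<otimes> A" "Cod C f = \<one>" using f by (auto simp: hom_iff)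
  obtain g1 where g1: "g1 \<in> Arr C" "Dom C g1 = D \<otimes> A" "Cod C g1 = D" "ev \<cdot> (g1 \<otimes> A) = f \<cdot> (D \<otimes> \<Phi> A A)"
    using transpose_exists[of "D \<otimes> A" "f \<cdot> (D \<otimes> \<Phi> A A)"] by auto
  obtain g where g: "g \<in> Arr C" "Dom C g = D" "Cod C g = D \<otimes> D" "(D \<otimes> ev) \<cdot> (g \<otimes> A) = g1"
    using transpose_exists[of D g1] g1 by auto
  let ?pair = "\<lambda>g. (ev \<otimes> ev) \<cdot> (D \<otimes> \<Phi> D A \<otimes> A) \<cdot> (g \<otimes> A \<otimes> A)"
  have swap: "?pair g = (ev \<cdot> (((D \<otimes> ev) \<cdot> (g \<otimes> A)) \<otimes> A)) \<cdot> (D \<otimes> \<Phi> A A)" if "g \<in> hom C D (D \<otimes> D)" for g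
    unfolding pairing2_transpose[OF that, symmetric] using that id_braid_sym by (simp add: hom_iff)
  show ?thesis
  proof (intro ex1I conjI)
    show gh: "g \<in> hom C D (D \<otimes> D)" using g by (simp add: hom_iff)
    show "?pair g = f"
      unfolding swap[OF gh] g(4) g1(4) using id_braid_sym by simp
    fix k assume k: "k \<in> hom C D (D \<otimes> D) \<and> ?pair k = f"
    then have kt [simp]: "k \<in> Arr C" "Dom C k = D" "Cod C k = D \<otimes> D" by (auto simp: hom_iff)
    have "ev \<cdot> (((D \<otimes> ev) \<cdot> (k \<otimes> A)) \<otimes> A) = ev \<cdot> (g1 \<otimes> A)"
      using pairing2_transpose[of k] k g1(4) by simp
    then have "(D \<otimes> ev) \<cdot> (k \<otimes> A) = g1"
      using transpose_inj[of "\<one>" "(D \<otimes> ev) \<cdot> (k \<otimes> A)" g1] g1 by simp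
    then show "k = g"
      using transpose_inj[of D k g] g by simp
  qed
qed

text \<open>By naturality the pairing is an ordinary transposition preceded by the isomorphism
  \<open>\<Phi> A (A \<otimes> D)\<close>. This justifies the definite description of the left
  action.\<close>

lemma ev_bar_unique:
  assumes f: "f \<in> hom C (A \<otimes> A \<otimes> D) \<one>"
  shows "\<exists>!g. g \<in> hom C (A \<otimes> D) D \<and> (ev \<cdot> \<Phi> A D) \<cdot> (A \<otimes> g) = f"
proof -
  let ?B = "\<Phi> A (A \<otimes> D)"
  have iso: "is_iso C ?B" by (rule braid_iso) simp_all
  note k = inv_arrow_facts[OF iso, simplified]
  have f' [simp]: "f \<in> Arr C" "Dom C f = A \<otimes> A \<otimes> D" "Cod C f = \<one>" using f by (auto simp: hom_iff)
  have nat: "(ev \<cdot> \<Phi> A D) \<cdot> (A \<otimes> g) = (ev \<cdot> (g \<otimes> A)) \<cdot> ?B" if "g \<in> hom C (A \<otimes> D) D" for g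
    using that braid_nat[of "A" g] by (simp add: hom_iff)
  have cancel: "(x \<cdot> ?B) \<cdot> inv_arrow C ?B = x" if "x \<in> Arr C" "Dom C x = A \<otimes> D \<otimes> A" for x
    using that k by simp
  obtain g where g: "g \<in> Arr C" "Dom C g = A \<otimes> D" "Cod C g = D" "ev \<cdot> (g \<otimes> A) = f \<cdot> inv_arrow C ?B"
    using transpose_exists[of "A \<otimes> D" "f \<cdot> inv_arrow C ?B"] k by auto
  show ?thesis
  proof (intro ex1I conjI)
    show gh: "g \<in> hom C (A \<otimes> D) D" using g by (simp add: hom_iff)
    show "(ev \<cdot> \<Phi> A D) \<cdot> (A \<otimes> g) = f" unfolding nat[OF gh] g(4) using k by simp
    fix x assume x: "x \<in> hom C (A \<otimes> D) D \<and> (ev \<cdot> \<Phi> A D) \<cdot> (A \<otimes> x) = f"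
    then have xt: "x \<in> Arr C" "Dom C x = A \<otimes> D" "Cod C x = D" by (auto simp: hom_iff)
    have "ev \<cdot> (x \<otimes> A) = f \<cdot> inv_arrow C ?B"
      using nat[of x] x cancel[of "ev \<cdot> (x \<otimes> A)"] xt by simp
    then show "x = g" using transpose_inj[of "\<one>" x g] g xt by simp
  qed
qed

end

section \<open>The structure of the dual and the two actions\<close>

text \<open>The structure arrows enter through the equations that characterise them, with the
  opposite multiplication written out, so that no definite description occurs in the calculations.
  In \<open>r_eq\<close> a braiding stands where the definition has its inverse.\<close>

locale double_actions = hopf_double C H D ev coev S T
  for C :: "'a braided_cat" (structure) and H :: "'a bialg_data" and D ev coev S T :: 'a +
  fixes m u d l r :: 'a
  assumes m_hom: "m \<in> hom C (D \<otimes> D) D" and u_hom: "u \<in> hom C \<one> D" and d_hom: "d \<in> hom C D (D \<otimes> D)"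
    and l_hom: "l \<in> hom C (A \<otimes> D) D"
    and m_ev: "ev \<cdot> (m \<otimes> A) = (ev \<otimes> ev) \<cdot> (D \<otimes> \<Phi> D A \<otimes> A) \<cdot> (D \<otimes> D \<otimes> \<Delta>\<^bsub>H\<^esub>)"
    and u_ev: "ev \<cdot> (u \<otimes> A) = \<epsilon>\<^bsub>H\<^esub>"
    and d_ev: "(ev \<otimes> ev) \<cdot> (D \<otimes> \<Phi> D A \<otimes> A) \<cdot> (d \<otimes> A \<otimes> A) = ev \<cdot> (D \<otimes> (\<nabla>\<^bsub>H\<^esub> \<cdot> \<Phi> A A))"
    and l_ev: "(ev \<cdot> \<Phi> A D) \<cdot> (A \<otimes> l) =
      (ev \<cdot> \<Phi> A D) \<cdot> ((\<nabla>\<^bsub>H\<^esub> \<cdot> \<Phi> A A \<cdot> (\<nabla>\<^bsub>H\<^esub> \<otimes> T) \<cdot> (A \<otimes> \<Delta>\<^bsub>H\<^esub>)) \<otimes> D)"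
    and r_eq: "r = (A \<otimes> (ev \<cdot> \<Phi> A D)) \<cdot> (A \<otimes> (\<nabla>\<^bsub>H\<^esub> \<cdot> \<Phi> A A) \<otimes> D) \<cdot>
      (\<Phi> A A \<otimes> T \<otimes> D) \<cdot> (((\<Delta>\<^bsub>H\<^esub> \<otimes> A) \<cdot> \<Delta>\<^bsub>H\<^esub>) \<otimes> D)"
begin

lemma action_typing [simp]:
  "m \<in> Arr C" "Dom C m = D \<otimes> D" "Cod C m = D"
  "u \<in> Arr C" "Dom C u = \<one>" "Cod C u = D"
  "d \<in> Arr C" "Dom C d = D" "Cod C d = D \<otimes> D"
  "l \<in> Arr C" "Dom C l = A \<otimes> D" "Cod C l = D"
  "r \<in> Arr C" "Dom C r = A \<otimes> D" "Cod C r = A"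
  using m_hom u_hom d_hom l_hom by (simp_all add: hom_iff r_eq)

definition DMul :: "nat \<Rightarrow> nat \<Rightarrow> nat \<Rightarrow> (wire, 'a) gate" where
  "DMul f g k = ([dw f, dw g], [dw k], m)"

definition DUnit :: "nat \<Rightarrow> (wire, 'a) gate" where
  "DUnit k = ([], [dw k], u)"

definition DCop :: "nat \<Rightarrow> nat \<Rightarrow> nat \<Rightarrow> (wire, 'a) gate" where
  "DCop f p q = ([dw f], [dw p, dw q], d)"

definition LAct :: "nat \<Rightarrow> nat \<Rightarrow> nat \<Rightarrow> (wire, 'a) gate" where
  "LAct h f k = ([hw h, dw f], [dw k], l)"

definition RAct :: "nat \<Rightarrow> nat \<Rightarrow> nat \<Rightarrow> (wire, 'a) gate" where
  "RAct h f y = ([hw h, dw f], [hw y], r)"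

lemma action_gate_simps [simp]:
  "ins (DMul f g k) = [dw f, dw g]" "outs (DMul f g k) = [dw k]" "gate (DMul f g k)"
  "ins (DUnit k) = []" "outs (DUnit k) = [dw k]" "gate (DUnit k)"
  "ins (DCop f p q) = [dw f]" "outs (DCop f p q) = [dw p, dw q]" "gate (DCop f p q)"
  "ins (LAct h f k) = [hw h, dw f]" "outs (LAct h f k) = [dw k]" "gate (LAct h f k)"
  "ins (RAct h f y) = [hw h, dw f]" "outs (RAct h f y) = [hw y]" "gate (RAct h f y)"
  by (simp_all add: DMul_def DUnit_def DCop_def LAct_def RAct_def gate_def)

lemma action_arr_simps:
  "arr (DMul f g k) = m" "arr (DUnit k) = u" "arr (DCop f p q) = d" "arr (LAct h f k) = l" "arr (RAct h f y) = r"
  by (simp_all add: DMul_def DUnit_def DCop_def LAct_def RAct_def)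

lemma rep_DMul: "distinct [f, g, k] \<Longrightarrow> rep [dw f, dw g] m [DMul f g k] [dw k]"
  using rep_gate[of "DMul f g k"] by (auto simp: action_arr_simps)

lemma rep_DUnit: "rep [] u [DUnit k] [dw k]"
  using rep_gate[of "DUnit k"] by (auto simp: action_arr_simps)

lemma rep_DCop: "distinct [f, p, q] \<Longrightarrow> rep [dw f] d [DCop f p q] [dw p, dw q]"
  using rep_gate[of "DCop f p q"] by (auto simp: action_arr_simps)

lemma rep_LAct: "f \<noteq> k \<Longrightarrow> rep [hw h, dw f] l [LAct h f k] [dw k]"
  using rep_gate[of "LAct h f k"] by (auto simp: action_arr_simps)

lemma rep_RAct: "h \<noteq> y \<Longrightarrow> rep [hw h, dw f] r [RAct h f y] [hw y]"
  using rep_gate[of "RAct h f y"] by (auto simp: action_arr_simps)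

lemma rep_DCounit: "rep [dw f] (ev \<cdot> (D \<otimes> hunit)) [Mul [] z, Ev f z] []"
proof -
  have "rep [dw f] (D \<otimes> hunit) [Mul [] z] [dw f, hw z]"
    using rep_tensor[OF rep_dw[of f] rep_unit[of z]] by auto
  from rep_comp[OF this rep_Ev[of f z]] show ?thesis by simp
qed

lemma rep_ev_bar: "rep [hw x, dw f] (ev \<cdot> \<Phi> A D) [Ev f x] []"
  using rep_comp[OF rep_braid[of "[hw x]" "[dw f]"], of ev "[Ev f x]" "[]"] rep_Ev[of f x] by simp

lemma eqv_DMul:
  assumes "distinct [f, g, k]" "distinct [x, a, b]"
  shows "eqv [dw f, dw g, hw x] [] [DMul f g k, Ev k x] [Cop x [a, b], Ev f a, Ev g b]"
proof (rule eqv_rep)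
  have "rep [dw f, dw g, hw x] (m \<otimes> A) [DMul f g k] [dw k, hw x]"
    using rep_tensor[OF rep_DMul rep_hw[of x], of f g k] assms by auto
  from rep_comp[OF this rep_Ev]
  show "rep [dw f, dw g, hw x] (ev \<cdot> (m \<otimes> A)) [DMul f g k, Ev k x] []"
    using assms by auto
  have "rep [dw f, dw g, hw x] (D \<otimes> D \<otimes> hcomult) [Cop x [a, b]] [dw f, dw g, hw a, hw b]"
    using rep_tensor[OF rep_id[of "[dw f, dw g]"] rep_comult[of x a b]] assms by auto
  from rep_comp[OF this rep_pairing2]
  show "rep [dw f, dw g, hw x] (ev \<cdot> (m \<otimes> A)) [Cop x [a, b], Ev f a, Ev g b] []"
    using assms by (auto simp: m_ev)
qed auto

lemma eqv_DUnit: "eqv [hw x] [] [DUnit k, Ev k x] [Cop x []]"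
proof (rule eqv_rep)
  have "rep [hw x] (u \<otimes> A) [DUnit k] [dw k, hw x]"
    using rep_tensor[OF rep_DUnit rep_hw[of x], of k] by auto
  from rep_comp[OF this rep_Ev] show "rep [hw x] hcounit [DUnit k, Ev k x] []"
    by (auto simp: u_ev)
qed (auto simp: rep_counit)

lemma rep_opposite_mult:
  "distinct [x, y, z] \<Longrightarrow> rep [hw x, hw y] (hmult \<cdot> \<Phi> A A) [Mul [y, x] z] [hw z]"
  using rep_comp[OF rep_braid[of "[hw x]" "[hw y]"], of hmult "[Mul [y, x] z]" "[hw z]"] rep_mult[of z y x]
  by auto

lemma eqv_DCop:
  assumes "distinct [f, p, q]" "distinct [x, y, z]"
  shows "eqv [dw f, hw x, hw y] [] [DCop f p q, Ev p x, Ev q y] [Mul [y, x] z, Ev f z]"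
proof (rule eqv_rep)
  have "rep [dw f, hw x, hw y] (d \<otimes> A \<otimes> A) [DCop f p q] [dw p, dw q, hw x, hw y]"
    using rep_tensor[OF rep_DCop rep_id[of "[hw x, hw y]"], of f p q] assms by auto
  from rep_comp[OF this rep_pairing2]
  have "rep [dw f, hw x, hw y] (((ev \<otimes> ev) \<cdot> (D \<otimes> \<Phi> D A \<otimes> A)) \<cdot> (d \<otimes> A \<otimes> A)) [DCop f p q, Ev p x, Ev q y] []"
    using assms by auto
  then show "rep [dw f, hw x, hw y] (ev \<cdot> (D \<otimes> (hmult \<cdot> \<Phi> A A))) [DCop f p q, Ev p x, Ev q y] []"
    by (simp add: d_ev)
  have "rep [dw f, hw x, hw y] (D \<otimes> (hmult \<cdot> \<Phi> A A)) [Mul [y, x] z] [dw f, hw z]"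
    using rep_tensor[OF rep_dw[of f] rep_opposite_mult[of x y z]] assms by auto
  from rep_comp[OF this rep_Ev]
  show "rep [dw f, hw x, hw y] (ev \<cdot> (D \<otimes> (hmult \<cdot> \<Phi> A A))) [Mul [y, x] z, Ev f z] []"
    using assms by auto
qed auto

text \<open>The left action is known only through its pairing, so a \<open>LAct\<close> gate is
  expanded together with the evaluation that consumes its output.\<close>

lemma eqv_LAct:
  assumes "f \<noteq> k" "distinct [h, x, a, b, c, z]"
  shows "eqv [hw x, hw h, dw f] [] [LAct h f k, Ev k x] [Cop h [a, b], Ap T b c, Mul [c, x, a] z, Ev f z]"
proof -
  \<comment> \<open>\<open>w\<close> names the intermediate product x h1, which is flattened away at
    the end.\<close>
  obtain w where w: "w \<notin> {h, x, a, b, c, z}" using ex_new_if_finite[OF infinite_UNIV_nat, of "{h, x, a, b, c, z}"] by auto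
  have "rep [hw x, hw h, dw f] (A \<otimes> l) [LAct h f k] [hw x, dw k]"
    using rep_tensor[OF rep_hw[of x] rep_LAct, of f k h] assms by auto
  from rep_comp[OF this rep_ev_bar]
  have 1: "rep [hw x, hw h, dw f] ((ev \<cdot> \<Phi> A D) \<cdot> (A \<otimes> l)) [LAct h f k, Ev k x] []"
    using assms by auto
  have "rep [hw x, hw h] (A \<otimes> hcomult) [Cop h [a, b]] [hw x, hw a, hw b]"
    using rep_tensor[OF rep_hw[of x] rep_comult[of h a b]] assms by auto
  moreover have "rep [hw x, hw a, hw b] (hmult \<otimes> T) [Mul [x, a] w, Ap T b c] [hw w, hw c]"
    using rep_tensor[OF rep_mult[of w x a] rep_Ap[of T b c]] assms w by auto
  ultimately have "rep [hw x, hw h] ((hmult \<otimes> T) \<cdot> (A \<otimes> hcomult)) [Cop h [a, b], Mul [x, a] w, Ap T b c] [hw w, hw c]"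
    using rep_comp[of "[hw x, hw h]" "A \<otimes> hcomult" "[Cop h [a, b]]"] assms w by auto
  from rep_comp[OF this rep_opposite_mult[of w c z]]
  have "rep [hw x, hw h] ((hmult \<cdot> \<Phi> A A) \<cdot> (hmult \<otimes> T) \<cdot> (A \<otimes> hcomult)) [Cop h [a, b], Mul [x, a] w, Ap T b c, Mul [c, w] z] [hw z]"
    using assms w by auto
  from rep_tensor[OF this rep_dw[of f]]
  have "rep [hw x, hw h, dw f] (((hmult \<cdot> \<Phi> A A) \<cdot> (hmult \<otimes> T) \<cdot> (A \<otimes> hcomult)) \<otimes> D)
      [Cop h [a, b], Mul [x, a] w, Ap T b c, Mul [c, w] z] [hw z, dw f]"
    using assms w by auto
  from rep_comp[OF this rep_ev_bar]
  have 2: "rep [hw x, hw h, dw f] ((ev \<cdot> \<Phi> A D) \<cdot> (A \<otimes> l))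
      [Cop h [a, b], Mul [x, a] w, Ap T b c, Mul [c, w] z, Ev f z] []"
    unfolding l_ev using assms w by auto
  have "run [Cop h [a, b], Mul [x, a] w, Ap T b c, Mul [c, w] z, Ev f z] [] [hw x, hw h, dw f]
    = run [Cop h [a, b], Ap T b c, Mul [x, a] w, Mul [c, w] z, Ev f z] [] [hw x, hw h, dw f]"
    by (rule run_mset) (use assms w in auto)
  also have "\<dots> = run [Cop h [a, b], Ap T b c, Mul [c, x, a] z, Ev f z] [] [hw x, hw h, dw f]"
    by (rule run_step[OF eqv_prods[of z w "[c]" "[x, a]" "[]"], of 2]) (use assms w in auto)
  finally have e: "run [Cop h [a, b], Mul [x, a] w, Ap T b c, Mul [c, w] z, Ev f z] [] [hw x, hw h, dw f]
    = run [Cop h [a, b], Ap T b c, Mul [c, x, a] z, Ev f z] [] [hw x, hw h, dw f]" .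
  have "ok [Cop h [a, b], Ap T b c, Mul [c, x, a] z, Ev f z] [] [hw x, hw h, dw f]"
    using assms by auto
  then show ?thesis using 1 2 e by (auto simp: eqv_def rep_def)
qed

text \<open>The right action is an explicit composite, so its gate expands by itself. The output
  \<open>y\<close> is the middle leg of a threefold coproduct.\<close>

lemma eqv_RAct:
  assumes "distinct [h, y, a, b, c, z]"
  shows "eqv [hw h, dw f] [hw y] [RAct h f y] [Cop h [a, y, b], Ap T b c, Mul [c, a] z, Ev f z]"
proof -
  obtain w where w: "w \<notin> {h, y, a, b, c, z}" using ex_new_if_finite[OF infinite_UNIV_nat, of "{h, y, a, b, c, z}"] by auto
  have "rep [hw w, hw b] (hcomult \<otimes> A) [Cop w [a, y]] [hw a, hw y, hw b]"
    using rep_tensor[OF rep_comult[of w a y] rep_hw[of b]] assms w by auto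
  from rep_comp[OF rep_comult[of h w b] this]
  have "rep [hw h] ((hcomult \<otimes> A) \<cdot> hcomult) [Cop h [w, b], Cop w [a, y]] [hw a, hw y, hw b]"
    using assms w by auto
  from rep_tensor[OF this rep_dw[of f]]
  have 1: "rep [hw h, dw f] (((hcomult \<otimes> A) \<cdot> hcomult) \<otimes> D) [Cop h [w, b], Cop w [a, y]] [hw a, hw y, hw b, dw f]"
    using assms w by auto
  have "rep [hw b, dw f] (T \<otimes> D) [Ap T b c] [hw c, dw f]"
    using rep_tensor[OF rep_Ap[of T b c] rep_dw[of f]] assms by auto
  moreover have "rep [hw a, hw y] (\<Phi> A A) [] [hw y, hw a]"
    using rep_braid[of "[hw a]" "[hw y]"] assms by auto
  ultimately have 2: "rep [hw a, hw y, hw b, dw f] (\<Phi> A A \<otimes> T \<otimes> D) [Ap T b c] [hw y, hw a, hw c, dw f]"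
    using rep_tensor[of "[hw a, hw y]" "\<Phi> A A" "[]" "[hw y, hw a]"] assms by auto
  have "rep [hw a, hw c, dw f] ((hmult \<cdot> \<Phi> A A) \<otimes> D) [Mul [c, a] z] [hw z, dw f]"
    using rep_tensor[OF rep_opposite_mult[of a c z] rep_dw[of f]] assms by auto
  from rep_tensor[OF rep_hw[of y] this]
  have 3: "rep [hw y, hw a, hw c, dw f] (A \<otimes> (hmult \<cdot> \<Phi> A A) \<otimes> D) [Mul [c, a] z] [hw y, hw z, dw f]"
    using assms by auto
  have 4: "rep [hw y, hw z, dw f] (A \<otimes> (ev \<cdot> \<Phi> A D)) [Ev f z] [hw y]"
    using rep_tensor[OF rep_hw[of y] rep_ev_bar[of z f]] assms by auto
  have 5: "rep [hw h, dw f] ((\<Phi> A A \<otimes> T \<otimes> D) \<cdot> (((hcomult \<otimes> A) \<cdot> hcomult) \<otimes> D))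
      [Cop h [w, b], Cop w [a, y], Ap T b c] [hw y, hw a, hw c, dw f]"
    using rep_comp[OF 1 2] assms w by auto
  have 6: "rep [hw h, dw f] ((A \<otimes> (hmult \<cdot> \<Phi> A A) \<otimes> D) \<cdot> (\<Phi> A A \<otimes> T \<otimes> D) \<cdot> (((hcomult \<otimes> A) \<cdot> hcomult) \<otimes> D))
      [Cop h [w, b], Cop w [a, y], Ap T b c, Mul [c, a] z] [hw y, hw z, dw f]"
    using rep_comp[OF 5 3] assms w by auto
  have 7: "rep [hw h, dw f] r [Cop h [w, b], Cop w [a, y], Ap T b c, Mul [c, a] z, Ev f z] [hw y]"
    unfolding r_eq using rep_comp[OF 6 4] assms w by auto
  have e: "run [Cop h [w, b], Cop w [a, y], Ap T b c, Mul [c, a] z, Ev f z] [hw y] [hw h, dw f]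
    = run [Cop h [a, y, b], Ap T b c, Mul [c, a] z, Ev f z] [hw y] [hw h, dw f]"
    by (rule run_step[OF eqv_cops[of h w "[]" "[a, y]" "[b]"], of 0]) (use assms w in auto)
  have "ok [Cop h [a, y, b], Ap T b c, Mul [c, a] z, Ev f z] [hw y] [hw h, dw f]"
    using assms by auto
  then have "rep [hw h, dw f] r [Cop h [a, y, b], Ap T b c, Mul [c, a] z, Ev f z] [hw y]"
    using 7 e unfolding rep_def by metis
  from eqv_rep[OF rep_RAct this] show ?thesis using assms by simp
qed

lemmas expand_DMul = run_step[OF eqv_DMul]
lemmas expand_DCop = run_step[OF eqv_DCop]
lemmas expand_LAct = run_step[OF eqv_LAct]
lemmas expand_RAct = run_step[OF eqv_RAct]

section \<open>Computations in Sweedler notation\<close>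

text \<open>
  The equalities that remain after pairing with \<open>H\<close>, as computations with Sweedler components. The names of
  wires are arbitrary numbers.
\<close>

lemma dual_mult_assoc_circuit:
  "run [DMul 1 2 4, DMul 4 3 5, Ev 5 9] [] [dw 1, dw 2, dw 3, hw 9]
    = run [DMul 2 3 4, DMul 1 4 5, Ev 5 9] [] [dw 1, dw 2, dw 3, hw 9]"
  (is "?lhs = ?rhs")
proof -
  let ?run = "\<lambda>gl. run gl [] [dw 1, dw 2, dw 3, hw 9]"
  let ?nf = "run [Cop 9 [12, 13, 11], Ev 1 12, Ev 2 13, Ev 3 11] [] [dw 1, dw 2, dw 3, hw 9]"
  have "?lhs = ?run [Cop 9 [10, 11], DMul 1 2 4, Ev 4 10, Ev 3 11]"
    by (rule expand_DMul[of 4 3 5 9 10 11 1]) simp_all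
  also have "\<dots> = ?run [Cop 9 [10, 11], Cop 10 [12, 13], Ev 1 12, Ev 2 13, Ev 3 11]"
    by (rule expand_DMul[of 1 2 4 10 12 13 1]) simp_all
  also have "\<dots> = ?nf"
    by (rule merge_cops[of 9 10 "[]" "[12, 13]" "[11]" 0]) simp_all
  finally have left: "?lhs = ?nf" .
  have "?rhs = ?run [Cop 9 [12, 14], DMul 2 3 4, Ev 4 14, Ev 1 12]"
    by (rule expand_DMul[of 1 4 5 9 12 14 1]) simp_all
  also have "\<dots> = ?run [Cop 9 [12, 14], Cop 14 [13, 11], Ev 2 13, Ev 3 11, Ev 1 12]"
    by (rule expand_DMul[of 2 3 4 14 13 11 1]) simp_all
  also have "\<dots> = ?nf"
    by (rule merge_cops[of 9 14 "[12]" "[13, 11]" "[]" 0]) simp_all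
  finally have right: "?rhs = ?nf" .
  show ?thesis unfolding left right ..
qed

lemma dual_mult_unit_left_circuit:
  "run [DUnit 2, DMul 2 1 3, Ev 3 9] [] [dw 1, hw 9]
    = run [Ev 1 9] [] [dw 1, hw 9]"
  (is "?lhs = ?rhs")
proof -
  let ?run = "\<lambda>gl. run gl [] [dw 1, hw 9]"
  have "?lhs = ?run [Cop 9 [10, 11], DUnit 2, Ev 2 10, Ev 1 11]"
    by (rule expand_DMul[of 2 1 3 9 10 11 1]) simp_all
  also have "\<dots> = ?run [Cop 9 [10, 11], Cop 10 [], Ev 1 11]"
    by (rule run_step[OF eqv_DUnit[of 10 2], of 1]) simp_all
  also have "\<dots> = ?run [Cop 9 [11], Ev 1 11]"
    by (rule merge_cops[of 9 10 "[]" "[]" "[11]" 0]) simp_all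
  also have "\<dots> = ?rhs"
    by (rule run_step[OF eqv_cop_ev[of 9 11 1], of 0]) simp_all
  finally show ?thesis .
qed

lemma dual_mult_unit_right_circuit:
  "run [DUnit 2, DMul 1 2 3, Ev 3 9] [] [dw 1, hw 9]
    = run [Ev 1 9] [] [dw 1, hw 9]"
  (is "?lhs = ?rhs")
proof -
  let ?run = "\<lambda>gl. run gl [] [dw 1, hw 9]"
  have "?lhs = ?run [Cop 9 [10, 11], DUnit 2, Ev 2 11, Ev 1 10]"
    by (rule expand_DMul[of 1 2 3 9 10 11 1]) simp_all
  also have "\<dots> = ?run [Cop 9 [10, 11], Cop 11 [], Ev 1 10]"
    by (rule run_step[OF eqv_DUnit[of 11 2], of 1]) simp_all
  also have "\<dots> = ?run [Cop 9 [10], Ev 1 10]"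
    by (rule merge_cops[of 9 11 "[10]" "[]" "[]" 0]) simp_all
  also have "\<dots> = ?rhs"
    by (rule run_step[OF eqv_cop_ev[of 9 10 1], of 0]) simp_all
  finally show ?thesis .
qed

text \<open>With test arguments x, y, z for the three outputs, from left to right, both sides become
  f(z y x).\<close>

lemma dual_comult_coassoc_circuit:
  "run [DCop 1 2 3, DCop 2 4 5, Ev 3 9, Ev 5 8, Ev 4 7] [] [dw 1, hw 9, hw 8, hw 7]
    = run [DCop 1 4 6, DCop 6 5 3, Ev 3 9, Ev 5 8, Ev 4 7] [] [dw 1, hw 9, hw 8, hw 7]"
  (is "?lhs = ?rhs")
proof -
  let ?run = "\<lambda>gl. run gl [] [dw 1, hw 9, hw 8, hw 7]"
  let ?nf = "run [Mul [9, 8, 7] 11, Ev 1 11] [] [dw 1, hw 9, hw 8, hw 7]"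
  have "?lhs = ?run [DCop 1 2 3, DCop 2 4 5, Ev 4 7, Ev 5 8, Ev 3 9]"
    by (rule run_mset) simp_all
  also have "\<dots> = ?run [Mul [8, 7] 10, DCop 1 2 3, Ev 2 10, Ev 3 9]"
    by (rule expand_DCop[of 2 4 5 7 8 10 1]) simp_all
  also have "\<dots> = ?run [Mul [8, 7] 10, Mul [9, 10] 11, Ev 1 11]"
    by (rule expand_DCop[of 1 2 3 10 9 11 1]) simp_all
  also have "\<dots> = ?nf"
    by (rule merge_prods[of 11 10 "[9]" "[8, 7]" "[]" 0]) simp_all
  finally have left: "?lhs = ?nf" .
  have "?rhs = ?run [DCop 1 4 6, DCop 6 5 3, Ev 5 8, Ev 3 9, Ev 4 7]"
    by (rule run_mset) simp_all
  also have "\<dots> = ?run [Mul [9, 8] 10, DCop 1 4 6, Ev 4 7, Ev 6 10]"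
    by (rule expand_DCop[of 6 5 3 8 9 10 1]) simp_all
  also have "\<dots> = ?run [Mul [9, 8] 10, Mul [10, 7] 11, Ev 1 11]"
    by (rule expand_DCop[of 1 4 6 7 10 11 1]) simp_all
  also have "\<dots> = ?nf"
    by (rule merge_prods[of 11 10 "[]" "[9, 8]" "[7]" 0]) simp_all
  finally have right: "?rhs = ?nf" .
  show ?thesis unfolding left right ..
qed

lemma dual_counit_left_circuit:
  "run [DCop 1 2 3, Mul [] 4, Ev 2 4, Ev 3 9] [] [dw 1, hw 9]
    = run [Ev 1 9] [] [dw 1, hw 9]"
  (is "?lhs = ?rhs")
proof -
  let ?run = "\<lambda>gl. run gl [] [dw 1, hw 9]"
  have "?lhs = ?run [Mul [] 4, DCop 1 2 3, Ev 2 4, Ev 3 9]"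
    by (rule run_mset) simp_all
  also have "\<dots> = ?run [Mul [] 4, Mul [9, 4] 11, Ev 1 11]"
    by (rule expand_DCop[of 1 2 3 4 9 11 1]) simp_all
  also have "\<dots> = ?run [Mul [9] 11, Ev 1 11]"
    by (rule merge_prods[of 11 4 "[9]" "[]" "[]" 0]) simp_all
  also have "\<dots> = ?rhs"
    by (rule run_step[OF eqv_prod_ev[of 9 11 1], of 0]) simp_all
  finally show ?thesis .
qed

lemma dual_counit_right_circuit:
  "run [DCop 1 2 3, Mul [] 4, Ev 3 4, Ev 2 9] [] [dw 1, hw 9]
    = run [Ev 1 9] [] [dw 1, hw 9]"
  (is "?lhs = ?rhs")
proof -
  let ?run = "\<lambda>gl. run gl [] [dw 1, hw 9]"
  have "?lhs = ?run [Mul [] 4, DCop 1 2 3, Ev 2 9, Ev 3 4]"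
    by (rule run_mset) simp_all
  also have "\<dots> = ?run [Mul [] 4, Mul [4, 9] 11, Ev 1 11]"
    by (rule expand_DCop[of 1 2 3 9 4 11 1]) simp_all
  also have "\<dots> = ?run [Mul [9] 11, Ev 1 11]"
    by (rule merge_prods[of 11 4 "[]" "[]" "[9]" 0]) simp_all
  also have "\<dots> = ?rhs"
    by (rule run_step[OF eqv_prod_ev[of 9 11 1], of 0]) simp_all
  finally show ?thesis .
qed

text \<open>Both sides become f(y1 x1) g(y2 x2); on the left this is the bialgebra law of
  \<open>H\<close> for the product y x.\<close>

lemma dual_comult_mult_circuit:
  "run [DMul 1 2 3, DCop 3 8 9, Ev 9 22, Ev 8 21] [] [dw 1, dw 2, hw 22, hw 21]
    = run [DCop 1 4 5, DCop 2 6 7, DMul 4 6 8, DMul 5 7 9, Ev 9 22, Ev 8 21] [] [dw 1, dw 2, hw 22, hw 21]"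
  (is "?lhs = ?rhs")
proof -
  let ?run = "\<lambda>gl. run gl [] [dw 1, dw 2, hw 22, hw 21]"
  let ?nf = "run [Cop 22 [6, 7], Cop 21 [8, 9], Mul [6, 8] 4, Mul [7, 9] 5, Ev 1 4, Ev 2 5] [] [dw 1, dw 2, hw 22, hw 21]"
  have "?lhs = ?run [DMul 1 2 3, DCop 3 8 9, Ev 8 21, Ev 9 22]"
    by (rule run_mset) simp_all
  also have "\<dots> = ?run [Mul [22, 21] 23, DMul 1 2 3, Ev 3 23]"
    by (rule expand_DCop[of 3 8 9 21 22 23 1]) simp_all
  also have "\<dots> = ?run [Mul [22, 21] 23, Cop 23 [4, 5], Ev 1 4, Ev 2 5]"
    by (rule expand_DMul[of 1 2 3 23 4 5 1]) simp_all
  also have "\<dots> = ?nf"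
    by (rule expand_bialg[of 22 21 23 4 5 6 7 8 9 0]) simp_all
  finally have left: "?lhs = ?nf" .
  have "?rhs = ?run [DCop 1 4 5, DCop 2 6 7, DMul 4 6 8, Ev 8 21, DMul 5 7 9, Ev 9 22]"
    by (rule run_mset) simp_all
  also have "\<dots> = ?run [DCop 1 4 5, DCop 2 6 7, DMul 5 7 9, Ev 9 22, Cop 21 [8, 9], Ev 4 8, Ev 6 9]"
    by (rule expand_DMul[of 4 6 8 21 8 9 2]) simp_all
  also have "\<dots> = ?run [Cop 22 [6, 7], Cop 21 [8, 9], DCop 1 4 5, Ev 4 8, Ev 5 6, DCop 2 6 7, Ev 7 7,
    Ev 6 9]"
    by (rule expand_DMul[of 5 7 9 22 6 7 2]) simp_all
  also have "\<dots> = ?run [Cop 22 [6, 7], Cop 21 [8, 9], DCop 2 6 7, Ev 6 9, Ev 7 7, Mul [6, 8] 4, Ev 1 4]"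
    by (rule expand_DCop[of 1 4 5 8 6 4 2]) simp_all
  also have "\<dots> = ?nf"
    by (rule expand_DCop[of 2 6 7 9 7 5 2]) simp_all
  finally have right: "?rhs = ?nf" .
  show ?thesis unfolding left right ..
qed

lemma dual_comult_unit_circuit:
  "run [DUnit 1, DCop 1 2 3, Ev 3 2, Ev 2 1] [] [hw 2, hw 1]
    = run [DUnit 2, DUnit 3, Ev 3 2, Ev 2 1] [] [hw 2, hw 1]"
  (is "?lhs = ?rhs")
proof -
  let ?run = "\<lambda>gl. run gl [] [hw 2, hw 1]"
  let ?nf = "run [Cop 2 [], Cop 1 []] [] [hw 2, hw 1]"
  have "?lhs = ?run [DUnit 1, DCop 1 2 3, Ev 2 1, Ev 3 2]"
    by (rule run_mset) simp_all
  also have "\<dots> = ?run [Mul [2, 1] 3, DUnit 1, Ev 1 3]"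
    by (rule expand_DCop[of 1 2 3 1 2 3 1]) simp_all
  also have "\<dots> = ?run [Mul [2, 1] 3, Cop 3 []]"
    by (rule run_step[OF eqv_DUnit[of 3 1], of 1]) simp_all
  also have "\<dots> = ?nf"
    by (rule run_step[OF eqv_mult_counit[of 2 1 3], of 0]) simp_all
  finally have left: "?lhs = ?nf" .
  have "?rhs = ?run [DUnit 2, Ev 2 1, DUnit 3, Ev 3 2]"
    by (rule run_mset) simp_all
  also have "\<dots> = ?run [DUnit 3, Ev 3 2, Cop 1 []]"
    by (rule run_step[OF eqv_DUnit[of 1 2], of 0]) simp_all
  also have "\<dots> = ?nf"
    by (rule run_step[OF eqv_DUnit[of 2 3], of 0]) simp_all
  finally have right: "?rhs = ?nf" .
  show ?thesis unfolding left right ..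
qed

lemma dual_counit_mult_circuit:
  "run [DMul 1 2 3, Mul [] 4, Ev 3 4] [] [dw 1, dw 2]
    = run [Mul [] 5, Ev 1 5, Mul [] 6, Ev 2 6] [] [dw 1, dw 2]"
  (is "?lhs = ?rhs")
proof -
  let ?run = "\<lambda>gl. run gl [] [dw 1, dw 2]"
  have "?lhs = ?run [Mul [] 4, DMul 1 2 3, Ev 3 4]"
    by (rule run_mset) simp_all
  also have "\<dots> = ?run [Mul [] 4, Cop 4 [5, 6], Ev 1 5, Ev 2 6]"
    by (rule expand_DMul[of 1 2 3 4 5 6 1]) simp_all
  also have "\<dots> = ?rhs"
    by (rule run_step[OF eqv_unit_comult[of 4 5 6], of 0]) simp_all
  finally show ?thesis .
qed

lemma dual_counit_unit_circuit:
  "run [DUnit 1, Mul [] 2, Ev 1 2] [] []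
    = run [] [] []"
  (is "?lhs = ?rhs")
proof -
  let ?run = "\<lambda>gl. run gl [] []"
  have "?lhs = ?run [Mul [] 2, DUnit 1, Ev 1 2]"
    by (rule run_mset) simp_all
  also have "\<dots> = ?run [Mul [] 2, Cop 2 []]"
    by (rule run_step[OF eqv_DUnit[of 2 1], of 1]) simp_all
  also have "\<dots> = ?rhs"
    by (rule run_step[OF eqv_unit_counit[of 2], of 0]) simp_all
  finally show ?thesis .
qed

text \<open>For factors a, b and test argument x, both sides are f(T(b2) T(a2) x a1 b1); on the left
  \<open>T\<close> reverses the product a2 b2.\<close>

lemma left_action_mult_circuit:
  "run [Mul [1, 2] 3, LAct 3 1 5, Ev 5 9] [] [hw 1, hw 2, dw 1, hw 9]
    = run [LAct 2 1 4, LAct 1 4 5, Ev 5 9] [] [hw 1, hw 2, dw 1, hw 9]"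
  (is "?lhs = ?rhs")
proof -
  let ?run = "\<lambda>gl. run gl [] [hw 1, hw 2, dw 1, hw 9]"
  let ?nf = "run [Cop 1 [11, 12], Cop 2 [21, 22], Ap T 12 13, Ap T 22 23,
    Mul [23, 13, 9, 11, 21] 20, Ev 1 20] [] [hw 1, hw 2, dw 1, hw 9]"
  have "?lhs = ?run [Mul [1, 2] 3, Cop 3 [10, 14], Ap T 14 15, Mul [15, 9, 10] 20, Ev 1 20]"
    by (rule expand_LAct[of 1 5 3 9 10 14 15 20 1]) simp_all
  also have "\<dots> = ?run [Cop 1 [11, 12], Cop 2 [21, 22], Mul [12, 22] 14, Ap T 14 15, Mul [11, 21] 10,
    Mul [15, 9, 10] 20, Ev 1 20]"
    by (rule expand_bialg[of 1 2 3 10 14 11 12 21 22 0]) simp_all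
  also have "\<dots> = ?run [Cop 1 [11, 12], Cop 2 [21, 22], Ap T 12 13, Ap T 22 23, Mul [23, 13] 15,
    Mul [11, 21] 10, Mul [15, 9, 10] 20, Ev 1 20]"
    by (rule run_step[OF eqv_T_prod[of 12 22 14 15 13 23], of 2]) simp_all
  also have "\<dots> = ?run [Cop 1 [11, 12], Cop 2 [21, 22], Ap T 12 13, Ap T 22 23, Mul [23, 13] 15,
    Mul [15, 9, 11, 21] 20, Ev 1 20]"
    by (rule merge_prods[of 20 10 "[15, 9]" "[11, 21]" "[]" 5]) simp_all
  also have "\<dots> = ?nf"
    by (rule merge_prods[of 20 15 "[]" "[23, 13]" "[9, 11, 21]" 4]) simp_all
  finally have left: "?lhs = ?nf" .
  have "?rhs = ?run [Cop 1 [11, 12], Ap T 12 13, Mul [13, 9, 11] 30, LAct 2 1 4, Ev 4 30]"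
    by (rule expand_LAct[of 4 5 1 9 11 12 13 30 1]) simp_all
  also have "\<dots> = ?run [Cop 1 [11, 12], Ap T 12 13, Cop 2 [21, 22], Ap T 22 23, Mul [13, 9, 11] 30,
    Mul [23, 30, 21] 20, Ev 1 20]"
    by (rule expand_LAct[of 1 4 2 30 21 22 23 20 3]) simp_all
  also have "\<dots> = ?nf"
    by (rule merge_prods[of 20 30 "[23]" "[13, 9, 11]" "[21]" 4]) simp_all
  finally have right: "?rhs = ?nf" .
  show ?thesis unfolding left right ..
qed

lemma left_action_unit_circuit:
  "run [Mul [] 3, LAct 3 1 5, Ev 5 9] [] [dw 1, hw 9]
    = run [Ev 1 9] [] [dw 1, hw 9]"
  (is "?lhs = ?rhs")
proof -
  let ?run = "\<lambda>gl. run gl [] [dw 1, hw 9]"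
  have "?lhs = ?run [Mul [] 3, Cop 3 [10, 14], Ap T 14 15, Mul [15, 9, 10] 20, Ev 1 20]"
    by (rule expand_LAct[of 1 5 3 9 10 14 15 20 1]) simp_all
  also have "\<dots> = ?run [Mul [] 14, Ap T 14 15, Mul [] 10, Mul [15, 9, 10] 20, Ev 1 20]"
    by (rule run_step[OF eqv_unit_comult[of 3 10 14], of 0]) simp_all
  also have "\<dots> = ?run [Mul [] 15, Mul [] 10, Mul [15, 9, 10] 20, Ev 1 20]"
    by (rule run_step[OF eqv_T_unit[of 14 15], of 0]) simp_all
  also have "\<dots> = ?run [Mul [] 15, Mul [15, 9] 20, Ev 1 20]"
    by (rule merge_prods[of 20 10 "[15, 9]" "[]" "[]" 1]) simp_all
  also have "\<dots> = ?run [Mul [9] 20, Ev 1 20]"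
    by (rule merge_prods[of 20 15 "[]" "[]" "[9]" 0]) simp_all
  also have "\<dots> = ?rhs"
    by (rule run_step[OF eqv_prod_ev[of 9 20 1], of 0]) simp_all
  finally show ?thesis .
qed

text \<open>For test arguments x and y the right side becomes f(T(h4) y h3 T(h2) x h1), where h3
  T(h2) cancels.\<close>

lemma left_action_comult_circuit:
  "run [LAct 1 1 5, DCop 5 6 7, Ev 7 9, Ev 6 8] [] [hw 1, dw 1, hw 9, hw 8]
    = run [Cop 1 [2, 3], DCop 1 2 3, LAct 2 2 6, LAct 3 3 7, Ev 7 9, Ev 6 8] [] [hw 1, dw 1, hw 9, hw 8]"
  (is "?lhs = ?rhs")
proof -
  let ?run = "\<lambda>gl. run gl [] [hw 1, dw 1, hw 9, hw 8]"
  let ?nf = "run [Cop 1 [11, 12], Ap T 12 13, Mul [13, 9, 8, 11] 21, Ev 1 21] [] [hw 1, dw 1, hw 9, hw 8]"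
  have "?lhs = ?run [LAct 1 1 5, DCop 5 6 7, Ev 6 8, Ev 7 9]"
    by (rule run_mset) simp_all
  also have "\<dots> = ?run [Mul [9, 8] 20, LAct 1 1 5, Ev 5 20]"
    by (rule expand_DCop[of 5 6 7 8 9 20 1]) simp_all
  also have "\<dots> = ?run [Cop 1 [11, 12], Ap T 12 13, Mul [9, 8] 20, Mul [13, 20, 11] 21, Ev 1 21]"
    by (rule expand_LAct[of 1 5 1 20 11 12 13 21 1]) simp_all
  also have "\<dots> = ?nf"
    by (rule merge_prods[of 21 20 "[13]" "[9, 8]" "[11]" 2]) simp_all
  finally have left: "?lhs = ?nf" .
  have "?rhs = ?run [Cop 1 [2, 3], DCop 1 2 3, LAct 2 2 6, Ev 6 8, LAct 3 3 7, Ev 7 9]"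
    by (rule run_mset) simp_all
  also have "\<dots> = ?run [Cop 1 [2, 3], DCop 1 2 3, LAct 3 3 7, Ev 7 9, Cop 2 [11, 14], Ap T 14 15,
    Mul [15, 8, 11] 22, Ev 2 22]"
    by (rule expand_LAct[of 2 6 2 8 11 14 15 22 2]) simp_all
  also have "\<dots> = ?run [Cop 1 [2, 3], Cop 3 [16, 12], Ap T 12 13, Mul [13, 9, 16] 23, Cop 2 [11, 14],
    Ap T 14 15, Mul [15, 8, 11] 22, DCop 1 2 3, Ev 2 22, Ev 3 23]"
    by (rule expand_LAct[of 3 7 3 9 16 12 13 23 2]) simp_all
  also have "\<dots> = ?run [Cop 1 [2, 3], Cop 2 [11, 14], Cop 3 [16, 12], Ap T 12 13, Mul [13, 9, 16] 23,
    Ap T 14 15, Mul [15, 8, 11] 22, Mul [23, 22] 21, Ev 1 21]"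
    by (rule expand_DCop[of 1 2 3 22 23 21 7]) simp_all
  also have "\<dots> = ?run [Cop 1 [11, 14, 3], Cop 3 [16, 12], Ap T 12 13, Mul [13, 9, 16] 23, Ap T 14 15,
    Mul [15, 8, 11] 22, Mul [23, 22] 21, Ev 1 21]"
    by (rule merge_cops[of 1 2 "[]" "[11, 14]" "[3]" 0]) simp_all
  also have "\<dots> = ?run [Cop 1 [11, 14, 16, 12], Ap T 12 13, Mul [13, 9, 16] 23, Ap T 14 15,
    Mul [15, 8, 11] 22, Mul [23, 22] 21, Ev 1 21]"
    by (rule merge_cops[of 1 3 "[11, 14]" "[16, 12]" "[]" 0]) simp_all
  also have "\<dots> = ?run [Cop 1 [11, 14, 16, 12], Ap T 12 13, Ap T 14 15, Mul [13, 9, 16] 23,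
    Mul [23, 15, 8, 11] 21, Ev 1 21]"
    by (rule merge_prods[of 21 22 "[23]" "[15, 8, 11]" "[]" 4]) simp_all
  also have "\<dots> = ?run [Cop 1 [11, 14, 16, 12], Ap T 14 15, Ap T 12 13, Mul [13, 9, 16, 15, 8, 11] 21,
    Ev 1 21]"
    by (rule merge_prods[of 21 23 "[]" "[13, 9, 16]" "[15, 8, 11]" 3]) simp_all
  also have "\<dots> = ?nf"
    by (rule cancel_mid[of 14 16 15 1 21 "[11]" "[12]" "[13, 9]" "[8, 11]" 0 _ 1]) simp_all
  finally have right: "?rhs = ?nf" .
  show ?thesis unfolding left right ..
qed

text \<open>The counit of the dual tests at the unit, which leaves f(T(h2) h1).\<close>

lemma left_action_counit_circuit:
  "run [LAct 1 1 5, Mul [] 9, Ev 5 9] [] [hw 1, dw 1]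
    = run [Cop 1 [], Mul [] 20, Ev 1 20] [] [hw 1, dw 1]"
  (is "?lhs = ?rhs")
proof -
  let ?run = "\<lambda>gl. run gl [] [hw 1, dw 1]"
  have "?lhs = ?run [Mul [] 9, LAct 1 1 5, Ev 5 9]"
    by (rule run_mset) simp_all
  also have "\<dots> = ?run [Cop 1 [11, 12], Ap T 12 13, Mul [] 9, Mul [13, 9, 11] 20, Ev 1 20]"
    by (rule expand_LAct[of 1 5 1 9 11 12 13 20 1]) simp_all
  also have "\<dots> = ?run [Cop 1 [11, 12], Ap T 12 13, Mul [13, 11] 20, Ev 1 20]"
    by (rule merge_prods[of 20 9 "[13]" "[]" "[11]" 2]) simp_all
  also have "\<dots> = ?rhs"
    by (rule cancel_out[of 11 12 13 1 20 "[]" "[]" "[]" "[]" 0 _ 0]) simp_all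
  finally show ?thesis .
qed

text \<open>Both sides are h3 f(T(h5) h1) g(T(h4) h2). On the left this comes from the coproduct of
  T(h3) h1, where \<open>T\<close> reverses the two legs; on the right from nested
  coproducts.\<close>

lemma right_action_mult_circuit:
  "run [DMul 1 2 3, RAct 1 3 2] [hw 2] [hw 1, dw 1, dw 2]
    = run [RAct 1 1 4, RAct 4 2 2] [hw 2] [hw 1, dw 1, dw 2]"
  (is "?lhs = ?rhs")
proof -
  let ?run = "\<lambda>gl. run gl [hw 2] [hw 1, dw 1, dw 2]"
  let ?nf = "run [Cop 1 [33, 34, 2, 35, 36], Ap T 36 31, Ap T 35 32, Mul [31, 33] 21,
    Mul [32, 34] 22, Ev 1 21, Ev 2 22] [hw 2] [hw 1, dw 1, dw 2]"
  have "?lhs = ?run [Cop 1 [11, 2, 12], Ap T 12 13, Mul [13, 11] 20, DMul 1 2 3, Ev 3 20]"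
    by (rule expand_RAct[of 1 2 11 12 13 20 3 1]) simp_all
  also have "\<dots> = ?run [Cop 1 [11, 2, 12], Ap T 12 13, Mul [13, 11] 20, Cop 20 [21, 22], Ev 1 21,
    Ev 2 22]"
    by (rule expand_DMul[of 1 2 3 20 21 22 3]) simp_all
  also have "\<dots> = ?run [Cop 1 [11, 2, 12], Ap T 12 13, Cop 13 [31, 32], Cop 11 [33, 34],
    Mul [31, 33] 21, Mul [32, 34] 22, Ev 1 21, Ev 2 22]"
    by (rule expand_bialg[of 13 11 20 21 22 31 32 33 34 2]) simp_all
  also have "\<dots> = ?run [Cop 1 [11, 2, 12], Cop 11 [33, 34], Cop 12 [35, 36], Ap T 36 31, Ap T 35 32,
    Mul [31, 33] 21, Mul [32, 34] 22, Ev 1 21, Ev 2 22]"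
    by (rule run_step[OF eqv_T_cop[of 12 13 31 32 35 36], of 1]) simp_all
  also have "\<dots> = ?run [Cop 1 [33, 34, 2, 12], Cop 12 [35, 36], Ap T 36 31, Ap T 35 32,
    Mul [31, 33] 21, Mul [32, 34] 22, Ev 1 21, Ev 2 22]"
    by (rule merge_cops[of 1 11 "[]" "[33, 34]" "[2, 12]" 0]) simp_all
  also have "\<dots> = ?nf"
    by (rule merge_cops[of 1 12 "[33, 34, 2]" "[35, 36]" "[]" 0]) simp_all
  finally have left: "?lhs = ?nf" .
  have "?rhs = ?run [Cop 1 [33, 4, 36], RAct 4 2 2, Ap T 36 31, Mul [31, 33] 21, Ev 1 21]"
    by (rule expand_RAct[of 1 4 33 36 31 21 1 0]) simp_all
  also have "\<dots> = ?run [Cop 1 [33, 4, 36], Cop 4 [34, 2, 35], Ap T 35 32, Mul [32, 34] 22, Ev 2 22,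
    Ap T 36 31, Mul [31, 33] 21, Ev 1 21]"
    by (rule expand_RAct[of 4 2 34 35 32 22 2 1]) simp_all
  also have "\<dots> = ?nf"
    by (rule merge_cops[of 1 4 "[33]" "[34, 2, 35]" "[36]" 0]) simp_all
  finally have right: "?rhs = ?nf" .
  show ?thesis unfolding left right ..
qed

lemma right_action_unit_circuit:
  "run [DUnit 3, RAct 1 3 2] [hw 2] [hw 1]
    = run [Cop 1 [2]] [hw 2] [hw 1]"
  (is "?lhs = ?rhs")
proof -
  let ?run = "\<lambda>gl. run gl [hw 2] [hw 1]"
  have "?lhs = ?run [Cop 1 [11, 2, 12], Ap T 12 13, Mul [13, 11] 20, DUnit 3, Ev 3 20]"
    by (rule expand_RAct[of 1 2 11 12 13 20 3 1]) simp_all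
  also have "\<dots> = ?run [Cop 1 [11, 2, 12], Ap T 12 13, Mul [13, 11] 20, Cop 20 []]"
    by (rule run_step[OF eqv_DUnit[of 20 3], of 3]) simp_all
  also have "\<dots> = ?run [Cop 1 [11, 2, 12], Ap T 12 13, Cop 13 [], Cop 11 []]"
    by (rule run_step[OF eqv_mult_counit[of 13 11 20], of 2]) simp_all
  also have "\<dots> = ?run [Cop 1 [11, 2, 12], Cop 11 [], Cop 12 []]"
    by (rule run_step[OF eqv_T_counit[of 12 13], of 1]) simp_all
  also have "\<dots> = ?run [Cop 1 [2, 12], Cop 12 []]"
    by (rule merge_cops[of 1 11 "[]" "[]" "[2, 12]" 0]) simp_all
  also have "\<dots> = ?rhs"
    by (rule merge_cops[of 1 12 "[2]" "[]" "[]" 0]) simp_all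
  finally show ?thesis .
qed

text \<open>The right side has outputs h2, h5 and scalar f(T(h6) h4 T(h3) h1); cancelling h4 T(h3)
  leaves outputs h2, h3 and scalar f(T(h4) h1).\<close>

lemma right_action_comult_circuit:
  "run [RAct 1 1 5, Cop 5 [6, 7]] [hw 6, hw 7] [hw 1, dw 1]
    = run [Cop 1 [2, 3], DCop 1 2 3, RAct 2 2 6, RAct 3 3 7] [hw 6, hw 7] [hw 1, dw 1]"
  (is "?lhs = ?rhs")
proof -
  let ?run = "\<lambda>gl. run gl [hw 6, hw 7] [hw 1, dw 1]"
  let ?nf = "run [Cop 1 [11, 6, 7, 12], Ap T 12 13, Mul [13, 11] 20, Ev 1 20] [hw 6, hw 7] [hw 1, dw 1]"
  have "?lhs = ?run [Cop 1 [11, 5, 12], Cop 5 [6, 7], Ap T 12 13, Mul [13, 11] 20, Ev 1 20]"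
    by (rule expand_RAct[of 1 5 11 12 13 20 1 0]) simp_all
  also have "\<dots> = ?nf"
    by (rule merge_cops[of 1 5 "[11]" "[6, 7]" "[12]" 0]) simp_all
  finally have left: "?lhs = ?nf" .
  have "?rhs = ?run [Cop 1 [2, 3], DCop 1 2 3, RAct 3 3 7, Cop 2 [11, 6, 14], Ap T 14 15,
    Mul [15, 11] 21, Ev 2 21]"
    by (rule expand_RAct[of 2 6 11 14 15 21 2 2]) simp_all
  also have "\<dots> = ?run [Cop 1 [2, 3], Cop 3 [16, 7, 12], Ap T 12 13, Mul [13, 16] 22,
    Cop 2 [11, 6, 14], Ap T 14 15, Mul [15, 11] 21, DCop 1 2 3, Ev 2 21, Ev 3 22]"
    by (rule expand_RAct[of 3 7 16 12 13 22 3 2]) simp_all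
  also have "\<dots> = ?run [Cop 1 [2, 3], Cop 2 [11, 6, 14], Cop 3 [16, 7, 12], Ap T 12 13,
    Mul [13, 16] 22, Ap T 14 15, Mul [15, 11] 21, Mul [22, 21] 20, Ev 1 20]"
    by (rule expand_DCop[of 1 2 3 21 22 20 7]) simp_all
  also have "\<dots> = ?run [Cop 1 [11, 6, 14, 3], Cop 3 [16, 7, 12], Ap T 12 13, Mul [13, 16] 22,
    Ap T 14 15, Mul [15, 11] 21, Mul [22, 21] 20, Ev 1 20]"
    by (rule merge_cops[of 1 2 "[]" "[11, 6, 14]" "[3]" 0]) simp_all
  also have "\<dots> = ?run [Cop 1 [11, 6, 14, 16, 7, 12], Ap T 12 13, Mul [13, 16] 22, Ap T 14 15,
    Mul [15, 11] 21, Mul [22, 21] 20, Ev 1 20]"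
    by (rule merge_cops[of 1 3 "[11, 6, 14]" "[16, 7, 12]" "[]" 0]) simp_all
  also have "\<dots> = ?run [Cop 1 [11, 6, 14, 16, 7, 12], Ap T 12 13, Ap T 14 15, Mul [13, 16] 22,
    Mul [22, 15, 11] 20, Ev 1 20]"
    by (rule merge_prods[of 20 21 "[22]" "[15, 11]" "[]" 4]) simp_all
  also have "\<dots> = ?run [Cop 1 [11, 6, 14, 16, 7, 12], Ap T 14 15, Ap T 12 13, Mul [13, 16, 15, 11] 20,
    Ev 1 20]"
    by (rule merge_prods[of 20 22 "[]" "[13, 16]" "[15, 11]" 3]) simp_all
  also have "\<dots> = ?nf"
    by (rule cancel_mid[of 14 16 15 1 20 "[11, 6]" "[7, 12]" "[13]" "[11]" 0 _ 1]) simp_all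
  finally have right: "?rhs = ?nf" .
  show ?thesis unfolding left right ..
qed

lemma right_action_counit_circuit:
  "run [RAct 1 1 5, Cop 5 []] [] [hw 1, dw 1]
    = run [Cop 1 [], Mul [] 20, Ev 1 20] [] [hw 1, dw 1]"
  (is "?lhs = ?rhs")
proof -
  let ?run = "\<lambda>gl. run gl [] [hw 1, dw 1]"
  have "?lhs = ?run [Cop 1 [11, 5, 12], Cop 5 [], Ap T 12 13, Mul [13, 11] 20, Ev 1 20]"
    by (rule expand_RAct[of 1 5 11 12 13 20 1 0]) simp_all
  also have "\<dots> = ?run [Cop 1 [11, 12], Ap T 12 13, Mul [13, 11] 20, Ev 1 20]"
    by (rule merge_cops[of 1 5 "[11]" "[]" "[12]" 0]) simp_all
  also have "\<dots> = ?rhs"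
    by (rule cancel_out[of 11 12 13 1 20 "[]" "[]" "[]" "[]" 0 _ 0]) simp_all
  finally show ?thesis .
qed

text \<open>The left side is f(T(h4) x1 h1) g(T(h3) x2 h2), since \<open>T\<close> reverses legs in
  the coproduct of T(h2) x h1. The right side is f(T(h6) h3 T(h2) x1 h1) g(T(h5) x2 h4), where h3
  T(h2) cancels.\<close>

lemma left_action_dual_mult_circuit:
  "run [DMul 1 2 3, LAct 1 3 4, Ev 4 9] [] [hw 1, dw 1, dw 2, hw 9]
    = run [Cop 1 [2, 3], DCop 1 5 6, LAct 2 5 7, RAct 3 6 4, LAct 4 2 8, DMul 7 8 10,
    Ev 10 9] [] [hw 1, dw 1, dw 2, hw 9]"
  (is "?lhs = ?rhs")
proof -
  let ?run = "\<lambda>gl. run gl [] [hw 1, dw 1, dw 2, hw 9]"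
  let ?nf = "run [Cop 1 [26, 27, 32, 33], Ap T 33 28, Ap T 32 29, Cop 9 [30, 31],
    Mul [29, 31, 27] 22, Mul [28, 30, 26] 21, Ev 1 21, Ev 2 22] [] [hw 1, dw 1, dw 2, hw 9]"
  have "?lhs = ?run [Cop 1 [11, 12], Ap T 12 13, Mul [13, 9, 11] 20, DMul 1 2 3, Ev 3 20]"
    by (rule expand_LAct[of 3 4 1 9 11 12 13 20 1]) simp_all
  also have "\<dots> = ?run [Cop 1 [11, 12], Ap T 12 13, Mul [13, 9, 11] 20, Cop 20 [21, 22], Ev 1 21,
    Ev 2 22]"
    by (rule expand_DMul[of 1 2 3 20 21 22 3]) simp_all
  also have "\<dots> = ?run [Cop 1 [11, 12], Ap T 12 13, Mul [13, 9] 23, Mul [23, 11] 20, Cop 20 [21, 22],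
    Ev 1 21, Ev 2 22]"
    by (rule split_prods[of 20 23 "[]" "[13, 9]" "[11]" 2]) simp_all
  also have "\<dots> = ?run [Cop 1 [11, 12], Ap T 12 13, Mul [13, 9] 23, Cop 23 [24, 25], Cop 11 [26, 27],
    Mul [24, 26] 21, Mul [25, 27] 22, Ev 1 21, Ev 2 22]"
    by (rule expand_bialg[of 23 11 20 21 22 24 25 26 27 3]) simp_all
  also have "\<dots> = ?run [Cop 1 [11, 12], Ap T 12 13, Cop 13 [28, 29], Cop 9 [30, 31], Cop 11 [26, 27],
    Mul [28, 30] 24, Mul [24, 26] 21, Mul [29, 31] 25, Mul [25, 27] 22, Ev 1 21,
    Ev 2 22]"
    by (rule expand_bialg[of 13 9 23 24 25 28 29 30 31 2]) simp_all
  also have "\<dots> = ?run [Cop 1 [11, 12], Ap T 12 13, Cop 13 [28, 29], Cop 9 [30, 31], Cop 11 [26, 27],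
    Mul [29, 31] 25, Mul [25, 27] 22, Mul [28, 30, 26] 21, Ev 1 21, Ev 2 22]"
    by (rule merge_prods[of 21 24 "[]" "[28, 30]" "[26]" 5]) simp_all
  also have "\<dots> = ?run [Cop 1 [11, 12], Ap T 12 13, Cop 13 [28, 29], Cop 9 [30, 31], Cop 11 [26, 27],
    Mul [29, 31, 27] 22, Mul [28, 30, 26] 21, Ev 1 21, Ev 2 22]"
    by (rule merge_prods[of 22 25 "[]" "[29, 31]" "[27]" 5]) simp_all
  also have "\<dots> = ?run [Cop 1 [11, 12], Cop 11 [26, 27], Cop 12 [32, 33], Ap T 33 28, Ap T 32 29,
    Cop 9 [30, 31], Mul [29, 31, 27] 22, Mul [28, 30, 26] 21, Ev 1 21, Ev 2 22]"
    by (rule run_step[OF eqv_T_cop[of 12 13 28 29 32 33], of 1]) simp_all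
  also have "\<dots> = ?run [Cop 1 [26, 27, 12], Cop 12 [32, 33], Ap T 33 28, Ap T 32 29, Cop 9 [30, 31],
    Mul [29, 31, 27] 22, Mul [28, 30, 26] 21, Ev 1 21, Ev 2 22]"
    by (rule merge_cops[of 1 11 "[]" "[26, 27]" "[12]" 0]) simp_all
  also have "\<dots> = ?nf"
    by (rule merge_cops[of 1 12 "[26, 27]" "[32, 33]" "[]" 0]) simp_all
  finally have left: "?lhs = ?nf" .
  have "?rhs = ?run [Cop 1 [2, 3], DCop 1 5 6, Cop 9 [30, 31], LAct 2 5 7, Ev 7 30, RAct 3 6 4,
    LAct 4 2 8, Ev 8 31]"
    by (rule expand_DMul[of 7 8 10 9 30 31 5]) simp_all
  also have "\<dots> = ?run [Cop 1 [2, 3], DCop 1 5 6, RAct 3 6 4, Cop 9 [30, 31], Cop 2 [26, 40],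
    Ap T 40 41, Mul [41, 30, 26] 42, Ev 5 42, LAct 4 2 8, Ev 8 31]"
    by (rule expand_LAct[of 5 7 2 30 26 40 41 42 3]) simp_all
  also have "\<dots> = ?run [Cop 1 [2, 3], Cop 3 [43, 4, 33], Cop 9 [30, 31], LAct 4 2 8, Ev 8 31,
    DCop 1 5 6, Ap T 33 28, Mul [28, 43] 44, Ev 6 44, Cop 2 [26, 40], Ap T 40 41,
    Mul [41, 30, 26] 42, Ev 5 42]"
    by (rule expand_RAct[of 3 4 43 33 28 44 6 2]) simp_all
  also have "\<dots> = ?run [Cop 1 [2, 3], Cop 3 [43, 4, 33], Cop 9 [30, 31], Ap T 33 28, Mul [28, 43] 44,
    Cop 2 [26, 40], Ap T 40 41, Mul [41, 30, 26] 42, DCop 1 5 6, Ev 5 42, Ev 6 44,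
    Cop 4 [27, 32], Ap T 32 29, Mul [29, 31, 27] 22, Ev 2 22]"
    by (rule expand_LAct[of 2 8 4 31 27 32 29 22 3]) simp_all
  also have "\<dots> = ?run [Cop 1 [2, 3], Cop 2 [26, 40], Cop 3 [43, 4, 33], Cop 9 [30, 31], Ap T 33 28,
    Mul [28, 43] 44, Ap T 40 41, Mul [41, 30, 26] 42, Mul [44, 42] 21, Ev 1 21,
    Cop 4 [27, 32], Ap T 32 29, Mul [29, 31, 27] 22, Ev 2 22]"
    by (rule expand_DCop[of 1 5 6 42 44 21 8]) simp_all
  also have "\<dots> = ?run [Cop 1 [26, 40, 3], Cop 3 [43, 4, 33], Cop 9 [30, 31], Ap T 33 28,
    Mul [28, 43] 44, Ap T 40 41, Mul [41, 30, 26] 42, Mul [44, 42] 21, Ev 1 21,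
    Cop 4 [27, 32], Ap T 32 29, Mul [29, 31, 27] 22, Ev 2 22]"
    by (rule merge_cops[of 1 2 "[]" "[26, 40]" "[3]" 0]) simp_all
  also have "\<dots> = ?run [Cop 1 [26, 40, 43, 4, 33], Cop 4 [27, 32], Cop 9 [30, 31], Ap T 33 28,
    Mul [28, 43] 44, Ap T 40 41, Mul [41, 30, 26] 42, Mul [44, 42] 21, Ev 1 21,
    Ap T 32 29, Mul [29, 31, 27] 22, Ev 2 22]"
    by (rule merge_cops[of 1 3 "[26, 40]" "[43, 4, 33]" "[]" 0]) simp_all
  also have "\<dots> = ?run [Cop 1 [26, 40, 43, 27, 32, 33], Cop 9 [30, 31], Ap T 33 28, Mul [28, 43] 44,
    Ap T 40 41, Mul [41, 30, 26] 42, Mul [44, 42] 21, Ev 1 21, Ap T 32 29,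
    Mul [29, 31, 27] 22, Ev 2 22]"
    by (rule merge_cops[of 1 4 "[26, 40, 43]" "[27, 32]" "[33]" 0]) simp_all
  also have "\<dots> = ?run [Cop 1 [26, 40, 43, 27, 32, 33], Cop 9 [30, 31], Ap T 33 28, Ap T 40 41,
    Mul [28, 43] 44, Mul [44, 41, 30, 26] 21, Ev 1 21, Ap T 32 29,
    Mul [29, 31, 27] 22, Ev 2 22]"
    by (rule merge_prods[of 21 42 "[44]" "[41, 30, 26]" "[]" 5]) simp_all
  also have "\<dots> = ?run [Cop 1 [26, 40, 43, 27, 32, 33], Ap T 40 41, Cop 9 [30, 31], Ap T 33 28,
    Mul [28, 43, 41, 30, 26] 21, Ev 1 21, Ap T 32 29, Mul [29, 31, 27] 22, Ev 2 22]"
    by (rule merge_prods[of 21 44 "[]" "[28, 43]" "[41, 30, 26]" 4]) simp_all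
  also have "\<dots> = ?nf"
    by (rule cancel_mid[of 40 43 41 1 21 "[26]" "[27, 32, 33]" "[28]" "[30, 26]" 0 _ 2]) simp_all
  finally have right: "?rhs = ?nf" .
  show ?thesis unfolding left right ..
qed

text \<open>For inputs x, y the left side is x2 y2 f(T(y3) T(x3) x1 y1). The right side is x2 y4
  f(T(y5) y3 T(y2) T(x3) x1 y1), where y3 T(y2) cancels.\<close>

lemma right_action_mult_left_circuit:
  "run [Mul [1, 2] 4, RAct 4 1 3] [hw 3] [hw 1, hw 2, dw 1]
    = run [Cop 2 [4, 5], DCop 1 2 3, LAct 4 2 4, RAct 5 3 23, RAct 1 4 13, Mul [13, 23] 3] [hw 3] [hw 1, hw 2, dw 1]"
  (is "?lhs = ?rhs")
proof -
  let ?run = "\<lambda>gl. run gl [hw 3] [hw 1, hw 2, dw 1]"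
  let ?nf = "run [Cop 2 [21, 23, 24], Cop 1 [11, 13, 14], Ap T 14 15, Ap T 24 25,
    Mul [25, 15, 11, 21] 20, Mul [13, 23] 3, Ev 1 20] [hw 3] [hw 1, hw 2, dw 1]"
  have "?lhs = ?run [Mul [1, 2] 4, Cop 4 [5, 3, 6], Ap T 6 7, Mul [7, 5] 20, Ev 1 20]"
    by (rule expand_RAct[of 4 3 5 6 7 20 1 1]) simp_all
  also have "\<dots> = ?run [Mul [1, 2] 4, Cop 4 [5, 8], Cop 8 [3, 6], Ap T 6 7, Mul [7, 5] 20, Ev 1 20]"
    by (rule split_cops[of 4 8 "[5]" "[3, 6]" "[]" 1]) simp_all
  also have "\<dots> = ?run [Cop 1 [11, 12], Cop 2 [21, 22], Mul [12, 22] 8, Cop 8 [3, 6], Mul [11, 21] 5,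
    Ap T 6 7, Mul [7, 5] 20, Ev 1 20]"
    by (rule expand_bialg[of 1 2 4 5 8 11 12 21 22 0]) simp_all
  also have "\<dots> = ?run [Cop 1 [11, 12], Cop 2 [21, 22], Cop 12 [13, 14], Cop 22 [23, 24],
    Mul [14, 24] 6, Ap T 6 7, Mul [13, 23] 3, Mul [11, 21] 5, Mul [7, 5] 20, Ev 1 20]"
    by (rule expand_bialg[of 12 22 8 3 6 13 14 23 24 2]) simp_all
  also have "\<dots> = ?run [Cop 1 [11, 12], Cop 12 [13, 14], Cop 2 [21, 22], Cop 22 [23, 24], Ap T 14 15,
    Ap T 24 25, Mul [25, 15] 7, Mul [13, 23] 3, Mul [11, 21] 5, Mul [7, 5] 20,
    Ev 1 20]"
    by (rule run_step[OF eqv_T_prod[of 14 24 6 7 15 25], of 4]) simp_all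
  also have "\<dots> = ?run [Cop 2 [21, 22], Cop 22 [23, 24], Cop 1 [11, 13, 14], Ap T 14 15, Ap T 24 25,
    Mul [25, 15] 7, Mul [13, 23] 3, Mul [11, 21] 5, Mul [7, 5] 20, Ev 1 20]"
    by (rule merge_cops[of 1 12 "[11]" "[13, 14]" "[]" 0]) simp_all
  also have "\<dots> = ?run [Cop 2 [21, 23, 24], Cop 1 [11, 13, 14], Ap T 14 15, Ap T 24 25, Mul [25, 15] 7,
    Mul [11, 21] 5, Mul [7, 5] 20, Mul [13, 23] 3, Ev 1 20]"
    by (rule merge_cops[of 2 22 "[21]" "[23, 24]" "[]" 0]) simp_all
  also have "\<dots> = ?run [Cop 2 [21, 23, 24], Cop 1 [11, 13, 14], Ap T 14 15, Ap T 24 25, Mul [25, 15] 7,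
    Mul [7, 11, 21] 20, Mul [13, 23] 3, Ev 1 20]"
    by (rule merge_prods[of 20 5 "[7]" "[11, 21]" "[]" 5]) simp_all
  also have "\<dots> = ?nf"
    by (rule merge_prods[of 20 7 "[]" "[25, 15]" "[11, 21]" 4]) simp_all
  finally have left: "?lhs = ?nf" .
  have "?rhs = ?run [Cop 2 [4, 5], DCop 1 2 3, LAct 4 2 4, RAct 1 4 13, RAct 5 3 23, Mul [13, 23] 3]"
    by (rule run_mset) simp_all
  also have "\<dots> = ?run [Cop 2 [4, 5], DCop 1 2 3, Cop 1 [11, 13, 14], Ap T 14 15, Mul [15, 11] 30,
    LAct 4 2 4, Ev 4 30, RAct 5 3 23, Mul [13, 23] 3]"
    by (rule expand_RAct[of 1 13 11 14 15 30 4 3]) simp_all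
  also have "\<dots> = ?run [Cop 2 [4, 5], DCop 1 2 3, RAct 5 3 23, Cop 1 [11, 13, 14], Ap T 14 15,
    Mul [15, 11] 30, Cop 4 [21, 31], Ap T 31 32, Mul [32, 30, 21] 33, Ev 2 33,
    Mul [13, 23] 3]"
    by (rule expand_LAct[of 2 4 4 30 21 31 32 33 5]) simp_all
  also have "\<dots> = ?run [Cop 2 [4, 5], Cop 5 [34, 23, 24], Ap T 24 25, Mul [25, 34] 35,
    Cop 1 [11, 13, 14], Ap T 14 15, Mul [15, 11] 30, Cop 4 [21, 31], Ap T 31 32,
    Mul [32, 30, 21] 33, DCop 1 2 3, Ev 2 33, Ev 3 35, Mul [13, 23] 3]"
    by (rule expand_RAct[of 5 23 34 24 25 35 3 2]) simp_all
  also have "\<dots> = ?run [Cop 2 [4, 5], Cop 4 [21, 31], Cop 5 [34, 23, 24], Ap T 24 25, Mul [25, 34] 35,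
    Cop 1 [11, 13, 14], Ap T 14 15, Mul [15, 11] 30, Ap T 31 32,
    Mul [32, 30, 21] 33, Mul [35, 33] 20, Ev 1 20, Mul [13, 23] 3]"
    by (rule expand_DCop[of 1 2 3 33 35 20 10]) simp_all
  also have "\<dots> = ?run [Cop 2 [21, 31, 5], Cop 5 [34, 23, 24], Ap T 24 25, Mul [25, 34] 35,
    Cop 1 [11, 13, 14], Ap T 14 15, Mul [15, 11] 30, Ap T 31 32,
    Mul [32, 30, 21] 33, Mul [35, 33] 20, Ev 1 20, Mul [13, 23] 3]"
    by (rule merge_cops[of 2 4 "[]" "[21, 31]" "[5]" 0]) simp_all
  also have "\<dots> = ?run [Cop 2 [21, 31, 34, 23, 24], Cop 1 [11, 13, 14], Ap T 14 15, Ap T 31 32,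
    Mul [15, 11] 30, Mul [32, 30, 21] 33, Ap T 24 25, Mul [25, 34] 35,
    Mul [35, 33] 20, Ev 1 20, Mul [13, 23] 3]"
    by (rule merge_cops[of 2 5 "[21, 31]" "[34, 23, 24]" "[]" 0]) simp_all
  also have "\<dots> = ?run [Cop 2 [21, 31, 34, 23, 24], Cop 1 [11, 13, 14], Ap T 14 15, Ap T 31 32,
    Ap T 24 25, Mul [25, 34] 35, Mul [32, 15, 11, 21] 33, Mul [35, 33] 20, Ev 1 20,
    Mul [13, 23] 3]"
    by (rule merge_prods[of 33 30 "[32]" "[15, 11]" "[21]" 4]) simp_all
  also have "\<dots> = ?run [Cop 2 [21, 31, 34, 23, 24], Cop 1 [11, 13, 14], Ap T 14 15, Ap T 31 32,
    Ap T 24 25, Mul [25, 34] 35, Mul [35, 32, 15, 11, 21] 20, Ev 1 20,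
    Mul [13, 23] 3]"
    by (rule merge_prods[of 20 33 "[35]" "[32, 15, 11, 21]" "[]" 6]) simp_all
  also have "\<dots> = ?run [Cop 2 [21, 31, 34, 23, 24], Ap T 31 32, Cop 1 [11, 13, 14], Ap T 14 15,
    Ap T 24 25, Mul [25, 34, 32, 15, 11, 21] 20, Ev 1 20, Mul [13, 23] 3]"
    by (rule merge_prods[of 20 35 "[]" "[25, 34]" "[32, 15, 11, 21]" 5]) simp_all
  also have "\<dots> = ?nf"
    by (rule cancel_mid[of 31 34 32 2 20 "[21]" "[23, 24]" "[25]" "[15, 11, 21]" 0 _ 3]) simp_all
  finally have right: "?rhs = ?nf" .
  show ?thesis unfolding left right ..
qed

text \<open>The sides are h4 f(T(h5) h3 T(h2) x h1) and h2 f(T(h5) x h4 T(h3) h1). Cancelling to the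
  left of x in one and to the right of x in the other leaves h2 f(T(h3) x h1) in both.\<close>

lemma actions_commute_circuit:
  "run [Cop 1 [3, 4], DCop 1 3 4, LAct 3 3 2, RAct 4 4 2, Ev 2 9] [hw 2] [hw 1, dw 1, hw 9]
    = run [Cop 1 [3, 4], DCop 1 3 4, RAct 3 3 2, LAct 4 4 2, Ev 2 9] [hw 2] [hw 1, dw 1, hw 9]"
  (is "?lhs = ?rhs")
proof -
  let ?run = "\<lambda>gl. run gl [hw 2] [hw 1, dw 1, hw 9]"
  let ?nf = "run [Cop 1 [11, 2, 15], Ap T 15 16, Mul [16, 9, 11] 22, Ev 1 22] [hw 2] [hw 1, dw 1, hw 9]"
  have "?lhs = ?run [Cop 1 [3, 4], DCop 1 3 4, LAct 3 3 2, Ev 2 9, RAct 4 4 2]"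
    by (rule run_mset) simp_all
  also have "\<dots> = ?run [Cop 1 [3, 4], DCop 1 3 4, RAct 4 4 2, Cop 3 [11, 12], Ap T 12 13,
    Mul [13, 9, 11] 20, Ev 3 20]"
    by (rule expand_LAct[of 3 2 3 9 11 12 13 20 2]) simp_all
  also have "\<dots> = ?run [Cop 1 [3, 4], Cop 4 [14, 2, 15], Ap T 15 16, Mul [16, 14] 21, Cop 3 [11, 12],
    Ap T 12 13, Mul [13, 9, 11] 20, DCop 1 3 4, Ev 3 20, Ev 4 21]"
    by (rule expand_RAct[of 4 2 14 15 16 21 4 2]) simp_all
  also have "\<dots> = ?run [Cop 1 [3, 4], Cop 3 [11, 12], Cop 4 [14, 2, 15], Ap T 15 16, Mul [16, 14] 21,
    Ap T 12 13, Mul [13, 9, 11] 20, Mul [21, 20] 22, Ev 1 22]"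
    by (rule expand_DCop[of 1 3 4 20 21 22 7]) simp_all
  also have "\<dots> = ?run [Cop 1 [11, 12, 4], Cop 4 [14, 2, 15], Ap T 15 16, Mul [16, 14] 21, Ap T 12 13,
    Mul [13, 9, 11] 20, Mul [21, 20] 22, Ev 1 22]"
    by (rule merge_cops[of 1 3 "[]" "[11, 12]" "[4]" 0]) simp_all
  also have "\<dots> = ?run [Cop 1 [11, 12, 14, 2, 15], Ap T 15 16, Mul [16, 14] 21, Ap T 12 13,
    Mul [13, 9, 11] 20, Mul [21, 20] 22, Ev 1 22]"
    by (rule merge_cops[of 1 4 "[11, 12]" "[14, 2, 15]" "[]" 0]) simp_all
  also have "\<dots> = ?run [Cop 1 [11, 12, 14, 2, 15], Ap T 15 16, Ap T 12 13, Mul [16, 14] 21,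
    Mul [21, 13, 9, 11] 22, Ev 1 22]"
    by (rule merge_prods[of 22 20 "[21]" "[13, 9, 11]" "[]" 4]) simp_all
  also have "\<dots> = ?run [Cop 1 [11, 12, 14, 2, 15], Ap T 12 13, Ap T 15 16, Mul [16, 14, 13, 9, 11] 22,
    Ev 1 22]"
    by (rule merge_prods[of 22 21 "[]" "[16, 14]" "[13, 9, 11]" 3]) simp_all
  also have "\<dots> = ?nf"
    by (rule cancel_mid[of 12 14 13 1 22 "[11]" "[2, 15]" "[16]" "[9, 11]" 0 _ 1]) simp_all
  finally have left: "?lhs = ?nf" .
  have "?rhs = ?run [Cop 1 [3, 4], DCop 1 3 4, LAct 4 4 2, Ev 2 9, Cop 3 [11, 2, 12], Ap T 12 13,
    Mul [13, 11] 20, Ev 3 20]"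
    by (rule expand_RAct[of 3 2 11 12 13 20 3 2]) simp_all
  also have "\<dots> = ?run [Cop 1 [3, 4], Cop 4 [14, 15], Ap T 15 16, Mul [16, 9, 14] 21,
    Cop 3 [11, 2, 12], Ap T 12 13, Mul [13, 11] 20, DCop 1 3 4, Ev 3 20, Ev 4 21]"
    by (rule expand_LAct[of 4 2 4 9 14 15 16 21 2]) simp_all
  also have "\<dots> = ?run [Cop 1 [3, 4], Cop 3 [11, 2, 12], Cop 4 [14, 15], Ap T 15 16,
    Mul [16, 9, 14] 21, Ap T 12 13, Mul [13, 11] 20, Mul [21, 20] 22, Ev 1 22]"
    by (rule expand_DCop[of 1 3 4 20 21 22 7]) simp_all
  also have "\<dots> = ?run [Cop 1 [11, 2, 12, 4], Cop 4 [14, 15], Ap T 15 16, Mul [16, 9, 14] 21,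
    Ap T 12 13, Mul [13, 11] 20, Mul [21, 20] 22, Ev 1 22]"
    by (rule merge_cops[of 1 3 "[]" "[11, 2, 12]" "[4]" 0]) simp_all
  also have "\<dots> = ?run [Cop 1 [11, 2, 12, 14, 15], Ap T 15 16, Mul [16, 9, 14] 21, Ap T 12 13,
    Mul [13, 11] 20, Mul [21, 20] 22, Ev 1 22]"
    by (rule merge_cops[of 1 4 "[11, 2, 12]" "[14, 15]" "[]" 0]) simp_all
  also have "\<dots> = ?run [Cop 1 [11, 2, 12, 14, 15], Ap T 15 16, Ap T 12 13, Mul [16, 9, 14] 21,
    Mul [21, 13, 11] 22, Ev 1 22]"
    by (rule merge_prods[of 22 20 "[21]" "[13, 11]" "[]" 4]) simp_all
  also have "\<dots> = ?run [Cop 1 [11, 2, 12, 14, 15], Ap T 12 13, Ap T 15 16, Mul [16, 9, 14, 13, 11] 22,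
    Ev 1 22]"
    by (rule merge_prods[of 22 21 "[]" "[16, 9, 14]" "[13, 11]" 3]) simp_all
  also have "\<dots> = ?nf"
    by (rule cancel_mid[of 12 14 13 1 22 "[11, 2]" "[15]" "[16, 9]" "[11]" 0 _ 1]) simp_all
  finally have right: "?rhs = ?nf" .
  show ?thesis unfolding left right ..
qed

text \<open>The unit of the dual is the counit of \<open>H\<close>, and \<epsilon>(T(h2) x h1)
  splits into counits.\<close>

lemma left_action_dual_unit_circuit:
  "run [DUnit 1, LAct 1 1 2, Ev 2 9] [] [hw 1, hw 9]
    = run [Cop 1 [], DUnit 2, Ev 2 9] [] [hw 1, hw 9]"
  (is "?lhs = ?rhs")
proof -
  let ?run = "\<lambda>gl. run gl [] [hw 1, hw 9]"
  let ?nf = "run [Cop 1 [], Cop 9 []] [] [hw 1, hw 9]"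
  have "?lhs = ?run [Cop 1 [11, 12], Ap T 12 13, Mul [13, 9, 11] 20, DUnit 1, Ev 1 20]"
    by (rule expand_LAct[of 1 2 1 9 11 12 13 20 1]) simp_all
  also have "\<dots> = ?run [Cop 1 [11, 12], Ap T 12 13, Mul [13, 9, 11] 20, Cop 20 []]"
    by (rule run_step[OF eqv_DUnit[of 20 1], of 3]) simp_all
  also have "\<dots> = ?run [Cop 1 [11, 12], Ap T 12 13, Mul [13, 9] 21, Mul [21, 11] 20, Cop 20 []]"
    by (rule split_prods[of 20 21 "[]" "[13, 9]" "[11]" 2]) simp_all
  also have "\<dots> = ?run [Cop 1 [11, 12], Ap T 12 13, Mul [13, 9] 21, Cop 21 [], Cop 11 []]"
    by (rule run_step[OF eqv_mult_counit[of 21 11 20], of 3]) simp_all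
  also have "\<dots> = ?run [Cop 1 [11, 12], Ap T 12 13, Cop 13 [], Cop 9 [], Cop 11 []]"
    by (rule run_step[OF eqv_mult_counit[of 13 9 21], of 2]) simp_all
  also have "\<dots> = ?run [Cop 1 [11, 12], Cop 11 [], Cop 12 [], Cop 9 []]"
    by (rule run_step[OF eqv_T_counit[of 12 13], of 1]) simp_all
  also have "\<dots> = ?run [Cop 1 [12], Cop 12 [], Cop 9 []]"
    by (rule merge_cops[of 1 11 "[]" "[]" "[12]" 0]) simp_all
  also have "\<dots> = ?nf"
    by (rule merge_cops[of 1 12 "[]" "[]" "[]" 0]) simp_all
  finally have left: "?lhs = ?nf" .
  have "?rhs = ?run [DUnit 2, Ev 2 9, Cop 1 []]"
    by (rule run_mset) simp_all
  also have "\<dots> = ?nf"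
    by (rule run_step[OF eqv_DUnit[of 9 2], of 0]) simp_all
  finally have right: "?rhs = ?nf" .
  show ?thesis unfolding left right ..
qed

lemma right_action_unit_left_circuit:
  "run [Mul [] 1, RAct 1 1 2] [hw 2] [dw 1]
    = run [Mul [] 2, Mul [] 20, Ev 1 20] [hw 2] [dw 1]"
  (is "?lhs = ?rhs")
proof -
  let ?run = "\<lambda>gl. run gl [hw 2] [dw 1]"
  have "?lhs = ?run [Mul [] 1, Cop 1 [11, 2, 12], Ap T 12 13, Mul [13, 11] 20, Ev 1 20]"
    by (rule expand_RAct[of 1 2 11 12 13 20 1 1]) simp_all
  also have "\<dots> = ?run [Mul [] 1, Cop 1 [11, 8], Cop 8 [2, 12], Ap T 12 13, Mul [13, 11] 20, Ev 1 20]"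
    by (rule split_cops[of 1 8 "[11]" "[2, 12]" "[]" 1]) simp_all
  also have "\<dots> = ?run [Mul [] 8, Cop 8 [2, 12], Mul [] 11, Ap T 12 13, Mul [13, 11] 20, Ev 1 20]"
    by (rule run_step[OF eqv_unit_comult[of 1 11 8], of 0]) simp_all
  also have "\<dots> = ?run [Mul [] 12, Ap T 12 13, Mul [] 2, Mul [] 11, Mul [13, 11] 20, Ev 1 20]"
    by (rule run_step[OF eqv_unit_comult[of 8 2 12], of 0]) simp_all
  also have "\<dots> = ?run [Mul [] 13, Mul [] 11, Mul [13, 11] 20, Mul [] 2, Ev 1 20]"
    by (rule run_step[OF eqv_T_unit[of 12 13], of 0]) simp_all
  also have "\<dots> = ?run [Mul [] 13, Mul [13] 20, Mul [] 2, Ev 1 20]"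
    by (rule merge_prods[of 20 11 "[13]" "[]" "[]" 1]) simp_all
  also have "\<dots> = ?rhs"
    by (rule merge_prods[of 20 13 "[]" "[]" "[]" 0]) simp_all
  finally show ?thesis .
qed

section \<open>The matched pair\<close>

abbreviation "dcounit \<equiv> ev \<cdot> (D \<otimes> hunit)"
abbreviation "theta \<equiv> (A \<otimes> \<Phi> A D \<otimes> D) \<cdot> (hcomult \<otimes> d)"

lemma rep_theta:
  assumes "distinct [h, a, b]" "distinct [f, p, q]"
  shows "rep [hw h, dw f] theta [Cop h [a, b], DCop f p q] [hw a, dw p, hw b, dw q]"
proof -
  have 1: "rep [hw h, dw f] (hcomult \<otimes> d) [Cop h [a, b], DCop f p q] [hw a, hw b, dw p, dw q]"
    using rep_tensor[OF rep_comult[of h a b] rep_DCop[of f p q]] assms by auto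
  have "rep [hw b, dw p, dw q] (\<Phi> A D \<otimes> D) [] [dw p, hw b, dw q]"
    using rep_tensor[OF rep_braid[of "[hw b]" "[dw p]"] rep_dw[of q]] assms by auto
  from rep_tensor[OF rep_hw[of a] this]
  have "rep [hw a, hw b, dw p, dw q] (A \<otimes> \<Phi> A D \<otimes> D) [] [hw a, dw p, hw b, dw q]"
    using assms by auto
  from rep_comp[OF 1 this] show ?thesis using assms by auto
qed

lemma dual_mult_assoc: "m \<cdot> (m \<otimes> D) = m \<cdot> (D \<otimes> m)"
proof -
  have l: "rep [dw 1, dw 2, dw 3] (m \<cdot> (m \<otimes> D)) [DMul 1 2 4, DMul 4 3 5] ([] @ [dw 5])"
    using rep_comp_eq[OF rep_tensor[OF rep_DMul[of 1 2 4] rep_dw[of 3]] rep_DMul[of 4 3 5]] by simp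
  have r: "rep [dw 1, dw 2, dw 3] (m \<cdot> (D \<otimes> m)) [DMul 2 3 4, DMul 1 4 5] ([] @ [dw 5])"
    using rep_comp_eq[OF rep_tensor[OF rep_dw[of 1] rep_DMul[of 2 3 4]] rep_DMul[of 1 4 5]] by simp
  show ?thesis
    \<comment> \<open>The well-formedness premises are evaluated; the premise that simplification
      alone does not close is the circuit equation, with wire 9 as test argument.\<close>
    by (rule test1[OF l r, of 9]; (simp; fail | use dual_mult_assoc_circuit in simp))
qed

text \<open>The output list is written as an append to fit the pattern \<open>ys @ [dw k]\<close> of
  \<open>test1\<close>.\<close>

lemma rep_D: "rep [dw 1] D [] ([] @ [dw 1])"
  using rep_dw[of 1] by simp

lemma dual_mult_unit: "m \<cdot> (u \<otimes> D) = D" "m \<cdot> (D \<otimes> u) = D"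
proof -
  have l: "rep [dw 1] (m \<cdot> (u \<otimes> D)) [DUnit 2, DMul 2 1 3] ([] @ [dw 3])"
    using rep_comp_eq[OF rep_tensor[OF rep_DUnit[of 2] rep_dw[of 1]] rep_DMul[of 2 1 3]] by simp
  show "m \<cdot> (u \<otimes> D) = D"
    by (rule test1[OF l rep_D, of 9]; (simp; fail | use dual_mult_unit_left_circuit in simp))
  have l: "rep [dw 1] (m \<cdot> (D \<otimes> u)) [DUnit 2, DMul 1 2 3] ([] @ [dw 3])"
    using rep_comp_eq[OF rep_tensor[OF rep_dw[of 1] rep_DUnit[of 2]] rep_DMul[of 1 2 3]] by simp
  show "m \<cdot> (D \<otimes> u) = D"
    by (rule test1[OF l rep_D, of 9]; (simp; fail | use dual_mult_unit_right_circuit in simp))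
qed

lemma dual_comult_coassoc: "(d \<otimes> D) \<cdot> d = (D \<otimes> d) \<cdot> d"
proof -
  have "rep [dw 2, dw 3] (d \<otimes> D) [DCop 2 4 5] [dw 4, dw 5, dw 3]"
    using rep_tensor[OF rep_DCop[of 2 4 5] rep_dw[of 3]] by simp
  from rep_comp[OF rep_DCop[of 1 2 3] this]
  have l: "rep [dw 1] ((d \<otimes> D) \<cdot> d) [DCop 1 2 3, DCop 2 4 5] [dw 4, dw 5, dw 3]"
    by simp
  have "rep [dw 4, dw 6] (D \<otimes> d) [DCop 6 5 3] [dw 4, dw 5, dw 3]"
    using rep_tensor[OF rep_dw[of 4] rep_DCop[of 6 5 3]] by simp
  from rep_comp[OF rep_DCop[of 1 4 6] this]
  have r: "rep [dw 1] ((D \<otimes> d) \<cdot> d) [DCop 1 4 6, DCop 6 5 3] [dw 4, dw 5, dw 3]"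
    by simp
  show ?thesis
    by (rule test3[OF l r, of 9 8 7]; (simp; fail | use dual_comult_coassoc_circuit in simp))
qed

lemma dual_comult_counit: "(dcounit \<otimes> D) \<cdot> d = D" "(D \<otimes> dcounit) \<cdot> d = D"
proof -
  have "rep [dw 2, dw 3] (dcounit \<otimes> D) [Mul [] 4, Ev 2 4] [dw 3]"
    using rep_tensor[OF rep_DCounit[of 2 4] rep_dw[of 3]] by simp
  from rep_comp[OF rep_DCop[of 1 2 3] this]
  have l: "rep [dw 1] ((dcounit \<otimes> D) \<cdot> d) [DCop 1 2 3, Mul [] 4, Ev 2 4] ([] @ [dw 3])"
    by simp
  show "(dcounit \<otimes> D) \<cdot> d = D"
    by (rule test1[OF l rep_D, of 9]; (simp; fail | use dual_counit_left_circuit in simp))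
  have "rep [dw 2, dw 3] (D \<otimes> dcounit) [Mul [] 4, Ev 3 4] [dw 2]"
    using rep_tensor[OF rep_dw[of 2] rep_DCounit[of 3 4]] by simp
  from rep_comp[OF rep_DCop[of 1 2 3] this]
  have l: "rep [dw 1] ((D \<otimes> dcounit) \<cdot> d) [DCop 1 2 3, Mul [] 4, Ev 3 4] ([] @ [dw 2])"
    by simp
  show "(D \<otimes> dcounit) \<cdot> d = D"
    by (rule test1[OF l rep_D, of 9]; (simp; fail | use dual_counit_right_circuit in simp))
qed

lemma dual_comult_mult: "d \<cdot> m = (m \<otimes> m) \<cdot> (D \<otimes> \<Phi> D D \<otimes> D) \<cdot> (d \<otimes> d)"
proof -
  have l: "rep [dw 1, dw 2] (d \<cdot> m) [DMul 1 2 3, DCop 3 8 9] ([] @ [dw 8] @ [dw 9])"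
    using rep_comp_eq[OF rep_DMul[of 1 2 3] rep_DCop[of 3 8 9]] by simp
  have 1: "rep [dw 1, dw 2] (d \<otimes> d) [DCop 1 4 5, DCop 2 6 7] [dw 4, dw 5, dw 6, dw 7]"
    using rep_tensor[OF rep_DCop[of 1 4 5] rep_DCop[of 2 6 7]] by simp
  have "rep [dw 5, dw 6, dw 7] (\<Phi> D D \<otimes> D) [] [dw 6, dw 5, dw 7]"
    using rep_tensor[OF rep_braid[of "[dw 5]" "[dw 6]"] rep_dw[of 7]] by simp
  from rep_tensor[OF rep_dw[of 4] this]
  have 2: "rep [dw 4, dw 5, dw 6, dw 7] (D \<otimes> \<Phi> D D \<otimes> D) [] [dw 4, dw 6, dw 5, dw 7]"
    by simp
  have 3: "rep [dw 4, dw 6, dw 5, dw 7] (m \<otimes> m) [DMul 4 6 8, DMul 5 7 9] ([] @ [dw 8] @ [dw 9])"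
    using rep_tensor[OF rep_DMul[of 4 6 8] rep_DMul[of 5 7 9]] by simp
  have r: "rep [dw 1, dw 2] ((m \<otimes> m) \<cdot> (D \<otimes> \<Phi> D D \<otimes> D) \<cdot> (d \<otimes> d))
      [DCop 1 4 5, DCop 2 6 7, DMul 4 6 8, DMul 5 7 9] ([] @ [dw 8] @ [dw 9])"
    using rep_comp_eq[OF rep_comp_eq[OF 1 2] 3] by simp
  show ?thesis
    by (rule test2[OF l r, of 22 21]; (simp; fail | use dual_comult_mult_circuit in simp))
qed

lemma dual_comult_unit: "d \<cdot> u = u \<otimes> u"
proof -
  have l: "rep [] (d \<cdot> u) [DUnit 1, DCop 1 2 3] ([] @ [dw 2] @ [dw 3])"
    using rep_comp_eq[OF rep_DUnit[of 1] rep_DCop[of 1 2 3]] by simp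
  have r: "rep [] (u \<otimes> u) [DUnit 2, DUnit 3] ([] @ [dw 2] @ [dw 3])"
    using rep_tensor[OF rep_DUnit[of 2] rep_DUnit[of 3]] by simp
  show ?thesis
    by (rule test2[OF l r, of 2 1]; (simp; fail | use dual_comult_unit_circuit in simp))
qed

lemma dual_counit_mult: "dcounit \<cdot> m = dcounit \<otimes> dcounit"
proof -
  have l: "rep [dw 1, dw 2] (dcounit \<cdot> m) [DMul 1 2 3, Mul [] 4, Ev 3 4] []"
    using rep_comp_eq[OF rep_DMul[of 1 2 3] rep_DCounit[of 3 4]] by simp
  have r: "rep [dw 1, dw 2] (dcounit \<otimes> dcounit) [Mul [] 5, Ev 1 5, Mul [] 6, Ev 2 6] []"
    using rep_tensor[OF rep_DCounit[of 1 5] rep_DCounit[of 2 6]] by simp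
  show ?thesis using rep_eq[OF l r dual_counit_mult_circuit] .
qed

lemma dual_counit_unit: "dcounit \<cdot> u = \<one>"
proof -
  have l: "rep [] (dcounit \<cdot> u) [DUnit 1, Mul [] 2, Ev 1 2] []"
    using rep_comp_eq[OF rep_DUnit[of 1] rep_DCounit[of 1 2]] by simp
  have r: "rep [] \<one> [] []" using rep_id[of "[]"] by simp
  show ?thesis using rep_eq[OF l r dual_counit_unit_circuit] .
qed

lemma left_action_mult: "l \<cdot> (hmult \<otimes> D) = l \<cdot> (A \<otimes> l)"
proof -
  have l: "rep [hw 1, hw 2, dw 1] (l \<cdot> (hmult \<otimes> D)) [Mul [1, 2] 3, LAct 3 1 5] ([] @ [dw 5])"
    using rep_comp_eq[OF rep_tensor[OF rep_mult[of 3 1 2] rep_dw[of 1]] rep_LAct[of 1 5 3]] by simp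
  have r: "rep [hw 1, hw 2, dw 1] (l \<cdot> (A \<otimes> l)) [LAct 2 1 4, LAct 1 4 5] ([] @ [dw 5])"
    using rep_comp_eq[OF rep_tensor[OF rep_hw[of 1] rep_LAct[of 1 4 2]] rep_LAct[of 4 5 1]] by simp
  show ?thesis
    by (rule test1[OF l r, of 9]; (simp; fail | use left_action_mult_circuit in simp))
qed

lemma left_action_unit: "l \<cdot> (hunit \<otimes> D) = D"
proof -
  have l: "rep [dw 1] (l \<cdot> (hunit \<otimes> D)) [Mul [] 3, LAct 3 1 5] ([] @ [dw 5])"
    using rep_comp_eq[OF rep_tensor[OF rep_unit[of 3] rep_dw[of 1]] rep_LAct[of 1 5 3]] by simp
  show ?thesis
    by (rule test1[OF l rep_D, of 9]; (simp; fail | use left_action_unit_circuit in simp))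
qed

lemma left_action_comult: "d \<cdot> l = (l \<otimes> l) \<cdot> theta"
proof -
  have l: "rep [hw 1, dw 1] (d \<cdot> l) [LAct 1 1 5, DCop 5 6 7] ([] @ [dw 6] @ [dw 7])"
    using rep_comp_eq[OF rep_LAct[of 1 5 1] rep_DCop[of 5 6 7]] by simp
  have "rep [hw 2, dw 2, hw 3, dw 3] (l \<otimes> l) [LAct 2 2 6, LAct 3 3 7] [dw 6, dw 7]"
    using rep_tensor[OF rep_LAct[of 2 6 2] rep_LAct[of 3 7 3]] by simp
  from rep_comp[OF rep_theta[of 1 2 3 1 2 3] this]
  have r: "rep [hw 1, dw 1] ((l \<otimes> l) \<cdot> theta) [Cop 1 [2, 3], DCop 1 2 3, LAct 2 2 6, LAct 3 3 7] ([] @ [dw 6] @ [dw 7])"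
    by simp
  show ?thesis
    by (rule test2[OF l r, of 9 8]; (simp; fail | use left_action_comult_circuit in simp))
qed

lemma rep_counits: "rep [hw 1, dw 1] (hcounit \<otimes> dcounit) [Cop 1 [], Mul [] 20, Ev 1 20] []"
  using rep_tensor[OF rep_counit[of 1] rep_DCounit[of 1 20]] by simp

lemma left_action_counit: "dcounit \<cdot> l = hcounit \<otimes> dcounit"
proof -
  have l: "rep [hw 1, dw 1] (dcounit \<cdot> l) [LAct 1 1 5, Mul [] 9, Ev 5 9] []"
    using rep_comp_eq[OF rep_LAct[of 1 5 1] rep_DCounit[of 5 9]] by simp
  show ?thesis using rep_eq[OF l rep_counits left_action_counit_circuit] .
qed

lemma right_action_mult: "r \<cdot> (A \<otimes> m) = r \<cdot> (r \<otimes> D)"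
proof -
  have l: "rep [hw 1, dw 1, dw 2] (r \<cdot> (A \<otimes> m)) [DMul 1 2 3, RAct 1 3 2] [hw 2]"
    using rep_comp_eq[OF rep_tensor[OF rep_hw[of 1] rep_DMul[of 1 2 3]] rep_RAct[of 1 2 3]] by simp
  have r: "rep [hw 1, dw 1, dw 2] (r \<cdot> (r \<otimes> D)) [RAct 1 1 4, RAct 4 2 2] [hw 2]"
    using rep_comp_eq[OF rep_tensor[OF rep_RAct[of 1 4 1] rep_dw[of 2]] rep_RAct[of 4 2 2]] by simp
  show ?thesis using rep_eq[OF l r right_action_mult_circuit] .
qed

lemma right_action_unit: "r \<cdot> (A \<otimes> u) = A"
proof -
  have l: "rep [hw 1] (r \<cdot> (A \<otimes> u)) [DUnit 3, RAct 1 3 2] [hw 2]"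
    using rep_comp_eq[OF rep_tensor[OF rep_hw[of 1] rep_DUnit[of 3]] rep_RAct[of 1 2 3]] by simp
  \<comment> \<open>A coproduct with one leg is the identity; it gives the identity arrow different
    names at its two ends, as in the circuit for the action.\<close>
  have r: "rep [hw 1] A [Cop 1 [2]] [hw 2]"
    using rep_Cop[of 1 "[2]"] unfolding copl_small by simp
  show ?thesis using rep_eq[OF l r right_action_unit_circuit] .
qed

lemma right_action_comult: "hcomult \<cdot> r = (r \<otimes> r) \<cdot> theta"
proof -
  have l: "rep [hw 1, dw 1] (hcomult \<cdot> r) [RAct 1 1 5, Cop 5 [6, 7]] [hw 6, hw 7]"
    using rep_comp_eq[OF rep_RAct[of 1 5 1] rep_comult[of 5 6 7]] by simp
  have "rep [hw 2, dw 2, hw 3, dw 3] (r \<otimes> r) [RAct 2 2 6, RAct 3 3 7] [hw 6, hw 7]"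
    using rep_tensor[OF rep_RAct[of 2 6 2] rep_RAct[of 3 7 3]] by simp
  from rep_comp[OF rep_theta[of 1 2 3 1 2 3] this]
  have r: "rep [hw 1, dw 1] ((r \<otimes> r) \<cdot> theta) [Cop 1 [2, 3], DCop 1 2 3, RAct 2 2 6, RAct 3 3 7] [hw 6, hw 7]"
    by simp
  show ?thesis using rep_eq[OF l r right_action_comult_circuit] .
qed

lemma right_action_counit: "hcounit \<cdot> r = hcounit \<otimes> dcounit"
proof -
  have l: "rep [hw 1, dw 1] (hcounit \<cdot> r) [RAct 1 1 5, Cop 5 []] []"
    using rep_comp_eq[OF rep_RAct[of 1 5 1] rep_counit[of 5]] by simp
  show ?thesis using rep_eq[OF l rep_counits right_action_counit_circuit] .
qed

lemma left_action_dual_mult: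
  "l \<cdot> (A \<otimes> m) = m \<cdot> (D \<otimes> l) \<cdot> (l \<otimes> r \<otimes> D) \<cdot> (theta \<otimes> D)"
proof -
  have l: "rep [hw 1, dw 1, dw 2] (l \<cdot> (A \<otimes> m)) [DMul 1 2 3, LAct 1 3 4] ([] @ [dw 4])"
    using rep_comp_eq[OF rep_tensor[OF rep_hw[of 1] rep_DMul[of 1 2 3]] rep_LAct[of 3 4 1]] by simp
  have 1: "rep [hw 1, dw 1, dw 2] (theta \<otimes> D) [Cop 1 [2, 3], DCop 1 5 6] [hw 2, dw 5, hw 3, dw 6, dw 2]"
    using rep_tensor[OF rep_theta[of 1 2 3 1 5 6] rep_dw[of 2]] by simp
  have "rep [hw 3, dw 6, dw 2] (r \<otimes> D) [RAct 3 6 4] [hw 4, dw 2]"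
    using rep_tensor[OF rep_RAct[of 3 4 6] rep_dw[of 2]] by simp
  from rep_tensor[OF rep_LAct[of 5 7 2] this]
  have 2: "rep [hw 2, dw 5, hw 3, dw 6, dw 2] (l \<otimes> r \<otimes> D) [LAct 2 5 7, RAct 3 6 4] [dw 7, hw 4, dw 2]"
    by simp
  have 3: "rep [dw 7, hw 4, dw 2] (D \<otimes> l) [LAct 4 2 8] [dw 7, dw 8]"
    using rep_tensor[OF rep_dw[of 7] rep_LAct[of 2 8 4]] by simp
  have 12: "rep [hw 1, dw 1, dw 2] ((l \<otimes> r \<otimes> D) \<cdot> (theta \<otimes> D)) [Cop 1 [2, 3], DCop 1 5 6, LAct 2 5 7, RAct 3 6 4] [dw 7, hw 4, dw 2]"
    using rep_comp[OF 1 2] by simp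
  have 123: "rep [hw 1, dw 1, dw 2] ((D \<otimes> l) \<cdot> (l \<otimes> r \<otimes> D) \<cdot> (theta \<otimes> D))
      [Cop 1 [2, 3], DCop 1 5 6, LAct 2 5 7, RAct 3 6 4, LAct 4 2 8] [dw 7, dw 8]"
    using rep_comp[OF 12 3] by simp
  have r: "rep [hw 1, dw 1, dw 2] (m \<cdot> (D \<otimes> l) \<cdot> (l \<otimes> r \<otimes> D) \<cdot> (theta \<otimes> D))
      [Cop 1 [2, 3], DCop 1 5 6, LAct 2 5 7, RAct 3 6 4, LAct 4 2 8, DMul 7 8 10] ([] @ [dw 10])"
    using rep_comp[OF 123 rep_DMul[of 7 8 10]] by simp
  show ?thesis
    by (rule test1[OF l r, of 9]; (simp; fail | use left_action_dual_mult_circuit in simp))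
qed

lemma right_action_mult_left:
  "r \<cdot> (hmult \<otimes> D) = hmult \<cdot> (r \<otimes> A) \<cdot> (A \<otimes> l \<otimes> r) \<cdot> (A \<otimes> theta)"
proof -
  have l: "rep [hw 1, hw 2, dw 1] (r \<cdot> (hmult \<otimes> D)) [Mul [1, 2] 4, RAct 4 1 3] [hw 3]"
    using rep_comp_eq[OF rep_tensor[OF rep_mult[of 4 1 2] rep_dw[of 1]] rep_RAct[of 4 3 1]] by simp
  have 1: "rep [hw 1, hw 2, dw 1] (A \<otimes> theta) [Cop 2 [4, 5], DCop 1 2 3] [hw 1, hw 4, dw 2, hw 5, dw 3]"
    using rep_tensor[OF rep_hw[of 1] rep_theta[of 2 4 5 1 2 3]] by simp
  have "rep [hw 4, dw 2, hw 5, dw 3] (l \<otimes> r) [LAct 4 2 4, RAct 5 3 23] [dw 4, hw 23]"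
    using rep_tensor[OF rep_LAct[of 2 4 4] rep_RAct[of 5 23 3]] by simp
  from rep_tensor[OF rep_hw[of 1] this]
  have 2: "rep [hw 1, hw 4, dw 2, hw 5, dw 3] (A \<otimes> l \<otimes> r) [LAct 4 2 4, RAct 5 3 23] [hw 1, dw 4, hw 23]"
    by simp
  have 3: "rep [hw 1, dw 4, hw 23] (r \<otimes> A) [RAct 1 4 13] [hw 13, hw 23]"
    using rep_tensor[OF rep_RAct[of 1 13 4] rep_hw[of 23]] by simp
  have 12: "rep [hw 1, hw 2, dw 1] ((A \<otimes> l \<otimes> r) \<cdot> (A \<otimes> theta))
      [Cop 2 [4, 5], DCop 1 2 3, LAct 4 2 4, RAct 5 3 23] [hw 1, dw 4, hw 23]"
    using rep_comp[OF 1 2] by simp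
  have 123: "rep [hw 1, hw 2, dw 1] ((r \<otimes> A) \<cdot> (A \<otimes> l \<otimes> r) \<cdot> (A \<otimes> theta))
      [Cop 2 [4, 5], DCop 1 2 3, LAct 4 2 4, RAct 5 3 23, RAct 1 4 13] [hw 13, hw 23]"
    using rep_comp[OF 12 3] by simp
  have r: "rep [hw 1, hw 2, dw 1] (hmult \<cdot> (r \<otimes> A) \<cdot> (A \<otimes> l \<otimes> r) \<cdot> (A \<otimes> theta))
      [Cop 2 [4, 5], DCop 1 2 3, LAct 4 2 4, RAct 5 3 23, RAct 1 4 13, Mul [13, 23] 3] [hw 3]"
    using rep_comp[OF 123 rep_mult[of 3 13 23]] by simp
  show ?thesis using rep_eq[OF l r right_action_mult_left_circuit] .
qed

lemma actions_commute: "\<Phi> D A \<cdot> (l \<otimes> r) \<cdot> theta = (r \<otimes> l) \<cdot> theta"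
proof -
  have "rep [hw 3, dw 3, hw 4, dw 4] (l \<otimes> r) [LAct 3 3 2, RAct 4 4 2] [dw 2, hw 2]"
    using rep_tensor[OF rep_LAct[of 3 2 3] rep_RAct[of 4 2 4]] by simp
  from rep_comp[OF rep_theta[of 1 3 4 1 3 4] this]
  have lr: "rep [hw 1, dw 1] ((l \<otimes> r) \<cdot> theta) [Cop 1 [3, 4], DCop 1 3 4, LAct 3 3 2, RAct 4 4 2] [dw 2, hw 2]"
    by simp
  have "rep [dw 2, hw 2] (\<Phi> D A) [] [hw 2, dw 2]"
    using rep_braid[of "[dw 2]" "[hw 2]"] by simp
  from rep_comp[OF lr this]
  have l: "rep [hw 1, dw 1] (\<Phi> D A \<cdot> (l \<otimes> r) \<cdot> theta) [Cop 1 [3, 4], DCop 1 3 4, LAct 3 3 2, RAct 4 4 2] ([hw 2] @ [dw 2])"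
    by simp
  have "rep [hw 3, dw 3, hw 4, dw 4] (r \<otimes> l) [RAct 3 3 2, LAct 4 4 2] [hw 2, dw 2]"
    using rep_tensor[OF rep_RAct[of 3 2 3] rep_LAct[of 4 2 4]] by simp
  from rep_comp[OF rep_theta[of 1 3 4 1 3 4] this]
  have r: "rep [hw 1, dw 1] ((r \<otimes> l) \<cdot> theta) [Cop 1 [3, 4], DCop 1 3 4, RAct 3 3 2, LAct 4 4 2] ([hw 2] @ [dw 2])"
    by simp
  show ?thesis
    by (rule test1[OF l r, of 9]; (simp; fail | use actions_commute_circuit in simp))
qed

lemma left_action_dual_unit: "l \<cdot> (A \<otimes> u) = u \<cdot> hcounit"
proof -
  have l: "rep [hw 1] (l \<cdot> (A \<otimes> u)) [DUnit 1, LAct 1 1 2] ([] @ [dw 2])"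
    using rep_comp_eq[OF rep_tensor[OF rep_hw[of 1] rep_DUnit[of 1]] rep_LAct[of 1 2 1]] by simp
  have r: "rep [hw 1] (u \<cdot> hcounit) [Cop 1 [], DUnit 2] ([] @ [dw 2])"
    using rep_comp_eq[OF rep_counit[of 1] rep_DUnit[of 2]] by simp
  show ?thesis
    by (rule test1[OF l r, of 9]; (simp; fail | use left_action_dual_unit_circuit in simp))
qed

lemma right_action_unit_left: "r \<cdot> (hunit \<otimes> D) = hunit \<cdot> dcounit"
proof -
  have l: "rep [dw 1] (r \<cdot> (hunit \<otimes> D)) [Mul [] 1, RAct 1 1 2] [hw 2]"
    using rep_comp_eq[OF rep_tensor[OF rep_unit[of 1] rep_dw[of 1]] rep_RAct[of 1 2 1]] by simp
  have "rep [dw 1] (hunit \<cdot> dcounit) [Mul [] 20, Ev 1 20, Mul [] 2] [hw 2]"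
    using rep_comp_eq[OF rep_DCounit[of 1 20] rep_unit[of 2]] by simp
  then have r: "rep [dw 1] (hunit \<cdot> dcounit) [Mul [] 2, Mul [] 20, Ev 1 20] [hw 2]"
    by (rule rep_mset) simp_all
  show ?thesis using rep_eq[OF l r right_action_unit_left_circuit] .
qed

lemma matched_pair_dual:
  "matched_pair C \<lparr>Obj = D, Mult = m, Unit = u, Comult = d, Counit = dcounit\<rparr> H l r"
  unfolding matched_pair_def left_module_coalgebra_def right_module_coalgebra_def Theta_def bialgebra_def[of C "\<lparr>Obj = _, Mult = _, Unit = _, Comult = _, Counit = _\<rparr>"]
  using bialgebra
  by (simp add: bialgebra_def algebra_def coalgebra_def hom_iff dual_mult_assoc dual_mult_unit dual_comult_coassoc dual_comult_counit dual_comult_mult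
      dual_comult_unit dual_counit_mult dual_counit_unit left_action_mult left_action_unit left_action_comult left_action_counit
      right_action_mult right_action_unit right_action_comult right_action_counit left_action_dual_mult right_action_mult_left
      actions_commute left_action_dual_unit right_action_unit_left)

end

lemma op_bialg_sel:
  "Obj (op_bialg C H) = Obj H" "Mult (op_bialg C H) = Comp C (Mult H) (Braid C (Obj H) (Obj H))"
  "Unit (op_bialg C H) = Unit H" "Comult (op_bialg C H) = Comult H" "Counit (op_bialg C H) = Counit H"
  by (simp_all add: op_bialg_def)

theorem proposition4p2:
  fixes C :: "'a braided_cat" (structure)
    and H :: "'a bialg_data" and S Hs ev :: 'a
  assumes "strict_braided_monoidal_category C"
    and "hopf_algebra C H S"
    and "is_iso C S"
    and "finite_object C \<langle>H\<rangle>"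
    and "internal_hom C \<langle>H\<rangle> \<one> Hs ev"
    and "\<Phi> \<langle>H\<rangle> \<langle>H\<rangle> = inv_arrow C (\<Phi> \<langle>H\<rangle> \<langle>H\<rangle>)"
    and "\<Phi> \<langle>H\<rangle> Hs = inv_arrow C (\<Phi> Hs \<langle>H\<rangle>)"
  shows "matched_pair C (dual_bialg C (op_bialg C H) Hs ev) H
           (left_action C H S Hs ev) (right_action C H S Hs ev)"
proof -
  interpret strict_braided_monoidal_category C by (rule assms(1))
  \<comment> \<open>Finiteness turns the given internal hom into a dual.\<close>
  obtain coev where "dual_object C \<langle>H\<rangle> Hs ev coev"
    using finite_object_dual[OF assms(4,5)] by blast
  then interpret dual_object C "\<langle>H\<rangle>" Hs ev coev .
  let ?T = "inv_arrow C S"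
  have b: "is_iso C (\<Phi> \<langle>H\<rangle> \<langle>H\<rangle>)" "is_iso C (\<Phi> Hs \<langle>H\<rangle>)" by (rule braid_iso; simp)+
  interpret hopf_double C H Hs ev coev S ?T
  proof unfold_locales
    show "bialgebra C H" "hopf_algebra C H S" using assms(2) by (auto simp: hopf_algebra_def)
    show "inverse_arrows C S ?T" by (rule inv_arrow_inverse[OF assms(3)])
    show "\<Phi> \<langle>H\<rangle> \<langle>H\<rangle> \<cdot> \<Phi> \<langle>H\<rangle> \<langle>H\<rangle> = \<langle>H\<rangle> \<otimes> \<langle>H\<rangle>"
      using inv_arrow_facts(6)[OF b(1)] assms(6) by simp
    show "\<Phi> \<langle>H\<rangle> Hs \<cdot> \<Phi> Hs \<langle>H\<rangle> = Hs \<otimes> \<langle>H\<rangle>" "\<Phi> Hs \<langle>H\<rangle> \<cdot> \<Phi> \<langle>H\<rangle> Hs = \<langle>H\<rangle> \<otimes> Hs"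
      using inv_arrow_facts(5,6)[OF b(2)] assms(7) by simp_all
  qed
  let ?B = "dual_bialg C (op_bialg C H) Hs ev"
  \<comment> \<open>Unique existence turns each definite description in \<open>dual_bialg\<close>
    and \<open>left_action\<close> into its characterising equation. For \<open>m\<close> and
    \<open>u\<close> it is the universal property of the internal hom.\<close>
  have m: "\<exists>!m. m \<in> hom C (Hs \<otimes> Hs) Hs \<and>
      ev \<cdot> (m \<otimes> \<langle>H\<rangle>) = (ev \<otimes> ev) \<cdot> (Hs \<otimes> \<Phi> Hs \<langle>H\<rangle> \<otimes> \<langle>H\<rangle>) \<cdot> (Hs \<otimes> Hs \<otimes> \<Delta>\<^bsub>H\<^esub>)"
    using assms(5) unfolding internal_hom_def by (auto simp: hom_iff)
  have u: "\<exists>!u. u \<in> hom C \<one> Hs \<and> ev \<cdot> (u \<otimes> \<langle>H\<rangle>) = \<epsilon>\<^bsub>H\<^esub>"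
    using assms(5) unfolding internal_hom_def by (auto simp: hom_iff)
  have d: "\<exists>!d. d \<in> hom C Hs (Hs \<otimes> Hs) \<and>
      (ev \<otimes> ev) \<cdot> (Hs \<otimes> \<Phi> Hs \<langle>H\<rangle> \<otimes> \<langle>H\<rangle>) \<cdot> (d \<otimes> \<langle>H\<rangle> \<otimes> \<langle>H\<rangle>) = ev \<cdot> (Hs \<otimes> (\<nabla>\<^bsub>H\<^esub> \<cdot> \<Phi> \<langle>H\<rangle> \<langle>H\<rangle>))"
    by (rule pairing2_unique) (simp add: hom_iff)
  have l: "\<exists>!l. l \<in> hom C (\<langle>H\<rangle> \<otimes> Hs) Hs \<and> (ev \<cdot> \<Phi> \<langle>H\<rangle> Hs) \<cdot> (\<langle>H\<rangle> \<otimes> l) =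
      (ev \<cdot> \<Phi> \<langle>H\<rangle> Hs) \<cdot> ((\<nabla>\<^bsub>H\<^esub> \<cdot> \<Phi> \<langle>H\<rangle> \<langle>H\<rangle> \<cdot> (\<nabla>\<^bsub>H\<^esub> \<otimes> ?T) \<cdot> (\<langle>H\<rangle> \<otimes> \<Delta>\<^bsub>H\<^esub>)) \<otimes> Hs)"
    by (rule ev_bar_unique) (simp add: hom_iff)
  have "double_actions C H Hs ev coev S ?T (Mult ?B) (Unit ?B) (Comult ?B)
      (left_action C H S Hs ev) (right_action C H S Hs ev)"
  proof unfold_locales
    \<comment> \<open>The braiding of \<open>H\<close> with itself is its own inverse, so the
      inverse in the definition may be replaced by the braiding.\<close>
    show "right_action C H S Hs ev = (\<langle>H\<rangle> \<otimes> (ev \<cdot> \<Phi> \<langle>H\<rangle> Hs)) \<cdot> (\<langle>H\<rangle> \<otimes> (\<nabla>\<^bsub>H\<^esub> \<cdot> \<Phi> \<langle>H\<rangle> \<langle>H\<rangle>) \<otimes> Hs) \<cdot>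
      (\<Phi> \<langle>H\<rangle> \<langle>H\<rangle> \<otimes> ?T \<otimes> Hs) \<cdot> (((\<Delta>\<^bsub>H\<^esub> \<otimes> \<langle>H\<rangle>) \<cdot> \<Delta>\<^bsub>H\<^esub>) \<otimes> Hs)"
      unfolding right_action_def ev_bar_def assms(6)[symmetric] ..
  qed (use theI'[OF m] theI'[OF u] theI'[OF d] theI'[OF l]
      in \<open>simp_all only: left_action_def ev_bar_def dual_bialg_def op_bialg_sel bialg_data.simps\<close>)
  from double_actions.matched_pair_dual[OF this]
  show ?thesis by (simp add: dual_bialg_def op_bialg_sel)
qed

end
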